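(* Endow $GL_N(\mathbb C)\times GL_N(\mathbb C)\ni(B,C)$ with the Poisson Lie group structure $$\{\overset{1}{B},\overset{2}{B}\}=r_{12}\overset{1}{B}\overset{2}{B}-\overset{1}{B}\overset{2}{B}r_{12},\quad \{\overset{1}{C},\overset{2}{C}\}=r_{12}\overset{1}{C}\overset{2}{C}-\overset{1}{C}\overset{2}{C}r_{12},\quad \{\overset{1}{C},\overset{2}{B}\}=r_{12}\overset{1}{C}\overset{2}{B}-\overset{1}{C}\overset{2}{B}r_{12}.$$ The map $$\Theta: GL_N\times GL_N\to GL_N\times GL_N,\qquad (B,C)\mapsto (C^{-\mathrm T},B^{-\mathrm T}),$$ is an involutive anti-Poisson automorphism, so that $(GL_N\times GL_N,\Theta)$ is a Poisson symmetric Lie group. Let $H\subset GL_N\times GL_N$ be the fixed point set of $\Theta$. Then the immersion $$i:(GL_N\times GL_N)/H\to\mathcal A,\qquad (B,C)\mapsto BC^{\mathrm T},$$ is a Poisson isomorphism, where $\mathcal A$ carries the Poisson bracket $$\{\overset{1}{\mathbb A},\overset{2}{\mathbb A}\}=r_{12}\overset{1}{\mathbb A}\overset{2}{\mathbb A}-\overset{1}{\mathbb A}\overset{2}{\mathbb A}r_{12}+\overset{1}{\mathbb A}r_{12}^{t_1}\overset{2}{\mathbb A}-\overset{2}{\mathbb A}r_{12}^{t_1}\overset{1}{\mathbb A}.$$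
   Context: $\mathcal A$ is the space of bilinear forms $\langle x,y\rangle=x^{\mathrm T}\mathbb A y$ on $\mathbb C^N$, identified with their defining matrices $\mathbb A\in\mathrm{Mat}_N(\mathbb C)$. $E_{i,j}$ are the $N\times N$ matrix units. For an $N\times N$ matrix $X$ write $\overset{1}{X}=X\otimes I$, $\overset{2}{X}=I\otimes X$, where $I$ is the $N\times N$ identity matrix, and $X^{-\mathrm T}=(X^{-1})^{\mathrm T}$. For $T\in \mathrm{Mat}_N\otimes\mathrm{Mat}_N$, $T^{t_1}$ denotes transposition in the first tensor factor. $\{\overset{1}{X},\overset{2}{Y}\}=\sum_{i,j,k,l}\{x_{i,j},y_{k,l}\}E_{i,j}\otimes E_{k,l}$. The classical $r$-matrix is $$r_{12}=\sum_i E_{i,i}\otimes E_{i,i}+2\sum_{i>j}E_{i,j}\otimes E_{j,i}.$$ A Poisson symmetric Lie group is a pair $(G,\Theta)$ consisting of a Poisson Lie group $G$ and an involutive group automorphism $\Theta$ of $G$ which is anti-Poisson. The quotient $(GL_N\times GL_N)/H$ consists of classes of pairs under $(B_1,C_1)\sim(B_2,C_2)$ iff $(B_1,C_1)=(B_2H_1,C_2H_2)$ for some $(H_1,H_2)\in H$, and carries the unique Poisson structure for which the coset projection $GL_N\times GL_N\to (GL_N\times GL_N)/H$ is a Poisson map.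
   Formalization: Since BCᵀ is always invertible, i is not onto 𝒜 (the zero form is missed); the isomorphism is stated onto its image, the open set of nondegenerate forms with the restricted bracket, and i is also stated to be a Poisson map into all of 𝒜. *)

theory Defs
  imports "HOL-Analysis.Analysis" "HOL-Algebra.Left_Coset"
begin

class scaleC =
  fixes scaleC :: "complex \<Rightarrow> 'a \<Rightarrow> 'a"  (infixr \<open>*\<^sub>C\<close> 75)

class complex_normed_vector = scaleC + real_normed_vector +
  assumes scaleC_add_right: "a *\<^sub>C (x + y) = a *\<^sub>C x + a *\<^sub>C y"
    and scaleC_add_left: "(a + b) *\<^sub>C x = a *\<^sub>C x + b *\<^sub>C x"
    and scaleC_scaleC: "a *\<^sub>C b *\<^sub>C x = (a * b) *\<^sub>C x"
    and scaleR_scaleC: "t *\<^sub>R x = complex_of_real t *\<^sub>C x"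
    and norm_scaleC: "norm (a *\<^sub>C x) = cmod a * norm x"

instantiation complex :: complex_normed_vector
begin
definition scaleC_complex_def: "a *\<^sub>C (x::complex) = a * x"
instance
  by standard (simp_all add: scaleC_complex_def algebra_simps norm_mult scaleR_conv_of_real)
end

instantiation vec :: (complex_normed_vector, finite) complex_normed_vector
begin
definition scaleC_vec_def: "a *\<^sub>C (x::'a^'b) = (\<chi> i. a *\<^sub>C (x $ i))"
instance
proof
  fix a :: complex and x :: "'a^'b"
  show "norm (a *\<^sub>C x) = cmod a * norm x"
    by (simp add: norm_vec_def scaleC_vec_def norm_scaleC L2_set_right_distrib)
qed (simp_all add: scaleC_vec_def vec_eq_iff scaleC_add_right scaleC_add_left scaleC_scaleC
      scaleR_scaleC)
end

instantiation prod :: (complex_normed_vector, complex_normed_vector) complex_normed_vector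
begin
definition scaleC_prod_def: "a *\<^sub>C (x::'a \<times> 'b) = (a *\<^sub>C fst x, a *\<^sub>C snd x)"
instance
proof
  fix a :: complex and x :: "'a \<times> 'b"
  have "sqrt ((cmod a * norm (fst x))\<^sup>2 + (cmod a * norm (snd x))\<^sup>2) =
      sqrt ((cmod a)\<^sup>2 * ((norm (fst x))\<^sup>2 + (norm (snd x))\<^sup>2))"
    by (simp add: power_mult_distrib distrib_left)
  then show "norm (a *\<^sub>C x) = cmod a * norm x"
    by (simp add: norm_prod_def scaleC_prod_def norm_scaleC real_sqrt_mult)
qed (simp_all add: scaleC_prod_def prod_eq_iff scaleC_add_right scaleC_add_left scaleC_scaleC
      scaleR_scaleC)
end

definition holo :: "'a::complex_normed_vector set \<Rightarrow> ('a \<Rightarrow> complex) set" where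
  "holo U = {f. \<forall>x\<in>U. \<exists>D. (f has_derivative D) (at x) \<and> (\<forall>c v. D (c *\<^sub>C v) = c * D v)}"

text \<open>A complex manifold is given by its topology and by the sheaf of holomorphic functions
  (the field hol; hol M U is meant for open U). Functions are total, only their
  values on U matter. A Poisson structure is a Poisson bracket on this sheaf. The bracket is a
  local operation, so a single operation serves for all open sets at once.\<close>

record 'a poisson_space =
  topol :: "'a topology"
  hol :: "'a set \<Rightarrow> ('a \<Rightarrow> complex) set"
  pbr :: "('a \<Rightarrow> complex) \<Rightarrow> ('a \<Rightarrow> complex) \<Rightarrow> 'a \<Rightarrow> complex"

definition poisson_structure :: "'a poisson_space \<Rightarrow> bool" where
  "poisson_structure M \<longleftrightarrow>
    (\<forall>U. openin (topol M) U \<longrightarrow>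
      (\<forall>f\<in>hol M U. \<forall>f'\<in>hol M U. \<forall>g\<in>hol M U. (\<forall>x\<in>U. f x = f' x) \<longrightarrow>
          (\<forall>x\<in>U. pbr M f g x = pbr M f' g x)) \<and>
      (\<forall>f\<in>hol M U. \<forall>g\<in>hol M U. pbr M f g \<in> hol M U \<and>
          (\<forall>x\<in>U. pbr M g f x = - pbr M f g x)) \<and>
      (\<forall>f\<in>hol M U. \<forall>g\<in>hol M U. \<forall>h\<in>hol M U. \<forall>x\<in>U.
          (\<forall>a b. pbr M (\<lambda>y. a * f y + b * g y) h x = a * pbr M f h x + b * pbr M g h x) \<and>
          pbr M (\<lambda>y. f y * g y) h x = f x * pbr M g h x + pbr M f h x * g x \<and>
          pbr M f (pbr M g h) x + pbr M g (pbr M h f) x + pbr M h (pbr M f g) x = 0))"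

definition holo_map :: "'a poisson_space \<Rightarrow> 'b poisson_space \<Rightarrow> ('a \<Rightarrow> 'b) \<Rightarrow> bool" where
  "holo_map M N \<phi> \<longleftrightarrow> continuous_map (topol M) (topol N) \<phi> \<and>
    (\<forall>V f. openin (topol N) V \<longrightarrow> f \<in> hol N V \<longrightarrow>
      f \<circ> \<phi> \<in> hol M {x \<in> topspace (topol M). \<phi> x \<in> V})"

definition poisson_map :: "'a poisson_space \<Rightarrow> 'b poisson_space \<Rightarrow> ('a \<Rightarrow> 'b) \<Rightarrow> bool" where
  "poisson_map M N \<phi> \<longleftrightarrow> holo_map M N \<phi> \<and>
    (\<forall>V. openin (topol N) V \<longrightarrow> (\<forall>f\<in>hol N V. \<forall>g\<in>hol N V.
      \<forall>x\<in>topspace (topol M). \<phi> x \<in> V \<longrightarrow> pbr M (f \<circ> \<phi>) (g \<circ> \<phi>) x = pbr N f g (\<phi> x)))"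

definition anti_poisson_map :: "'a poisson_space \<Rightarrow> 'b poisson_space \<Rightarrow> ('a \<Rightarrow> 'b) \<Rightarrow> bool" where
  "anti_poisson_map M N \<phi> \<longleftrightarrow> holo_map M N \<phi> \<and>
    (\<forall>V. openin (topol N) V \<longrightarrow> (\<forall>f\<in>hol N V. \<forall>g\<in>hol N V.
      \<forall>x\<in>topspace (topol M). \<phi> x \<in> V \<longrightarrow> pbr M (f \<circ> \<phi>) (g \<circ> \<phi>) x = - pbr N f g (\<phi> x)))"

definition poisson_iso :: "'a poisson_space \<Rightarrow> 'b poisson_space \<Rightarrow> ('a \<Rightarrow> 'b) \<Rightarrow> bool" where
  "poisson_iso M N \<phi> \<longleftrightarrow>
    bij_betw \<phi> (topspace (topol M)) (topspace (topol N)) \<and>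
    poisson_map M N \<phi> \<and> poisson_map N M (inv_into (topspace (topol M)) \<phi>)"

definition open_space ::
  "'a::complex_normed_vector set \<Rightarrow> (('a \<Rightarrow> complex) \<Rightarrow> ('a \<Rightarrow> complex) \<Rightarrow> 'a \<Rightarrow> complex)
    \<Rightarrow> 'a poisson_space" where
  "open_space S br = \<lparr>topol = top_of_set S, hol = holo, pbr = br\<rparr>"

definition prod_bracket ::
  "(('a \<Rightarrow> complex) \<Rightarrow> ('a \<Rightarrow> complex) \<Rightarrow> 'a \<Rightarrow> complex) \<Rightarrow>
   (('b \<Rightarrow> complex) \<Rightarrow> ('b \<Rightarrow> complex) \<Rightarrow> 'b \<Rightarrow> complex) \<Rightarrow>
   ('a \<times> 'b \<Rightarrow> complex) \<Rightarrow> ('a \<times> 'b \<Rightarrow> complex) \<Rightarrow> 'a \<times> 'b \<Rightarrow> complex" where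
  "prod_bracket br1 br2 f g = (\<lambda>(x, y).
      br1 (\<lambda>x'. f (x', y)) (\<lambda>x'. g (x', y)) x + br2 (\<lambda>y'. f (x, y')) (\<lambda>y'. g (x, y')) y)"

text \<open>The quotient has the image of q as underlying set and carries the quotient topology; a
  function on it is holomorphic iff its pullback is. For the projection of a complex Lie group onto the cosets
  of a closed complex subgroup (a holomorphic submersion) this is the complex structure of the
  homogeneous space. The bracket br on the quotient is a parameter.\<close>

definition quotient_top :: "'a topology \<Rightarrow> ('a \<Rightarrow> 'b) \<Rightarrow> 'b topology" where
  "quotient_top X q = topology (\<lambda>V. V \<subseteq> q ` topspace X \<and> openin X {x \<in> topspace X. q x \<in> V})"

lemma openin_quotient_top:
  "openin (quotient_top X q) V \<longleftrightarrow> V \<subseteq> q ` topspace X \<and> openin X {x \<in> topspace X. q x \<in> V}"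
proof -
  have "istopology (\<lambda>V. V \<subseteq> q ` topspace X \<and> openin X {x \<in> topspace X. q x \<in> V})"
    unfolding istopology_def
  proof (intro conjI allI impI)
    fix S T
    assume "S \<subseteq> q ` topspace X \<and> openin X {x \<in> topspace X. q x \<in> S}"
      and "T \<subseteq> q ` topspace X \<and> openin X {x \<in> topspace X. q x \<in> T}"
    then have "openin X ({x \<in> topspace X. q x \<in> S} \<inter> {x \<in> topspace X. q x \<in> T})"
      by blast
    moreover have "{x \<in> topspace X. q x \<in> S} \<inter> {x \<in> topspace X. q x \<in> T}
        = {x \<in> topspace X. q x \<in> S \<inter> T}"
      by blast
    ultimately show "openin X {x \<in> topspace X. q x \<in> S \<inter> T}"
      by simp
  next
    fix K
    assume K: "\<forall>V\<in>K. V \<subseteq> q ` topspace X \<and> openin X {x \<in> topspace X. q x \<in> V}"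
    then have "openin X (\<Union>V\<in>K. {x \<in> topspace X. q x \<in> V})"
      by blast
    moreover have "(\<Union>V\<in>K. {x \<in> topspace X. q x \<in> V}) = {x \<in> topspace X. q x \<in> \<Union>K}"
      by blast
    ultimately show "openin X {x \<in> topspace X. q x \<in> \<Union>K}"
      by simp
  qed blast+
  then show ?thesis
    by (simp add: quotient_top_def)
qed

lemma topspace_quotient_top: "topspace (quotient_top X q) = q ` topspace X"
proof -
  have "{x \<in> topspace X. q x \<in> q ` topspace X} = topspace X"
    by blast
  then have "openin (quotient_top X q) (q ` topspace X)"
    by (simp add: openin_quotient_top)
  moreover have "topspace (quotient_top X q) \<subseteq> q ` topspace X"
    using openin_quotient_top[of X q "topspace (quotient_top X q)"] by simp
  ultimately show ?thesis
    by (simp add: openin_subset subset_antisym)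
qed

definition quotient_space ::
  "'a poisson_space \<Rightarrow> ('a \<Rightarrow> 'b) \<Rightarrow> (('b \<Rightarrow> complex) \<Rightarrow> ('b \<Rightarrow> complex) \<Rightarrow> 'b \<Rightarrow> complex)
    \<Rightarrow> 'b poisson_space" where
  "quotient_space M q br =
    \<lparr>topol = quotient_top (topol M) q,
     hol = (\<lambda>V. {f. f \<circ> q \<in> hol M {x \<in> topspace (topol M). q x \<in> V}}),
     pbr = br\<rparr>"

definition quotient_poisson_bracket ::
  "'a poisson_space \<Rightarrow> ('a \<Rightarrow> 'b) \<Rightarrow> (('b \<Rightarrow> complex) \<Rightarrow> ('b \<Rightarrow> complex) \<Rightarrow> 'b \<Rightarrow> complex)
    \<Rightarrow> bool" where
  "quotient_poisson_bracket M q br \<longleftrightarrow>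
    poisson_structure (quotient_space M q br) \<and> poisson_map M (quotient_space M q br) q"

text \<open>Only groups whose underlying manifold is an open subset of a complex vector space occur.\<close>

definition poisson_lie_group ::
  "('a::complex_normed_vector) monoid \<Rightarrow> (('a \<Rightarrow> complex) \<Rightarrow> ('a \<Rightarrow> complex) \<Rightarrow> 'a \<Rightarrow> complex)
    \<Rightarrow> bool" where
  "poisson_lie_group G br \<longleftrightarrow>
    group G \<and> open (carrier G) \<and>
    poisson_structure (open_space (carrier G) br) \<and>
    poisson_map (open_space (carrier G \<times> carrier G) (prod_bracket br br))
      (open_space (carrier G) br) (\<lambda>(x, y). x \<otimes>\<^bsub>G\<^esub> y) \<and>
    holo_map (open_space (carrier G) br) (open_space (carrier G) br) (\<lambda>x. inv\<^bsub>G\<^esub> x)"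

definition poisson_symmetric_lie_group ::
  "('a::complex_normed_vector) monoid \<Rightarrow> (('a \<Rightarrow> complex) \<Rightarrow> ('a \<Rightarrow> complex) \<Rightarrow> 'a \<Rightarrow> complex)
    \<Rightarrow> ('a \<Rightarrow> 'a) \<Rightarrow> bool" where
  "poisson_symmetric_lie_group G br \<Theta> \<longleftrightarrow>
    poisson_lie_group G br \<and>
    \<Theta> \<in> iso G G \<and> (\<forall>g\<in>carrier G. \<Theta> (\<Theta> g) = g) \<and>
    anti_poisson_map (open_space (carrier G) br) (open_space (carrier G) br) \<Theta>"

text \<open>The tensor product of two copies of the matrix algebra is realised by matrices indexed by
  pairs (Kronecker product): the coefficient of the tensor product of the units E i j and E k l is the entry in row (i,k) and
  column (j,l), and the product is matrix multiplication.\<close>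

type_synonym 'n cmat = "complex^'n^'n"
type_synonym 'n ctensor = "complex^('n \<times> 'n)^('n \<times> 'n)"

definition mat_unit :: "'n::finite \<Rightarrow> 'n \<Rightarrow> 'n cmat" where
  "mat_unit i j = axis i (axis j 1)"

definition tensor ::
  "'n cmat \<Rightarrow> 'n cmat \<Rightarrow> 'n::finite ctensor"
  (infixl \<open>\<otimes>\<^sub>K\<close> 75) where
  "X \<otimes>\<^sub>K Y = (\<chi> p q. X $ fst p $ fst q * Y $ snd p $ snd q)"

definition in1 :: "'n cmat \<Rightarrow> 'n::finite ctensor" where
  "in1 X = X \<otimes>\<^sub>K mat 1"

definition in2 :: "'n cmat \<Rightarrow> 'n::finite ctensor" where
  "in2 X = mat 1 \<otimes>\<^sub>K X"

definition transpose1 ::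
  "'n ctensor \<Rightarrow> 'n::finite ctensor" where
  "transpose1 T = (\<chi> p q. T $ (fst q, snd p) $ (fst p, snd q))"

definition r_mat :: "'n::{finite,linorder} ctensor" where
  "r_mat = (\<Sum>i\<in>UNIV. mat_unit i i \<otimes>\<^sub>K mat_unit i i)
         + 2 *\<^sub>R (\<Sum>(i, j)\<in>{(i, j). i > j}. mat_unit i j \<otimes>\<^sub>K mat_unit j i)"

definition tensor_bracket ::
  "(('a \<Rightarrow> complex) \<Rightarrow> ('a \<Rightarrow> complex) \<Rightarrow> 'a \<Rightarrow> complex) \<Rightarrow>
   ('a \<Rightarrow> 'n cmat) \<Rightarrow> ('a \<Rightarrow> 'n cmat) \<Rightarrow>
   'a \<Rightarrow> 'n::finite ctensor" where
  "tensor_bracket br X Y a = (\<Sum>i\<in>UNIV. \<Sum>j\<in>UNIV. \<Sum>k\<in>UNIV. \<Sum>l\<in>UNIV.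
     br (\<lambda>x. X x $ i $ j) (\<lambda>x. Y x $ k $ l) a *\<^sub>C (mat_unit i j \<otimes>\<^sub>K mat_unit k l))"

text \<open>A bracket prescribed on coordinate functions is extended to holomorphic functions as a
  biderivation: the sum over all pairs of coordinates of (partial derivative of f) times
  (partial derivative of g) times (bracket of the two coordinates).\<close>

definition rr :: "'n cmat \<Rightarrow> 'n cmat \<Rightarrow> 'n::{finite,linorder} ctensor"
  where "rr X Y = r_mat ** in1 X ** in2 Y - in1 X ** in2 Y ** r_mat"

definition form_tensor :: "'n cmat \<Rightarrow> 'n::{finite,linorder} ctensor" where
  "form_tensor A = r_mat ** in1 A ** in2 A - in1 A ** in2 A ** r_mat
     + in1 A ** transpose1 r_mat ** in2 A - in2 A ** transpose1 r_mat ** in1 A"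

definition form_bracket ::
  "('n::{finite,linorder} cmat \<Rightarrow> complex) \<Rightarrow> ('n cmat \<Rightarrow> complex) \<Rightarrow>
   'n cmat \<Rightarrow> complex" where
  "form_bracket f g A =
    (let df = (\<lambda>i j. frechet_derivative f (at A) (mat_unit i j));
         dg = (\<lambda>i j. frechet_derivative g (at A) (mat_unit i j))
     in \<Sum>i\<in>UNIV. \<Sum>j\<in>UNIV. \<Sum>k\<in>UNIV. \<Sum>l\<in>UNIV.
          form_tensor A $ (i, k) $ (j, l) * df i j * dg k l)"

text \<open>In the last summand the term with a minus sign is the bracket of an entry of B with an
  entry of C, which is given by antisymmetry.\<close>

definition gl2_bracket ::
  "('n::{finite,linorder} cmat \<times> 'n cmat \<Rightarrow> complex) \<Rightarrow>
   ('n cmat \<times> 'n cmat \<Rightarrow> complex) \<Rightarrow>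
   'n cmat \<times> 'n cmat \<Rightarrow> complex" where
  "gl2_bracket f g = (\<lambda>(B, C).
    (let fB = (\<lambda>i j. frechet_derivative f (at (B, C)) (mat_unit i j, 0));
         fC = (\<lambda>i j. frechet_derivative f (at (B, C)) (0, mat_unit i j));
         gB = (\<lambda>i j. frechet_derivative g (at (B, C)) (mat_unit i j, 0));
         gC = (\<lambda>i j. frechet_derivative g (at (B, C)) (0, mat_unit i j))
     in \<Sum>i\<in>UNIV. \<Sum>j\<in>UNIV. \<Sum>k\<in>UNIV. \<Sum>l\<in>UNIV.
          rr B B $ (i, k) $ (j, l) * fB i j * gB k l
        + rr C C $ (i, k) $ (j, l) * fC i j * gC k l
        + rr C B $ (i, k) $ (j, l) * (fC i j * gB k l - fB k l * gC i j)))"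

definition GL :: "'n::finite cmat monoid" where
  "GL = \<lparr>carrier = {A. invertible A}, mult = (**), one = mat 1\<rparr>"

definition GL2 :: "('n::finite cmat \<times> 'n cmat) monoid" where
  "GL2 = GL \<times>\<times> GL"

definition Theta ::
  "'n::finite cmat \<times> 'n cmat \<Rightarrow> 'n cmat \<times> 'n cmat" where
  "Theta = (\<lambda>(B, C). (transpose (matrix_inv C), transpose (matrix_inv B)))"

text \<open>The value B ** transpose C common to all representatives (B, C) of a class Q.\<close>

definition iota :: "('n::finite cmat \<times> 'n cmat) set \<Rightarrow> 'n cmat" where
  "iota Q = (THE A. \<exists>(B, C)\<in>Q. A = B ** transpose C)"

end

theory Submission
  imports Defs "HOL-Complex_Analysis.Cauchy_Integral_Formula"
begin

text \<open>In terms of the gradients \<open>U\<close>, \<open>V\<close> of two functions of matrices \<open>X\<close> and \<open>Y\<close>, the bracket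
  \<open>r\<^sub>1\<^sub>2 X\<^sub>1 Y\<^sub>2 - X\<^sub>1 Y\<^sub>2 r\<^sub>1\<^sub>2\<close> is \<open>t (U X\<^sup>T) (V Y\<^sup>T) - t (V\<^sup>T Y) (U\<^sup>T X)\<close> for one bilinear form \<open>t\<close> on
  matrices. In this shape multiplicativity, the behaviour under inverse transposition and the
  reduction along \<open>(B, C) \<mapsto> B C\<^sup>T\<close> become short manipulations using \<open>t M\<^sup>T N\<^sup>T = t N M\<close> and
  \<open>t M N + t N M = 2 trace (M N)\<close>. The Jacobi identity is checked on coordinates, where it is a
  polynomial identity plus the cyclic sign identity for the r-matrix; it extends to all holomorphic
  functions because their partial derivatives are holomorphic and commute.

  The bracket on pairs is Poisson on all pairs of matrices, invertible or not. As
  \<open>(B, C) \<mapsto> B C\<^sup>T\<close> maps these onto all forms, the Jacobi identity of the bracket on forms follows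
  without computation, also at degenerate forms. The map has the holomorphic section
  \<open>A \<mapsto> (A, 1)\<close> and its fibres over invertible forms are the cosets of the fixed group, which
  identifies the quotient with the invertible forms.\<close>

section \<open>Holomorphic functions of several variables\<close>

text \<open>The r-matrix is the permutation of the two tensor factors plus a skew part whose
  coefficients are signs. The permutation drops out of the bracket of a copy with itself but is
  essential for the mixed one: when the copies are not all equal, the defects of the row and column
  signs in the Jacobi identity no longer cancel each other, and the permutation contributes the
  constant that removes them. It also produces the trace by which the bracket on pairs reduces to
  forms. Membership in \<open>holo\<close> says nothing about second derivatives. Cauchy's formula
  on complex lines writes a directional derivative as an integral of the function, which can be
  differentiated again. Products, inverses and the section need complex linear derivatives too, so
  \<open>cderiv\<close> admits vector values. The quotient bracket of the statement is any operation
  with the defining property, so it is evaluated only through representatives; a formula is needed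
  for existence alone. Functions are total, whereas the relevant pullbacks agree only on open sets,
  so comparisons of brackets go through locality.\<close>

definition cderiv :: "('a::complex_normed_vector \<Rightarrow> 'b::complex_normed_vector) \<Rightarrow> ('a \<Rightarrow> 'b) \<Rightarrow> 'a \<Rightarrow> bool"
  where "cderiv f D x \<longleftrightarrow> (f has_derivative D) (at x) \<and> (\<forall>c v. D (c *\<^sub>C v) = c *\<^sub>C D v)"

lemma cderivI:
  assumes "(f has_derivative D) (at x)" "\<And>c v. D (c *\<^sub>C v) = c *\<^sub>C D v"
  shows "cderiv f D x"
  using assms by (simp add: cderiv_def)

lemma cderiv_has_derivative: "cderiv f D x \<Longrightarrow> (f has_derivative D) (at x)"
  by (simp add: cderiv_def)

lemma cderiv_scaleC: "cderiv f D x \<Longrightarrow> D (c *\<^sub>C v) = c *\<^sub>C D v"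
  by (simp add: cderiv_def)

lemma cderiv_eq_rhs: "cderiv f D x \<Longrightarrow> D = E \<Longrightarrow> cderiv f E x"
  by simp

lemma cderiv_unique: "cderiv f D x \<Longrightarrow> cderiv f E x \<Longrightarrow> D = E"
  by (auto simp: cderiv_def intro: has_derivative_unique)

lemma cderiv_linear: "cderiv f D x \<Longrightarrow> linear D"
  by (auto simp: cderiv_def intro: has_derivative_linear)

lemma cderiv_frechet: "cderiv f D x \<Longrightarrow> frechet_derivative f (at x) = D"
  using frechet_derivative_at[of f D x] by (simp add: cderiv_def)

lemma cderiv_transform_open:
  assumes "cderiv f D x" "open U" "x \<in> U" "\<And>y. y \<in> U \<Longrightarrow> f y = g y"
  shows "cderiv g D x"
  using assms has_derivative_transform_within_open[of f D x UNIV U g] by (simp add: cderiv_def)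

lemma cderiv_const: "cderiv (\<lambda>_. a) (\<lambda>_. 0) x"
proof (rule cderivI)
  fix c :: complex
  have "c *\<^sub>C (0::'b) = 0 *\<^sub>C (c *\<^sub>C 0)"
    using norm_scaleC[of c "0::'b"] norm_scaleC[of 0 "c *\<^sub>C (0::'b)"] by simp
  then show "(0::'b) = c *\<^sub>C 0"
    using norm_scaleC[of c "0::'b"] by simp
qed simp

lemma cderiv_id: "cderiv (\<lambda>x. x) (\<lambda>v. v) x"
  by (rule cderivI) simp_all

lemma cderiv_add: "cderiv f D x \<Longrightarrow> cderiv g E x \<Longrightarrow> cderiv (\<lambda>y. f y + g y) (\<lambda>v. D v + E v) x"
  by (auto simp: cderiv_def scaleC_add_right intro!: has_derivative_add)

lemma cderiv_sum:
  assumes "\<And>i. i \<in> I \<Longrightarrow> cderiv (f i) (D i) x"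
  shows "cderiv (\<lambda>y. \<Sum>i\<in>I. f i y) (\<lambda>v. \<Sum>i\<in>I. D i v) x"
  using assms
proof (induction I rule: infinite_finite_induct)
  case (insert i I)
  then show ?case
    by (simp add: cderiv_add)
qed (simp_all add: cderiv_const)

lemma cderiv_mult:
  fixes f g :: "'a::complex_normed_vector \<Rightarrow> complex"
  shows "cderiv f D x \<Longrightarrow> cderiv g E x \<Longrightarrow> cderiv (\<lambda>y. f y * g y) (\<lambda>v. f x * E v + D v * g x) x"
  by (auto simp: cderiv_def scaleC_complex_def algebra_simps
      intro!: derivative_eq_intros)

lemma cderiv_inverse:
  fixes f :: "'a::complex_normed_vector \<Rightarrow> complex"
  assumes "cderiv f D x" "f x \<noteq> 0"
  shows "cderiv (\<lambda>y. inverse (f y)) (\<lambda>v. - (inverse (f x) * D v * inverse (f x))) x"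
  using assms Deriv.has_derivative_inverse[OF assms(2) cderiv_has_derivative[OF assms(1)]]
  by (simp add: cderiv_def scaleC_complex_def)

lemma cderiv_compose:
  assumes "cderiv f D x" "cderiv g E (f x)"
  shows "cderiv (\<lambda>y. g (f y)) (\<lambda>v. E (D v)) x"
  using assms has_derivative_compose[of f D x UNIV g E] by (simp add: cderiv_def)

lemma scaleC_vec_nth [simp]: "(c *\<^sub>C (x::'a::complex_normed_vector^'n::finite)) $ i = c *\<^sub>C x $ i"
  by (simp add: scaleC_vec_def)

lemma cderiv_vec_nth:
  fixes f :: "'a::complex_normed_vector \<Rightarrow> 'b::complex_normed_vector^'n::finite"
  shows "cderiv f D x \<Longrightarrow> cderiv (\<lambda>y. f y $ i) (\<lambda>v. D v $ i) x"
  by (auto simp: cderiv_def intro: bounded_linear.has_derivative[OF bounded_linear_vec_nth])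

text \<open>In a Euclidean codomain differentiability may be tested against basis vectors, and each
  basis vector \<open>axis i u\<close> sees the single component \<open>f i\<close>.\<close>

lemma cderiv_vec_lambda:
  fixes f :: "'n::finite \<Rightarrow> 'a::complex_normed_vector \<Rightarrow> 'b::{complex_normed_vector,euclidean_space}"
  assumes "\<And>i. cderiv (f i) (D i) x"
  shows "cderiv (\<lambda>y. \<chi> i. f i y) (\<lambda>v. \<chi> i. D i v) x"
proof (rule cderivI)
  have "((\<lambda>y. (\<chi> i. f i y) \<bullet> b) has_derivative (\<lambda>v. (\<chi> i. D i v) \<bullet> b)) (at x)"
    if "b \<in> Basis" for b :: "'b^'n"
  proof -
    obtain i u where "b = axis i u"
      using \<open>b \<in> Basis\<close> by (auto simp: Basis_vec_def)
    then show ?thesis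
      using assms[of i] by (auto simp: inner_axis cderiv_def intro!: has_derivative_inner_left)
  qed
  then show "((\<lambda>y. \<chi> i. f i y) has_derivative (\<lambda>v. \<chi> i. D i v)) (at x)"
    by (subst has_derivative_componentwise_within) blast
  show "(\<chi> i. D i (c *\<^sub>C v)) = c *\<^sub>C (\<chi> i. D i v)" for c v
    using cderiv_scaleC[OF assms] by (simp add: vec_eq_iff)
qed

lemma cderiv_Pair:
  "cderiv f D x \<Longrightarrow> cderiv g E x \<Longrightarrow> cderiv (\<lambda>y. (f y, g y)) (\<lambda>v. (D v, E v)) x"
  by (auto simp: cderiv_def scaleC_prod_def intro!: has_derivative_Pair)

lemma cderiv_fst: "cderiv f D x \<Longrightarrow> cderiv (\<lambda>y. fst (f y)) (\<lambda>v. fst (D v)) x"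
  by (auto simp: cderiv_def scaleC_prod_def intro!: has_derivative_fst)

lemma cderiv_snd: "cderiv f D x \<Longrightarrow> cderiv (\<lambda>y. snd (f y)) (\<lambda>v. snd (D v)) x"
  by (auto simp: cderiv_def scaleC_prod_def intro!: has_derivative_snd)

abbreviation dd :: "('a::complex_normed_vector \<Rightarrow> complex) \<Rightarrow> 'a \<Rightarrow> 'a \<Rightarrow> complex"
  where "dd f x \<equiv> frechet_derivative f (at x)"

text \<open>Derivatives are unique, so the existential derivative in \<open>holo\<close> can be
  replaced by \<open>frechet_derivative\<close>, the one in which the brackets are written.\<close>

lemma holo_iff: "f \<in> holo U \<longleftrightarrow> (\<forall>x\<in>U. cderiv f (dd f x) x)"
proof
  assume "f \<in> holo U"
  then have "\<exists>D. cderiv f D x" if "x \<in> U" for x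
    using that by (auto simp: holo_def cderiv_def scaleC_complex_def)
  then show "\<forall>x\<in>U. cderiv f (dd f x) x"
    using cderiv_frechet by metis
qed (auto simp: holo_def cderiv_def scaleC_complex_def)

lemma holoD: "f \<in> holo U \<Longrightarrow> x \<in> U \<Longrightarrow> cderiv f (dd f x) x"
  by (simp add: holo_iff)

lemma holoI: "(\<And>x. x \<in> U \<Longrightarrow> cderiv f (D x) x) \<Longrightarrow> f \<in> holo U"
  using cderiv_frechet holo_iff by metis

lemma holo_cong:
  assumes "f \<in> holo U" "open U" "\<And>x. x \<in> U \<Longrightarrow> f x = g x"
  shows "g \<in> holo U"
  using assms by (auto intro!: holoI intro: cderiv_transform_open holoD)

lemma dd_cong:
  assumes "f \<in> holo U" "open U" "x \<in> U" "\<And>x. x \<in> U \<Longrightarrow> f x = g x"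
  shows "dd g x = dd f x"
  using cderiv_transform_open[OF holoD[OF assms(1,3)] assms(2-4)] by (simp add: cderiv_frechet)

lemma holo_const: "(\<lambda>_. a) \<in> holo U"
  by (rule holoI, rule cderiv_const)

lemma holo_add: "f \<in> holo U \<Longrightarrow> g \<in> holo U \<Longrightarrow> (\<lambda>x. f x + g x) \<in> holo U"
  by (rule holoI, rule cderiv_add; erule (1) holoD)

lemma holo_mult: "f \<in> holo U \<Longrightarrow> g \<in> holo U \<Longrightarrow> (\<lambda>x. f x * g x) \<in> holo U"
  by (rule holoI, rule cderiv_mult; erule (1) holoD)

lemma holo_sum: "(\<And>i. i \<in> I \<Longrightarrow> f i \<in> holo U) \<Longrightarrow> (\<lambda>x. \<Sum>i\<in>I. f i x) \<in> holo U"
  by (rule holoI, rule cderiv_sum) (blast intro: holoD)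

lemma holo_prod: "(\<And>i. i \<in> I \<Longrightarrow> f i \<in> holo U) \<Longrightarrow> (\<lambda>x. \<Prod>i\<in>I. f i x) \<in> holo U"
  by (induction I rule: infinite_finite_induct) (simp_all add: holo_const holo_mult)

lemma holo_imp_continuous_on: "f \<in> holo U \<Longrightarrow> continuous_on U f"
  by (auto intro!: continuous_at_imp_continuous_on has_derivative_continuous
      dest: holoD cderiv_has_derivative)

lemma bounded_linear_scaleC_left:
  fixes v :: "'a::complex_normed_vector"
  shows "bounded_linear (\<lambda>z::complex. z *\<^sub>C v)"
proof (rule bounded_linear_intro[where K = "norm v"])
  show "(t *\<^sub>R z) *\<^sub>C v = t *\<^sub>R z *\<^sub>C v" for t and z :: complex
    unfolding scaleR_scaleC[of t "z *\<^sub>C v"] by (simp add: scaleC_scaleC scaleR_conv_of_real)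
qed (simp_all add: scaleC_add_left norm_scaleC)

lemma cderiv_line: "cderiv (\<lambda>z::complex. x + z *\<^sub>C v) (\<lambda>z. z *\<^sub>C v) z0"
proof (rule cderivI)
  show "((\<lambda>z::complex. x + z *\<^sub>C v) has_derivative (\<lambda>z. z *\<^sub>C v)) (at z0)"
    by (auto intro!: derivative_eq_intros bounded_linear_imp_has_derivative
        bounded_linear_scaleC_left)
qed (simp add: scaleC_complex_def scaleC_scaleC)

text \<open>On a complex line the function depends on one complex variable. Complex linearity of the
  derivative turns its real differential into multiplication by a number, which opens the way to
  one-variable theory.\<close>

lemma has_derivative_line:
  assumes "f \<in> holo U" "x + z *\<^sub>C v \<in> U"
  shows "((\<lambda>z. f (x + z *\<^sub>C v)) has_field_derivative dd f (x + z *\<^sub>C v) v) (at z)"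
proof -
  have *: "cderiv f (dd f (x + z *\<^sub>C v)) (x + z *\<^sub>C v)"
    by (rule holoD) fact+
  have "cderiv (\<lambda>z. f (x + z *\<^sub>C v)) (\<lambda>h. dd f (x + z *\<^sub>C v) (h *\<^sub>C v)) z"
    using cderiv_compose[OF cderiv_line *] .
  then show ?thesis
    using cderiv_scaleC[OF *]
    by (simp add: cderiv_def has_field_derivative_def scaleC_complex_def mult_commute_abs)
qed

section \<open>Cauchy's formula along complex lines and the regularity of derivatives\<close>

definition circ :: "real \<Rightarrow> real \<Rightarrow> complex"
  where "circ r t = complex_of_real r * exp (2 * of_real pi * \<i> * of_real t)"

lemma norm_circ [simp]: "norm (circ r t) = \<bar>r\<bar>"
  using norm_exp_i_times[of "2 * pi * t"] by (simp add: circ_def norm_mult mult_ac)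

lemma continuous_on_circ [continuous_intros]:
  "continuous_on S h \<Longrightarrow> continuous_on S (\<lambda>x. circ r (h x))"
  unfolding circ_def by (intro continuous_intros)

text \<open>Cauchy's formula for the first derivative at the centre, applied to
  \<open>z \<mapsto> f (x + z *\<^sub>C v)\<close>. On the circle du = 2 pi i u dt, which cancels
  one of the two powers of \<open>u\<close> in the denominator and the factor 2 pi i.\<close>

lemma Cauchy_directional:
  assumes f: "f \<in> holo U" and r: "r > 0" and U: "\<And>z. norm z \<le> r \<Longrightarrow> x + z *\<^sub>C v \<in> U"
  shows "dd f x v = integral {0..1} (\<lambda>t. f (x + circ r t *\<^sub>C v) / circ r t)"
proof -
  let ?h = "\<lambda>z. f (x + z *\<^sub>C v)"
  have d: "(?h has_field_derivative dd f (x + z *\<^sub>C v) v) (at z)" if "norm z \<le> r" for z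
    using has_derivative_line[OF f U[OF that]] .
  have "continuous_on (cball 0 r) ?h"
    by (auto intro!: continuous_at_imp_continuous_on DERIV_isCont[OF d])
  moreover have "?h holomorphic_on ball 0 r"
    by (auto simp: holomorphic_on_open intro!: exI d)
  ultimately have "contour_integral (circlepath 0 r) (\<lambda>u. ?h u / (u - 0)\<^sup>2) = 2 * pi * \<i> * deriv ?h 0"
    using r by (intro Cauchy_contour_integral_circlepath_2) auto
  also have "deriv ?h 0 = dd f x v"
  proof -
    have "x + 0 *\<^sub>C v = x"
      using norm_scaleC[of 0 v] by simp
    then show ?thesis
      using d[of 0] r by (auto intro!: DERIV_imp_deriv)
  qed
  also have "contour_integral (circlepath 0 r) (\<lambda>u. ?h u / (u - 0)\<^sup>2)
      = integral {0..1} (\<lambda>t. 2 * of_real pi * \<i> * (?h (circ r t) / circ r t))"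
  proof -
    have "circlepath 0 r t = circ r t" for t
      by (simp add: circlepath circ_def)
    moreover have "vector_derivative (circlepath 0 r) (at t) = 2 * of_real pi * \<i> * circ r t" for t
      by (simp add: vector_derivative_circlepath circ_def)
    moreover have "circ r t \<noteq> 0" for t
      using r by (metis norm_circ abs_eq_0_iff less_irrefl norm_zero)
    ultimately show ?thesis
      by (simp add: contour_integral_integral power2_eq_square field_simps)
  qed
  finally show ?thesis
    by (simp flip: times_divide_eq_right)
qed

text \<open>One radius serves all base points of the half ball, so Cauchy's formula can be used with
  a fixed contour while the base point varies.\<close>

lemma circle_in_ball:
  fixes v :: "'a::complex_normed_vector"
  assumes "e > 0"
  obtains r where "r > 0" "\<And>x z. x \<in> ball x0 (e/2) \<Longrightarrow> norm z \<le> r \<Longrightarrow> x + z *\<^sub>C v \<in> ball x0 e"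
proof
  \<comment> \<open>The summand 1 keeps the denominator positive when \<open>v = 0\<close>.\<close>
  let ?r = "e / (2 * (norm v + 1))"
  have v: "norm v + 1 > 0"
    using norm_ge_zero[of v] by linarith
  then show "?r > 0"
    using assms by simp
  fix x z assume x: "x \<in> ball x0 (e/2)" and z: "norm (z::complex) \<le> ?r"
  have "norm (z *\<^sub>C v) \<le> ?r * norm v"
    unfolding norm_scaleC by (intro mult_right_mono z) simp
  also have "\<dots> \<le> ?r * (norm v + 1)"
    using \<open>?r > 0\<close> by (intro mult_left_mono) auto
  also have "\<dots> = e / 2"
    using v by (simp add: field_simps)
  finally have "norm (z *\<^sub>C v) \<le> e / 2" .
  moreover have "dist x0 (x + z *\<^sub>C v) \<le> dist x0 x + norm (z *\<^sub>C v)"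
    by (metis add_diff_cancel_left' dist_commute dist_norm dist_triangle)
  ultimately show "x + z *\<^sub>C v \<in> ball x0 e"
    using x by simp
qed

lemma circ_nonzero: "r > 0 \<Longrightarrow> circ r t \<noteq> 0"
  by (simp add: circ_def)

lemma continuous_on_circ_scaleC:
  fixes v :: "'a::complex_normed_vector"
  shows "continuous_on S (\<lambda>(x, t). x + circ r t *\<^sub>C v)"
  unfolding split_beta
  by (intro continuous_intros bounded_linear.continuous_on[OF bounded_linear_scaleC_left])

lemma continuous_on_circ_integrand:
  fixes h :: "'a::complex_normed_vector \<Rightarrow> complex"
  assumes "continuous_on V h" "r > 0"
    and "\<And>x z. x \<in> W \<Longrightarrow> norm z \<le> r \<Longrightarrow> x + z *\<^sub>C v \<in> V"
  shows "continuous_on (W \<times> cbox 0 1) (\<lambda>(x, t). h (x + circ r t *\<^sub>C v) / circ r t)"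
proof -
  have "continuous_on (W \<times> cbox 0 1) (\<lambda>p. h (case p of (x, t) \<Rightarrow> x + circ r t *\<^sub>C v))"
    by (rule continuous_on_compose2[OF assms(1) continuous_on_circ_scaleC]) (use assms(2,3) in auto)
  then show ?thesis
    using assms(2) by (auto simp: split_beta circ_nonzero intro!: continuous_intros)
qed

text \<open>Cauchy's formula expresses the derivative through values of \<open>f\<close>, which are
  continuous. This continuity is what the Leibniz rule in \<open>cderiv_dd_integral\<close> asks
  for.\<close>

lemma continuous_on_dd:
  fixes f :: "'a::complex_normed_vector \<Rightarrow> complex"
  assumes f: "f \<in> holo U" and U: "open U"
  shows "continuous_on U (\<lambda>x. dd f x v)"
proof (rule continuous_at_imp_continuous_on, rule ballI)
  fix x0 assume "x0 \<in> U"
  then obtain e where e: "e > 0" "ball x0 e \<subseteq> U"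
    using U by (auto simp: open_contains_ball)
  obtain r where r: "r > 0"
    "\<And>x z. x \<in> ball x0 (e/2) \<Longrightarrow> norm z \<le> r \<Longrightarrow> x + z *\<^sub>C v \<in> ball x0 e"
    using circle_in_ball[OF e(1), of x0 v] by blast
  have "continuous_on (ball x0 (e/2)) (\<lambda>x. integral (cbox 0 1) (\<lambda>t. f (x + circ r t *\<^sub>C v) / circ r t))"
    using continuous_on_circ_integrand[OF holo_imp_continuous_on[OF f] r(1), of "ball x0 (e/2)" v] r(2) e(2)
    by (intro integral_continuous_on_param) blast
  then have "continuous_on (ball x0 (e/2)) (\<lambda>x. dd f x v)"
    by (rule continuous_on_eq, subst Cauchy_directional[OF f r(1)])
      (use r(2) e(2) in blast, simp)
  then show "isCont (\<lambda>x. dd f x v) x0"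
    using e(1) by (auto simp: continuous_on_eq_continuous_at)
qed

text \<open>Differentiation of Cauchy's formula under the integral sign.\<close>

lemma cderiv_dd_integral:
  fixes f :: "'a::{complex_normed_vector,euclidean_space} \<Rightarrow> complex"
  assumes f: "f \<in> holo U" and U: "open U" and x0: "x0 \<in> U"
  obtains r where "r > 0" "\<And>z. norm z \<le> r \<Longrightarrow> x0 + z *\<^sub>C v \<in> U"
    "cderiv (\<lambda>x. dd f x v) (\<lambda>h. integral {0..1} (\<lambda>t. dd f (x0 + circ r t *\<^sub>C v) h / circ r t)) x0"
proof -
  obtain e where e: "e > 0" "ball x0 e \<subseteq> U"
    using U x0 by (auto simp: open_contains_ball)
  obtain r where r: "r > 0"
    "\<And>x z. x \<in> ball x0 (e/2) \<Longrightarrow> norm z \<le> r \<Longrightarrow> x + z *\<^sub>C v \<in> ball x0 e"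
    using circle_in_ball[OF e(1), of x0 v] by blast
  let ?W = "ball x0 (e/2)"
  have W: "x + z *\<^sub>C v \<in> U" if "x \<in> ?W" "norm z \<le> r" for x z
    using r(2)[OF that] e(2) by blast
  have Wc: "x + circ r t *\<^sub>C v \<in> U" if "x \<in> ?W" for x t
    using W[OF that] r(1) by simp
  \<comment> \<open>The Leibniz rule takes the derivative as a continuous family of bounded linear
    maps. In finite dimension its continuity can be checked on basis vectors, where it is
    \<open>continuous_on_dd\<close>.\<close>
  define F where "F x t = Blinfun (\<lambda>h. dd f (x + circ r t *\<^sub>C v) h / circ r t)" for x t
  have bl: "bounded_linear (\<lambda>h. dd f (x + circ r t *\<^sub>C v) h / circ r t)" if "x \<in> ?W" for x t
    using has_derivative_bounded_linear[OF cderiv_has_derivative[OF holoD[OF f Wc[OF that]]]]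
    by (intro bounded_linear_compose[OF bounded_linear_divide])
  have F: "blinfun_apply (F x t) = (\<lambda>h. dd f (x + circ r t *\<^sub>C v) h / circ r t)" if "x \<in> ?W" for x t
    unfolding F_def by (rule bounded_linear_Blinfun_apply) (rule bl[OF that])
  have contF: "continuous_on (?W \<times> cbox 0 1) (\<lambda>(x, t). F x t)"
  proof (rule continuous_on_blinfun_componentwise)
    fix i :: 'a
    have "continuous_on (?W \<times> cbox 0 1) (\<lambda>(x, t). dd f (x + circ r t *\<^sub>C v) i / circ r t)"
      by (rule continuous_on_circ_integrand[OF continuous_on_dd[OF f U] r(1) W])
    then show "continuous_on (?W \<times> cbox 0 1) (\<lambda>p. blinfun_apply (case p of (x, t) \<Rightarrow> F x t) i)"
      by (rule continuous_on_eq) (auto simp: F)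
  qed
  have contf: "continuous_on (?W \<times> cbox 0 1) (\<lambda>(x, t). f (x + circ r t *\<^sub>C v) / circ r t)"
    by (rule continuous_on_circ_integrand[OF holo_imp_continuous_on[OF f] r(1) W])
  have slice: "continuous_on (cbox 0 1) (g x)"
    if "continuous_on (?W \<times> cbox (0::real) 1) (\<lambda>(x, t). g x t)" "x \<in> ?W"
    for g :: "'a \<Rightarrow> real \<Rightarrow> 'b::topological_space" and x
  proof -
    have "continuous_on (cbox 0 1) (Pair x)"
      by (intro continuous_intros)
    moreover have "Pair x ` cbox 0 1 \<subseteq> ?W \<times> cbox (0::real) 1"
      using that(2) by blast
    ultimately show ?thesis
      using continuous_on_compose2[OF that(1), of "cbox 0 1" "Pair x"] by (simp del: box_real)
  qed
  have x0W: "x0 \<in> ?W"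
    using e(1) by simp
  have "((\<lambda>x. integral (cbox 0 1) (\<lambda>t. f (x + circ r t *\<^sub>C v) / circ r t))
      has_derivative integral (cbox 0 1) (F x0)) (at x0 within ?W)"
  proof (rule leibniz_rule[OF _ _ contF x0W])
    fix x t assume "x \<in> ?W"
    have "((\<lambda>x. x + circ r t *\<^sub>C v) has_derivative (\<lambda>h. h)) (at x)"
      by (auto intro!: derivative_eq_intros)
    from has_derivative_compose[OF this cderiv_has_derivative[OF holoD[OF f Wc[OF \<open>x \<in> ?W\<close>]]]]
    have "((\<lambda>x. f (x + circ r t *\<^sub>C v) / circ r t) has_derivative
        (\<lambda>h. dd f (x + circ r t *\<^sub>C v) h / circ r t)) (at x)"
      by (rule bounded_linear.has_derivative[OF bounded_linear_divide])
    then show "((\<lambda>x. f (x + circ r t *\<^sub>C v) / circ r t) has_derivative blinfun_apply (F x t))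
        (at x within ?W)"
      by (simp add: F[OF \<open>x \<in> ?W\<close>] has_derivative_at_withinI)
  next
    show "(\<lambda>t. f (x + circ r t *\<^sub>C v) / circ r t) integrable_on cbox 0 1" if "x \<in> ?W" for x
      by (rule integrable_continuous, rule slice[OF contf that])
  qed simp
  moreover have "blinfun_apply (integral (cbox 0 1) (F x0))
      = (\<lambda>h. integral {0..1} (\<lambda>t. dd f (x0 + circ r t *\<^sub>C v) h / circ r t))"
    using integrable_continuous[OF slice[OF contF x0W]]
    by (simp add: fun_eq_iff blinfun_apply_integral F[OF x0W])
  ultimately have D: "((\<lambda>x. integral {0..1} (\<lambda>t. f (x + circ r t *\<^sub>C v) / circ r t))
      has_derivative (\<lambda>h. integral {0..1} (\<lambda>t. dd f (x0 + circ r t *\<^sub>C v) h / circ r t))) (at x0)"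
    using x0W by (simp add: at_within_open[OF x0W])
  have D': "((\<lambda>x. dd f x v) has_derivative
      (\<lambda>h. integral {0..1} (\<lambda>t. dd f (x0 + circ r t *\<^sub>C v) h / circ r t))) (at x0)"
    by (rule has_derivative_transform_within_open[OF D open_ball x0W])
      (rule Cauchy_directional[OF f r(1) W, symmetric])
  show thesis
  proof (rule that[OF r(1) W[OF x0W] cderivI[OF D']])
    show "integral {0..1} (\<lambda>t. dd f (x0 + circ r t *\<^sub>C v) (c *\<^sub>C h) / circ r t)
        = c *\<^sub>C integral {0..1} (\<lambda>t. dd f (x0 + circ r t *\<^sub>C v) h / circ r t)" for c h
      using cderiv_scaleC[OF holoD[OF f Wc[OF x0W]]]
      by (simp add: scaleC_complex_def flip: integral_mult_right times_divide_eq_right)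
  qed
qed

lemma holo_dd:
  fixes f :: "'a::{complex_normed_vector,euclidean_space} \<Rightarrow> complex"
  assumes "f \<in> holo U" "open U"
  shows "(\<lambda>x. dd f x v) \<in> holo U"
proof -
  have "\<exists>D. cderiv (\<lambda>x. dd f x v) D x" if "x \<in> U" for x
    using cderiv_dd_integral[OF assms that, of v] by blast
  then show ?thesis
    by (auto simp: holo_def cderiv_def scaleC_complex_def)
qed

text \<open>The derivative of Cauchy's formula for \<open>dd f _ v\<close> in direction \<open>w\<close> is Cauchy's formula for
  the derivative of \<open>dd f _ w\<close> in direction \<open>v\<close>.\<close>

lemma dd_symmetric:
  fixes f :: "'a::{complex_normed_vector,euclidean_space} \<Rightarrow> complex"
  assumes f: "f \<in> holo U" and U: "open U" and x: "x \<in> U"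
  shows "dd (\<lambda>y. dd f y v) x w = dd (\<lambda>y. dd f y w) x v"
proof -
  obtain r where r: "r > 0" "\<And>z. norm z \<le> r \<Longrightarrow> x + z *\<^sub>C v \<in> U"
    "cderiv (\<lambda>x. dd f x v) (\<lambda>h. integral {0..1} (\<lambda>t. dd f (x + circ r t *\<^sub>C v) h / circ r t)) x"
    using cderiv_dd_integral[OF f U x, of v] by blast
  show ?thesis
    using cderiv_frechet[OF r(3)] Cauchy_directional[OF holo_dd[OF f U] r(1,2)] by simp
qed

section \<open>Brackets with prescribed coordinate functions\<close>

text \<open>When the \<open>e p\<close> form a basis, this is the biderivation for which
  \<open>P p q\<close> is the bracket of the dual coordinates. The abstract index type allows the
  entries of both matrices to be treated as one family of coordinates.\<close>

definition coord_bracket ::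
  "('i::finite \<Rightarrow> 'a::complex_normed_vector) \<Rightarrow> ('i \<Rightarrow> 'i \<Rightarrow> 'a \<Rightarrow> complex)
    \<Rightarrow> ('a \<Rightarrow> complex) \<Rightarrow> ('a \<Rightarrow> complex) \<Rightarrow> 'a \<Rightarrow> complex"
  where "coord_bracket e P f g x = (\<Sum>p\<in>UNIV. \<Sum>q\<in>UNIV. P p q x * dd f x (e p) * dd g x (e q))"

lemma sum4_tuple:
  "(\<Sum>r\<in>UNIV. \<Sum>s\<in>UNIV. \<Sum>p\<in>UNIV. \<Sum>q\<in>UNIV. f r s p q)
    = (\<Sum>(r, s, p, q)\<in>UNIV. f r s p q)"
  by (simp add: sum.cartesian_product split_def)

lemma sum3_rotate:
  fixes f :: "'i::finite \<Rightarrow> 'i \<Rightarrow> 'i \<Rightarrow> complex"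
  shows "(\<Sum>r\<in>UNIV. \<Sum>p\<in>UNIV. \<Sum>q\<in>UNIV. f r p q) = (\<Sum>r\<in>UNIV. \<Sum>p\<in>UNIV. \<Sum>q\<in>UNIV. f p q r)"
proof -
  have "(\<Sum>r\<in>UNIV. \<Sum>p\<in>UNIV. \<Sum>q\<in>UNIV. f p q r) = (\<Sum>p\<in>UNIV. \<Sum>r\<in>UNIV. \<Sum>q\<in>UNIV. f p q r)"
    by (rule sum.swap)
  also have "\<dots> = (\<Sum>p\<in>UNIV. \<Sum>q\<in>UNIV. \<Sum>r\<in>UNIV. f p q r)"
    by (rule sum.cong[OF refl], rule sum.swap)
  finally show ?thesis
    by simp
qed

text \<open>The Jacobi identity at one point, as algebra. \<open>F\<close> stands for a gradient and
  \<open>F2\<close> for the Hessian of the same function; \<open>D u u2 v v2 s\<close> is the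
  derivative in direction \<open>s\<close> of the bracket of two functions with these data. Each
  Hessian occurs in two terms, which cancel because Hessians are symmetric and \<open>P\<close> is
  antisymmetric. What remains is \<open>jac\<close> contracted with three gradients.\<close>

lemma jacobi_sums:
  fixes P :: "'i::finite \<Rightarrow> 'i \<Rightarrow> complex" and DP :: "'i \<Rightarrow> 'i \<Rightarrow> 'i \<Rightarrow> complex"
    and F2 G2 H2 :: "'i \<Rightarrow> 'i \<Rightarrow> complex"
  assumes anti: "\<And>p q. P q p = - P p q"
    and jac: "\<And>p q r. (\<Sum>s\<in>UNIV. P p s * DP q r s) + (\<Sum>s\<in>UNIV. P q s * DP r p s)
      + (\<Sum>s\<in>UNIV. P r s * DP p q s) = 0"
    and sym: "\<And>p q. F2 p q = F2 q p" "\<And>p q. G2 p q = G2 q p" "\<And>p q. H2 p q = H2 q p"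
    and D: "\<And>s u v u2 v2. D u u2 v v2 s = (\<Sum>p\<in>UNIV. \<Sum>q\<in>UNIV.
        DP p q s * u p * v q + P p q * u2 p s * v q + P p q * u p * v2 q s)"
  shows "(\<Sum>r\<in>UNIV. \<Sum>s\<in>UNIV. P r s * F r * D G G2 H H2 s)
       + (\<Sum>r\<in>UNIV. \<Sum>s\<in>UNIV. P r s * G r * D H H2 F F2 s)
       + (\<Sum>r\<in>UNIV. \<Sum>s\<in>UNIV. P r s * H r * D F F2 G G2 s) = 0"
proof -
  \<comment> \<open>\<open>K v u w\<close> is, up to sign, the Hessian \<open>u\<close> evaluated on
    the Hamiltonian vectors of \<open>v\<close> and \<open>w\<close>; \<open>A\<close> collects the
    terms with derivatives of the coefficients.\<close>
  define K where "K v u w = (\<Sum>r\<in>UNIV. \<Sum>s\<in>UNIV. \<Sum>p\<in>UNIV. \<Sum>q\<in>UNIV. P r s * P p q * v r * u p s * w q)"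
    for v w :: "'i \<Rightarrow> complex" and u :: "'i \<Rightarrow> 'i \<Rightarrow> complex"
  define A where "A u v w = (\<Sum>r\<in>UNIV. \<Sum>p\<in>UNIV. \<Sum>q\<in>UNIV. u r * v p * w q * (\<Sum>s\<in>UNIV. P r s * DP p q s))"
    for u v w :: "'i \<Rightarrow> complex"
  have K_sym: "K v u w = K w u v" if u: "\<And>p q. u p q = u q p" for u v w
  proof -
    have "P q p * P s r * w q * u s p * v r = P r s * P p q * v r * u p s * w q" for p q r s
      using anti[of p q] anti[of r s] u[of s p] by simp
    then show ?thesis
      unfolding K_def sum4_tuple
      by (intro sum.reindex_bij_witness[of _ "\<lambda>(r, s, p, q). (q, p, s, r)" "\<lambda>(r, s, p, q). (q, p, s, r)"])
        auto
  qed
  have K_anti: "(\<Sum>r\<in>UNIV. \<Sum>s\<in>UNIV. \<Sum>p\<in>UNIV. \<Sum>q\<in>UNIV. P r s * P p q * v r * w p * u q s) = - K v u w" for u v w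
  proof -
    have "P r s * P p q * v r * u p s * w q = - (P r s * P q p * v r * w q * u p s)" for p q r s
      using anti[of q p] by simp
    then have "K v u w = (\<Sum>r\<in>UNIV. \<Sum>s\<in>UNIV. \<Sum>p\<in>UNIV. \<Sum>q\<in>UNIV. - (P r s * P p q * v r * w p * u q s))"
      unfolding K_def sum4_tuple
      by (intro sum.reindex_bij_witness[of _ "\<lambda>(r, s, p, q). (r, s, q, p)" "\<lambda>(r, s, p, q). (r, s, q, p)"])
        auto
    then show ?thesis
      by (simp add: sum_negf)
  qed
  have A_eq: "(\<Sum>r\<in>UNIV. \<Sum>s\<in>UNIV. \<Sum>p\<in>UNIV. \<Sum>q\<in>UNIV. P r s * DP p q s * u r * v p * w q) = A u v w" for u v w
    unfolding A_def sum_distrib_left sum4_tuple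
    by (rule sum.reindex_bij_witness[of _ "\<lambda>(r, p, q, s). (r, s, p, q)" "\<lambda>(r, s, p, q). (r, p, q, s)"])
      (auto simp: mult_ac)
  have *: "(\<Sum>r\<in>UNIV. \<Sum>s\<in>UNIV. P r s * u r * D v v2 w w2 s) = A u v w + K u v2 w - K u w2 v"
    for u v w v2 w2
  proof -
    have "(\<Sum>r\<in>UNIV. \<Sum>s\<in>UNIV. P r s * u r * D v v2 w w2 s)
      = (\<Sum>r\<in>UNIV. \<Sum>s\<in>UNIV. \<Sum>p\<in>UNIV. \<Sum>q\<in>UNIV. P r s * DP p q s * u r * v p * w q
          + P r s * P p q * u r * v2 p s * w q + P r s * P p q * u r * v p * w2 q s)"
      by (simp add: D sum_distrib_left distrib_left mult_ac)
    also have "\<dots> = A u v w + K u v2 w - K u w2 v"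
      by (simp add: sum.distrib A_eq K_anti) (simp add: K_def)
    finally show ?thesis .
  qed
  have "A F G H + A G H F + A H F G = 0"
  proof -
    have "A G H F = (\<Sum>r\<in>UNIV. \<Sum>p\<in>UNIV. \<Sum>q\<in>UNIV. F r * G p * H q * (\<Sum>s\<in>UNIV. P p s * DP q r s))"
      unfolding A_def by (subst sum3_rotate) (simp add: mult_ac)
    moreover have "A H F G = (\<Sum>r\<in>UNIV. \<Sum>p\<in>UNIV. \<Sum>q\<in>UNIV. F r * G p * H q * (\<Sum>s\<in>UNIV. P q s * DP r p s))"
      unfolding A_def by (subst sum3_rotate, subst sum3_rotate) (simp add: mult_ac)
    ultimately have "A F G H + A G H F + A H F G = (\<Sum>r\<in>UNIV. \<Sum>p\<in>UNIV. \<Sum>q\<in>UNIV. F r * G p * H q *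
        ((\<Sum>s\<in>UNIV. P r s * DP p q s) + (\<Sum>s\<in>UNIV. P p s * DP q r s) + (\<Sum>s\<in>UNIV. P q s * DP r p s)))"
      by (simp add: A_def sum.distrib distrib_left)
    then show ?thesis
      by (simp add: jac)
  qed
  then show ?thesis
    unfolding * using K_sym[OF sym(1), where v = G and w = H] K_sym[OF sym(2), where v = F and w = H]
      K_sym[OF sym(3), where v = F and w = G]
    by (simp add: algebra_simps)
qed

lemma coord_bracket_cong:
  assumes "f \<in> holo U" "open U" "x \<in> U" "\<And>x. x \<in> U \<Longrightarrow> f x = f' x"
  shows "coord_bracket e P f' g x = coord_bracket e P f g x"
  using dd_cong[OF assms] by (simp add: coord_bracket_def)

lemma cderiv_coord_bracket:
  fixes e :: "'i::finite \<Rightarrow> 'a::{complex_normed_vector,euclidean_space}"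
  assumes U: "open U" and P: "\<And>p q. P p q \<in> holo UNIV" and f: "f \<in> holo U" and g: "g \<in> holo U"
    and x: "x \<in> U"
  shows "cderiv (coord_bracket e P f g) (\<lambda>v. \<Sum>p\<in>UNIV. \<Sum>q\<in>UNIV.
      dd (P p q) x v * dd f x (e p) * dd g x (e q)
      + P p q x * dd (\<lambda>y. dd f y (e p)) x v * dd g x (e q)
      + P p q x * dd f x (e p) * dd (\<lambda>y. dd g y (e q)) x v) x"
  unfolding coord_bracket_def[abs_def]
proof (intro cderiv_sum)
  fix p q
  have "cderiv (\<lambda>y. P p q y * dd f y (e p) * dd g y (e q)) (\<lambda>v.
      P p q x * dd f x (e p) * dd (\<lambda>y. dd g y (e q)) x v
      + (P p q x * dd (\<lambda>y. dd f y (e p)) x v + dd (P p q) x v * dd f x (e p)) * dd g x (e q)) x"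
    by (intro cderiv_mult holoD[OF P UNIV_I] holoD[OF holo_dd[OF f U] x] holoD[OF holo_dd[OF g U] x])
  then show "cderiv (\<lambda>y. P p q y * dd f y (e p) * dd g y (e q)) (\<lambda>v.
      dd (P p q) x v * dd f x (e p) * dd g x (e q)
      + P p q x * dd (\<lambda>y. dd f y (e p)) x v * dd g x (e q)
      + P p q x * dd f x (e p) * dd (\<lambda>y. dd g y (e q)) x v) x"
    by (rule cderiv_eq_rhs) (simp add: fun_eq_iff algebra_simps)
qed

text \<open>Linearity and the Leibniz rule are inherited from the derivative, and closure rests on
  \<open>holo_dd\<close> together with holomorphic coefficients. In the Jacobi identity
  \<open>jac\<close> handles the first derivatives and \<open>dd_symmetric\<close> the second
  ones.\<close>

theorem poisson_structure_coord_bracket: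
  fixes e :: "'i::finite \<Rightarrow> 'a::{complex_normed_vector,euclidean_space}"
  assumes S: "open S" and P: "\<And>p q. P p q \<in> holo UNIV"
    and anti: "\<And>p q x. P q p x = - P p q x"
    and jac: "\<And>p q r x. (\<Sum>s\<in>UNIV. P p s x * dd (P q r) x (e s))
      + (\<Sum>s\<in>UNIV. P q s x * dd (P r p) x (e s)) + (\<Sum>s\<in>UNIV. P r s x * dd (P p q) x (e s)) = 0"
  shows "poisson_structure (open_space S (coord_bracket e P))"
  unfolding poisson_structure_def open_space_def poisson_space.simps
proof (intro allI impI conjI ballI)
  fix U assume "openin (top_of_set S) U"
  then have U: "open U"
    using S openin_open_eq by blast
  let ?br = "coord_bracket e P"
  show "?br f g x = ?br f' g x" if "f \<in> holo U" "f' \<in> holo U" "g \<in> holo U" "\<forall>x\<in>U. f x = f' x" "x \<in> U"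
    for f f' g x
    using coord_bracket_cong[OF that(2) U that(5), of f] that(4) by simp
  show "?br f g \<in> holo U" if "f \<in> holo U" "g \<in> holo U" for f g
    using cderiv_coord_bracket[OF U P that] by (rule holoI)
  show "?br g f x = - ?br f g x" for f g x
  proof -
    have "?br g f x = (\<Sum>q\<in>UNIV. \<Sum>p\<in>UNIV. P p q x * dd g x (e p) * dd f x (e q))"
      unfolding coord_bracket_def by (rule sum.swap)
    also have "\<dots> = (\<Sum>q\<in>UNIV. \<Sum>p\<in>UNIV. - (P q p x * dd f x (e q) * dd g x (e p)))"
      by (intro sum.cong refl, subst anti) (simp add: mult_ac)
    also have "\<dots> = - ?br f g x"
      by (simp add: coord_bracket_def sum_negf)
    finally show ?thesis .
  qed
  fix f g h x assume f: "f \<in> holo U" and g: "g \<in> holo U" and h: "h \<in> holo U" and x: "x \<in> U"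
  show "?br (\<lambda>y. a * f y + b * g y) h x = a * ?br f h x + b * ?br g h x" for a b
  proof -
    have "cderiv (\<lambda>y. a * f y + b * g y)
        (\<lambda>v. (a * dd f x v + 0 * f x) + (b * dd g x v + 0 * g x)) x"
      by (intro cderiv_add cderiv_mult cderiv_const holoD[OF f x] holoD[OF g x])
    from cderiv_frechet[OF this] show ?thesis
      by (simp add: coord_bracket_def sum.distrib sum_distrib_left algebra_simps)
  qed
  show "?br (\<lambda>y. f y * g y) h x = f x * ?br g h x + ?br f h x * g x"
  proof -
    have "dd (\<lambda>y. f y * g y) x = (\<lambda>v. f x * dd g x v + dd f x v * g x)"
      by (intro cderiv_frechet cderiv_mult holoD[OF f x] holoD[OF g x])
    then show ?thesis
      by (simp add: coord_bracket_def sum.distrib sum_distrib_left sum_distrib_right algebra_simps)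
  qed
  let ?d = "\<lambda>f p. dd f x (e p)" and ?d2 = "\<lambda>f p q. dd (\<lambda>y. dd f y (e p)) x (e q)"
  show "?br f (?br g h) x + ?br g (?br h f) x + ?br h (?br f g) x = 0"
    unfolding coord_bracket_def[of e P f "?br g h"] coord_bracket_def[of e P g "?br h f"]
      coord_bracket_def[of e P h "?br f g"]
    unfolding cderiv_frechet[OF cderiv_coord_bracket[OF U P f g x]]
      cderiv_frechet[OF cderiv_coord_bracket[OF U P g h x]]
      cderiv_frechet[OF cderiv_coord_bracket[OF U P h f x]]
  proof (rule jacobi_sums[where P = "\<lambda>p q. P p q x" and DP = "\<lambda>p q s. dd (P p q) x (e s)"
        and F = "?d f" and G = "?d g" and H = "?d h"
        and ?F2.0 = "?d2 f" and ?G2.0 = "?d2 g" and ?H2.0 = "?d2 h"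
        and D = "\<lambda>u u2 v v2 s. (\<Sum>p\<in>UNIV. \<Sum>q\<in>UNIV. dd (P p q) x (e s) * u p * v q
          + P p q x * u2 p s * v q + P p q x * u p * v2 q s)"])
    show "P q p x = - P p q x" for p q
      by (rule anti)
    show "(\<Sum>s\<in>UNIV. P p s x * dd (P q r) x (e s)) + (\<Sum>s\<in>UNIV. P q s x * dd (P r p) x (e s))
      + (\<Sum>s\<in>UNIV. P r s x * dd (P p q) x (e s)) = 0" for p q r
      by (rule jac)
    show "?d2 f p q = ?d2 f q p" "?d2 g p q = ?d2 g q p" "?d2 h p q = ?d2 h q p" for p q
      by (rule dd_symmetric[OF f U x] dd_symmetric[OF g U x] dd_symmetric[OF h U x])+
  qed (rule refl)
qed

section \<open>Matrices and their gradients\<close>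

lemma mat_unit_nth: "mat_unit i j $ a $ b = (if a = i \<and> b = j then 1 else 0)"
  by (simp add: mat_unit_def axis_def)

lemma sum_single:
  fixes f :: "'i::finite \<Rightarrow> 'a::comm_monoid_add"
  assumes "\<And>x. x \<noteq> a \<Longrightarrow> f x = 0"
  shows "(\<Sum>x\<in>UNIV. f x) = f a"
proof -
  have "(\<Sum>x\<in>UNIV. f x) = (\<Sum>x\<in>{a}. f x)"
    by (rule sum.mono_neutral_right) (use assms in auto)
  then show ?thesis
    by simp
qed

lemma cmat_expand: "(V::'n::finite cmat) = (\<Sum>i\<in>UNIV. \<Sum>j\<in>UNIV. V $ i $ j *\<^sub>C mat_unit i j)"
proof -
  have "(\<Sum>i\<in>UNIV. \<Sum>j\<in>UNIV. V $ i $ j *\<^sub>C mat_unit i j $ a $ b) = V $ a $ b" for a b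
    by (subst sum_single[of a], simp add: mat_unit_nth scaleC_complex_def,
        subst sum_single[of b]) (simp_all add: mat_unit_nth scaleC_complex_def)
  then show ?thesis
    by (simp add: vec_eq_iff)
qed

definition clinear :: "('a::complex_normed_vector \<Rightarrow> 'b::complex_normed_vector) \<Rightarrow> bool"
  where "clinear D \<longleftrightarrow> (\<forall>u v. D (u + v) = D u + D v) \<and> (\<forall>c v. D (c *\<^sub>C v) = c *\<^sub>C D v)"

lemma clinear_sum: "clinear D \<Longrightarrow> D (\<Sum>i\<in>I. f i) = (\<Sum>i\<in>I. D (f i))"
proof (induction I rule: infinite_finite_induct)
  case empty
  then have "D (0 + 0) = D 0 + D 0"
    unfolding clinear_def by blast
  then show ?case
    by simp
next
  case (infinite A)
  then have "D (0 + 0) = D 0 + D 0"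
    unfolding clinear_def by blast
  then show ?case
    using infinite by simp
qed (simp_all add: clinear_def)

text \<open>Represents a complex linear functional through the sum of products of entries, without
  conjugation. The adjoint of multiplication by \<open>M\<close> is therefore multiplication by
  \<open>transpose M\<close>.\<close>

definition grad :: "('n::finite cmat \<Rightarrow> complex) \<Rightarrow> 'n cmat"
  where "grad D = (\<chi> i j. D (mat_unit i j))"

lemma clinear_grad:
  assumes "clinear D"
  shows "D V = (\<Sum>i\<in>UNIV. \<Sum>j\<in>UNIV. grad D $ i $ j * V $ i $ j)"
proof -
  have "D V = D (\<Sum>i\<in>UNIV. \<Sum>j\<in>UNIV. V $ i $ j *\<^sub>C mat_unit i j)"
    using cmat_expand[of V] by simp
  also have "\<dots> = (\<Sum>i\<in>UNIV. \<Sum>j\<in>UNIV. D (V $ i $ j *\<^sub>C mat_unit i j))"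
    by (simp add: clinear_sum[OF assms])
  also have "\<dots> = (\<Sum>i\<in>UNIV. \<Sum>j\<in>UNIV. grad D $ i $ j * V $ i $ j)"
    using assms by (simp add: clinear_def grad_def scaleC_complex_def mult.commute)
  finally show ?thesis .
qed

lemma cderiv_clinear: "cderiv f D x \<Longrightarrow> clinear D"
  using cderiv_linear[of f D x] by (simp add: clinear_def cderiv_scaleC linear_add)

lemma matrix_mult_mat_unit:
  "((M::'n::finite cmat) ** mat_unit i j) $ a $ b = (if b = j then M $ a $ i else 0)"
  "(mat_unit i j ** (M::'n::finite cmat)) $ a $ b = (if a = i then M $ j $ b else 0)"
  unfolding matrix_matrix_mult_def vec_lambda_beta
  by (subst sum_single[of i], auto simp: mat_unit_nth)
    (subst sum_single[of j], auto simp: mat_unit_nth)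

lemma grad_mult_right:
  assumes "clinear D"
  shows "grad (\<lambda>V. D (V ** M)) = grad D ** transpose M"
proof -
  have "D (mat_unit i j ** M) = (grad D ** transpose M) $ i $ j" for i j
  proof -
    have "D (mat_unit i j ** M) = (\<Sum>a\<in>UNIV. \<Sum>b\<in>UNIV. if a = i then grad D $ a $ b * M $ j $ b else 0)"
      by (subst clinear_grad[OF assms]) (auto simp: matrix_mult_mat_unit intro!: sum.cong)
    also have "\<dots> = (\<Sum>b\<in>UNIV. \<Sum>a\<in>UNIV. if a = i then grad D $ a $ b * M $ j $ b else 0)"
      by (rule sum.swap)
    finally show ?thesis
      by (simp add: matrix_matrix_mult_def transpose_def)
  qed
  then show ?thesis
    by (simp add: vec_eq_iff grad_def)
qed

lemma grad_mult_left:
  assumes "clinear D"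
  shows "grad (\<lambda>V. D (M ** V)) = transpose M ** grad D"
proof -
  have "D (M ** mat_unit i j) = (transpose M ** grad D) $ i $ j" for i j
  proof -
    have "D (M ** mat_unit i j) = (\<Sum>a\<in>UNIV. \<Sum>b\<in>UNIV. grad D $ a $ b * (M ** mat_unit i j) $ a $ b)"
      by (rule clinear_grad[OF assms])
    also have "\<dots> = (\<Sum>a\<in>UNIV. grad D $ a $ j * M $ a $ i)"
      by (intro sum.cong refl, subst sum_single[of j]) (auto simp: matrix_mult_mat_unit)
    finally show ?thesis
      by (simp add: matrix_matrix_mult_def transpose_def mult.commute)
  qed
  then show ?thesis
    by (simp add: vec_eq_iff grad_def)
qed

lemma transpose_mat_unit: "transpose (mat_unit i j) = mat_unit j i"
  by (simp add: vec_eq_iff transpose_def mat_unit_nth conj_commute)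

lemma grad_transpose: "grad (\<lambda>V. D (transpose V)) = transpose (grad D)"
  by (simp add: vec_eq_iff grad_def transpose_mat_unit) (simp add: transpose_def)

lemma grad_uminus: "grad (\<lambda>V. - D V) = - grad D"
  by (simp add: vec_eq_iff grad_def)

lemma scaleC_matrix_mult:
  fixes M :: "'n::finite cmat"
  shows "(c *\<^sub>C V) ** M = c *\<^sub>C (V ** M)" "M ** (c *\<^sub>C V) = c *\<^sub>C (M ** V)"
  by (simp_all add: vec_eq_iff matrix_matrix_mult_def scaleC_complex_def sum_distrib_left mult_ac)

lemma transpose_scaleC: "transpose (c *\<^sub>C (V::'n::finite cmat)) = c *\<^sub>C transpose V"
  by (simp add: vec_eq_iff transpose_def)

lemma transpose_add: "transpose ((V::'n::finite cmat) + W) = transpose V + transpose W"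
  by (simp add: vec_eq_iff transpose_def)

lemma transpose_uminus: "transpose (- (V::'n::finite cmat)) = - transpose V"
  by (simp add: vec_eq_iff transpose_def)

lemma matrix_add_rdistrib: "((V::'n::finite cmat) + W) ** M = V ** M + W ** M"
  by (simp add: vec_eq_iff matrix_matrix_mult_def distrib_right sum.distrib)

lemma clinear_mult_right: "clinear D \<Longrightarrow> clinear (\<lambda>V::'n::finite cmat. D (V ** (M::'n cmat)))"
  unfolding clinear_def matrix_add_rdistrib scaleC_matrix_mult by blast

lemma clinear_transpose: "clinear D \<Longrightarrow> clinear (\<lambda>V::'n::finite cmat. D (transpose V))"
  by (simp add: clinear_def transpose_add transpose_scaleC)

lemma matrix_mult_uminus:
  fixes A B :: "'n::finite cmat"
  shows "(- A) ** B = - (A ** B)" "A ** (- B) = - (A ** B)"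
  by (simp_all add: vec_eq_iff matrix_matrix_mult_def sum_negf)

lemma cderiv_matrix_mult:
  fixes f g :: "'a::complex_normed_vector \<Rightarrow> 'n::finite cmat"
  assumes "cderiv f D x" "cderiv g E x"
  shows "cderiv (\<lambda>y. f y ** g y) (\<lambda>v. f x ** E v + D v ** g x) x"
proof -
  have "cderiv (\<lambda>y. \<chi> i j. \<Sum>k\<in>UNIV. f y $ i $ k * g y $ k $ j)
      (\<lambda>v. \<chi> i j. \<Sum>k\<in>UNIV. f x $ i $ k * E v $ k $ j + D v $ i $ k * g x $ k $ j) x"
    by (intro cderiv_vec_lambda cderiv_sum cderiv_mult cderiv_vec_nth assms)
  moreover have "(\<lambda>v. \<chi> i j. \<Sum>k\<in>UNIV. f x $ i $ k * E v $ k $ j + D v $ i $ k * g x $ k $ j)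
      = (\<lambda>v. f x ** E v + D v ** g x)"
    by (simp add: fun_eq_iff vec_eq_iff matrix_matrix_mult_def sum.distrib)
  ultimately show ?thesis
    unfolding matrix_matrix_mult_def by simp
qed

lemma cderiv_transpose:
  fixes f :: "'a::complex_normed_vector \<Rightarrow> 'n::finite cmat"
  assumes "cderiv f D x"
  shows "cderiv (\<lambda>y. transpose (f y)) (\<lambda>v. transpose (D v)) x"
  unfolding transpose_def by (intro cderiv_vec_lambda cderiv_vec_nth assms)

lemma holo_coord: "(\<lambda>X::'n::finite cmat. X $ i $ j) \<in> holo U"
  by (rule holoI, rule cderiv_vec_nth, rule cderiv_vec_nth, rule cderiv_id)

lemma holo_det:
  assumes "\<And>i j. (\<lambda>x. f x $ i $ j) \<in> holo U"
  shows "(\<lambda>x. det (f x :: 'n::finite cmat)) \<in> holo U"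
  unfolding det_def by (intro holo_sum holo_mult holo_prod holo_const assms)

section \<open>Inversion of matrices as a holomorphic map\<close>

lemma open_invertible: "open {A::'n::finite cmat. invertible A}"
proof -
  have "continuous_on UNIV (\<lambda>A::'n cmat. det A)"
    by (intro holo_imp_continuous_on holo_det holo_coord)
  then have "open {A::'n cmat. det A \<noteq> 0}"
    by (intro open_Collect_neq continuous_on_const)
  then show ?thesis
    by (simp add: invertible_det_nz)
qed

lemma matrix_inv_mult:
  assumes "invertible (A::'n::finite cmat)"
  shows "A ** matrix_inv A = mat 1" "matrix_inv A ** A = mat 1"
  using assms unfolding invertible_def matrix_inv_def
  by (metis (mono_tags, lifting) someI_ex)+

lemma matrix_inv_unique:
  assumes "A ** B = mat 1" "B ** A = mat 1"
  shows "matrix_inv (A::'n::finite cmat) = B"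
proof -
  have "invertible A"
    using assms by (auto simp: invertible_def)
  then have "matrix_inv A = matrix_inv A ** (A ** B)"
    by (simp add: assms)
  also have "\<dots> = B"
    using matrix_inv_mult[OF \<open>invertible A\<close>] by (simp add: matrix_mul_assoc)
  finally show ?thesis .
qed

text \<open>Exhibits the entries of the inverse as quotients of polynomials, so that they are seen
  to be holomorphic before any derivative of the inverse is known.\<close>

lemma matrix_inv_cramer:
  assumes "invertible (A::'n::finite cmat)"
  shows "matrix_inv A $ k $ l
    = det (\<chi> i j. if j = k then if i = l then 1 else 0 else A $ i $ j) * inverse (det A)"
proof -
  have "A *v (matrix_inv A *v axis l 1) = axis l 1"
    by (simp add: matrix_vector_mul_assoc matrix_inv_mult[OF assms])
  then have "matrix_inv A *v axis l 1 = (\<chi> k. det (\<chi> i j. if j = k then axis l 1 $ i else A $ i $ j) / det A)"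
    using cramer[of A "matrix_inv A *v axis l 1" "axis l 1"] assms by (simp add: invertible_det_nz)
  then have "(matrix_inv A *v axis l 1) $ k
      = det (\<chi> i j. if j = k then axis l 1 $ i else A $ i $ j) / det A"
    by simp
  moreover have "(matrix_inv A *v axis l 1) $ k = matrix_inv A $ k $ l"
    unfolding matrix_vector_mult_def vec_lambda_beta
    by (subst sum_single[of l]) (simp_all add: axis_def)
  moreover have "(\<chi> i j. if j = k then axis l 1 $ i else A $ i $ j)
      = (\<chi> i j. if j = k then if i = l then 1 else 0 else A $ i $ j)"
    by (simp add: vec_eq_iff axis_def)
  ultimately show ?thesis
    by (simp only: divide_inverse)
qed

text \<open>Cramer's rule gives the existence of a derivative; its value comes from differentiating
  \<open>X ** matrix_inv X = mat 1\<close>.\<close>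

lemma cderiv_matrix_inv:
  fixes A :: "'n::finite cmat"
  assumes A: "invertible A"
  shows "cderiv matrix_inv (\<lambda>V. - (matrix_inv A ** V ** matrix_inv A)) A"
proof -
  have "(\<lambda>A. det (\<chi> i j. if j = k then if i = l then 1 else 0 else A $ i $ j) * inverse (det A))
      \<in> holo {A::'n cmat. invertible A}" for k l
  proof (rule holo_mult)
    have "(\<lambda>A. if j = k then if i = l then 1 else 0 else A $ i $ j) \<in> holo {A::'n cmat. invertible A}"
      for i j
      by (cases "j = k") (simp_all add: holo_const holo_coord)
    then show "(\<lambda>A. det (\<chi> i j. if j = k then if i = l then 1 else 0 else A $ i $ j))
        \<in> holo {A::'n cmat. invertible A}"
      by (intro holo_det) simp
    have "cderiv (\<lambda>A. inverse (det A)) (\<lambda>v. - (inverse (det A) * dd det A v * inverse (det A))) A"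
      if "invertible A" for A :: "'n cmat"
      using that by (intro cderiv_inverse holoD[of _ UNIV] holo_det holo_coord)
        (simp_all add: invertible_det_nz)
    then show "(\<lambda>A. inverse (det A)) \<in> holo {A::'n cmat. invertible A}"
      by (intro holoI) blast
  qed
  then have "(\<lambda>A. matrix_inv A $ k $ l) \<in> holo {A::'n cmat. invertible A}" for k l
    by (rule holo_cong[OF _ open_invertible, of _ "\<lambda>A. matrix_inv A $ k $ l"])
      (simp only: matrix_inv_cramer mem_Collect_eq)
  then have "cderiv (\<lambda>A. matrix_inv A $ k $ l) (dd (\<lambda>A. matrix_inv A $ k $ l) A) A" for k l
    using A by (intro holoD) auto
  then have "cderiv (\<lambda>X. \<chi> k l. matrix_inv X $ k $ l) (\<lambda>v. \<chi> k l. dd (\<lambda>A. matrix_inv A $ k $ l) A v) A"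
    by (intro cderiv_vec_lambda)
  then obtain D where D: "cderiv matrix_inv D A"
    by auto
  have "cderiv (\<lambda>X. X ** matrix_inv X) (\<lambda>V. A ** D V + V ** matrix_inv A) A"
    by (rule cderiv_matrix_mult[OF cderiv_id D])
  then have "cderiv (\<lambda>X. mat 1) (\<lambda>V. A ** D V + V ** matrix_inv A) A"
    by (rule cderiv_transform_open[OF _ open_invertible]) (use A in \<open>auto simp: matrix_inv_mult\<close>)
  from cderiv_unique[OF this cderiv_const] have "A ** D V + V ** matrix_inv A = 0" for V
    by (rule fun_cong)
  then have "A ** D V = - (V ** matrix_inv A)" for V
    by (simp add: eq_neg_iff_add_eq_0)
  then have "matrix_inv A ** (A ** D V) = - (matrix_inv A ** V ** matrix_inv A)" for V
    by (simp add: matrix_mult_uminus matrix_mul_assoc)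
  then have "D = (\<lambda>V. - (matrix_inv A ** V ** matrix_inv A))"
    by (simp add: fun_eq_iff matrix_mul_assoc matrix_inv_mult[OF A])
  with D show ?thesis
    by simp
qed

section \<open>Entries of the r-matrix and of the structure tensors\<close>

definition ssgn :: "'n::linorder \<Rightarrow> 'n \<Rightarrow> complex"
  where "ssgn i k = (if k < i then 1 else if i < k then - 1 else 0)"

text \<open>The coefficients 2, 1 and 0 below, on and above the diagonal become the uniform
  \<open>1 + ssgn i k\<close>: the 1 is the permutation of the tensor factors, \<open>ssgn\<close>
  the skew part.\<close>

lemma r_mat_nth:
  "r_mat $ (i, k) $ (j, l) = (if j = k \<and> l = i then 1 + ssgn i k else 0)"
proof -
  have "(\<Sum>a\<in>UNIV. mat_unit a a \<otimes>\<^sub>K mat_unit a a) $ (i, k) $ (j, l)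
      = (\<Sum>a\<in>UNIV. if a = i then if k = i \<and> j = i \<and> l = i then 1 else 0 else 0)"
    unfolding sum_component
    by (intro sum.cong refl) (auto simp: tensor_def mat_unit_nth split: if_splits)
  moreover have "(\<Sum>(a, b)\<in>{(a, b). a > b}. mat_unit a b \<otimes>\<^sub>K mat_unit b a) $ (i, k) $ (j, l)
      = (\<Sum>p\<in>{(a, b). a > b}. if p = (i, k) then if j = k \<and> l = i then 1 else 0 else 0)"
    unfolding sum_component
    by (intro sum.cong refl) (auto simp: tensor_def mat_unit_nth split: if_splits)
  moreover have "finite {(a::'a, b). a > b}"
    by (rule finite_subset[OF subset_UNIV]) simp
  ultimately show ?thesis
    by (auto simp: r_mat_def ssgn_def scaleR_conv_of_real)
qed

text \<open>Multiplication by \<open>r_mat\<close> from the left exchanges the row indices of the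
  two factors, from the right their column indices; the sign compares the exchanged pair.\<close>

lemma rr_nth:
  "rr X Y $ (i, k) $ (j, l) = (1 + ssgn i k) * X $ k $ j * Y $ i $ l - (1 + ssgn l j) * X $ i $ l * Y $ k $ j"
proof -
  have XY: "(in1 X ** in2 Y) $ (i, k) $ (j, l) = X $ i $ j * Y $ k $ l" for i j k l
    unfolding matrix_matrix_mult_def vec_lambda_beta
    by (subst sum_single[of "(j, k)"]) (auto simp: in1_def in2_def tensor_def mat_def)
  have "(r_mat ** (in1 X ** in2 Y)) $ (i, k) $ (j, l) = (1 + ssgn i k) * X $ k $ j * Y $ i $ l"
    unfolding matrix_matrix_mult_def[of r_mat] vec_lambda_beta
    by (subst sum_single[of "(k, i)"]) (auto simp: r_mat_nth XY split: if_splits)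
  moreover have "(in1 X ** in2 Y ** r_mat) $ (i, k) $ (j, l) = (1 + ssgn l j) * X $ i $ l * Y $ k $ j"
    unfolding matrix_matrix_mult_def[of "in1 X ** in2 Y"] vec_lambda_beta
    by (subst sum_single[of "(l, j)"]) (auto simp: r_mat_nth XY split: if_splits)
  ultimately show ?thesis
    by (simp add: rr_def matrix_mul_assoc)
qed

text \<open>The partial transpose lives on rows \<open>(i, i)\<close> and columns
  \<open>(j, j)\<close>. Hence the signs in the two additional terms compare a column index of one
  factor with a row index of the other, whereas \<open>rr_nth\<close> compares rows with rows and
  columns with columns.\<close>

lemma form_tensor_nth:
  "form_tensor A $ (i, k) $ (j, l) = rr A A $ (i, k) $ (j, l)
    + (1 + ssgn j k) * A $ i $ k * A $ j $ l - (1 + ssgn l i) * A $ k $ i * A $ l $ j"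
proof -
  have t: "transpose1 r_mat $ (i, k) $ (j, l) = (if i = k \<and> j = l then 1 + ssgn j k else 0)"
    for i j k l :: 'a
    by (auto simp: transpose1_def r_mat_nth)
  have 1: "(in1 A ** transpose1 r_mat) $ (i, k) $ (j, l) = (if j = l then (1 + ssgn j k) * A $ i $ k else 0)"
    for i j k l
    unfolding matrix_matrix_mult_def vec_lambda_beta
    by (subst sum_single[of "(k, k)"]) (auto simp: t in1_def tensor_def mat_def split: if_splits)
  have 2: "(in2 A ** transpose1 r_mat) $ (i, k) $ (j, l) = (if j = l then (1 + ssgn j i) * A $ k $ i else 0)"
    for i j k l
    unfolding matrix_matrix_mult_def vec_lambda_beta
    by (subst sum_single[of "(i, i)"]) (auto simp: t in2_def tensor_def mat_def split: if_splits)
  have "(in1 A ** transpose1 r_mat ** in2 A) $ (i, k) $ (j, l) = (1 + ssgn j k) * A $ i $ k * A $ j $ l"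
    unfolding matrix_matrix_mult_def[of "in1 A ** transpose1 r_mat"] vec_lambda_beta
    by (subst sum_single[of "(j, j)"]) (auto simp: 1 in2_def tensor_def mat_def split: if_splits)
  moreover have "(in2 A ** transpose1 r_mat ** in1 A) $ (i, k) $ (j, l) = (1 + ssgn l i) * A $ k $ i * A $ l $ j"
    unfolding matrix_matrix_mult_def[of "in2 A ** transpose1 r_mat"] vec_lambda_beta
    by (subst sum_single[of "(l, l)"]) (auto simp: 2 in1_def tensor_def mat_def split: if_splits)
  ultimately show ?thesis
    by (simp add: form_tensor_def rr_def)
qed

section \<open>The Jacobi identity on pairs of matrices\<close>

lemma ssgn_swap: "ssgn k i = - ssgn i k"
  by (cases i k rule: linorder_cases) (simp_all add: ssgn_def)

lemma ssgn_simps: "i < k \<Longrightarrow> ssgn i k = - 1" "k < i \<Longrightarrow> ssgn i k = 1" "ssgn i i = 0"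
  by (simp_all add: ssgn_def)
text \<open>The modified classical Yang-Baxter equation in terms of coefficients. For three distinct
  indices the cyclic signs are never all equal, so their sum squares to 1 and the products add up to
  (1 - 3) / 2. If exactly two indices agree, one sign vanishes and the other two are
  opposite.\<close>

lemma ssgn_cyclic:
  "ssgn i k * ssgn k m + ssgn k m * ssgn m i + ssgn m i * ssgn i k = (if i = k \<and> k = m then 0 else - 1)"
proof (cases i k rule: linorder_cases)
  case less
  then show ?thesis
    by (cases k m rule: linorder_cases; cases i m rule: linorder_cases) (use less in \<open>auto simp: ssgn_simps\<close>)
next
  case equal
  then show ?thesis
    by (cases k m rule: linorder_cases) (simp_all add: ssgn_simps)
next
  case greater
  then show ?thesis
    by (cases k m rule: linorder_cases; cases i m rule: linorder_cases) (use greater in \<open>auto simp: ssgn_simps\<close>)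
qed

definition gl2_part :: "bool \<Rightarrow> 'n::finite cmat \<times> 'n cmat \<Rightarrow> 'n cmat"
  where "gl2_part a x = (if a then snd x else fst x)"

text \<open>The index \<open>True\<close> stands for \<open>C\<close>, \<open>False\<close> for \<open>B\<close>. The r-matrix has the coefficients
  \<open>1 + ssgn i k\<close>. In brackets of a copy with itself the symmetric part \<open>1\<close> cancels, and in those of
  \<open>B\<close> with \<open>C\<close> antisymmetry turns it into \<open>- 1\<close>; so \<open>eps\<close> replaces it by a sign that is antisymmetric
  in the copies.\<close>

definition eps :: "bool \<Rightarrow> bool \<Rightarrow> complex"
  where "eps a b = (if a = b then 0 else if a then 1 else - 1)"

lemma eps_swap: "eps b a = - eps a b"
  by (auto simp: eps_def)

text \<open>The value \<open>- 1\<close> is the same as in \<open>ssgn_cyclic\<close>; this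
  coincidence lets the mixed brackets satisfy the Jacobi identity.\<close>

lemma eps_cyclic:
  "eps a b * eps b c + eps b c * eps c a + eps c a * eps a b = (if a = b \<and> b = c then 0 else - 1)"
  by (auto simp: eps_def)

definition gl2_basis :: "bool \<times> 'n \<times> 'n \<Rightarrow> 'n::finite cmat \<times> 'n cmat"
  where "gl2_basis = (\<lambda>(a, i, j). if a then (0, mat_unit i j) else (mat_unit i j, 0))"

definition gl2_coeff ::
  "bool \<times> 'n \<times> 'n \<Rightarrow> bool \<times> 'n \<times> 'n \<Rightarrow> 'n::{finite,linorder} cmat \<times> 'n cmat \<Rightarrow> complex"
  where "gl2_coeff = (\<lambda>(a, i, j) (b, k, l) x.
    (ssgn i k + eps a b) * gl2_part a x $ k $ j * gl2_part b x $ i $ l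
    - (ssgn l j + eps a b) * gl2_part a x $ i $ l * gl2_part b x $ k $ j)"

lemma gl2_coeff_apply: "gl2_coeff (a, i, j) (b, k, l) x =
    (ssgn i k + eps a b) * gl2_part a x $ k $ j * gl2_part b x $ i $ l
    - (ssgn l j + eps a b) * gl2_part a x $ i $ l * gl2_part b x $ k $ j"
  by (simp add: gl2_coeff_def)

lemma cderiv_gl2_part: "cderiv (\<lambda>x. gl2_part a x $ i $ j) (\<lambda>v. gl2_part a v $ i $ j) x"
proof (cases a)
  case True
  have "cderiv (\<lambda>x::'a cmat \<times> 'a cmat. snd x $ i $ j) (\<lambda>v. snd v $ i $ j) x"
    by (rule cderiv_vec_nth, rule cderiv_vec_nth, rule cderiv_snd, rule cderiv_id)
  then show ?thesis
    using True by (simp add: gl2_part_def)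
next
  case False
  have "cderiv (\<lambda>x::'a cmat \<times> 'a cmat. fst x $ i $ j) (\<lambda>v. fst v $ i $ j) x"
    by (rule cderiv_vec_nth, rule cderiv_vec_nth, rule cderiv_fst, rule cderiv_id)
  then show ?thesis
    using False by (simp add: gl2_part_def)
qed

lemma cderiv_gl2_coeff:
  "cderiv (gl2_coeff (b, k, l) (c, m, n)) (\<lambda>v.
     (ssgn k m + eps b c) * (gl2_part b x $ m $ l * gl2_part c v $ k $ n + gl2_part b v $ m $ l * gl2_part c x $ k $ n)
     - (ssgn n l + eps b c) * (gl2_part b x $ k $ n * gl2_part c v $ m $ l + gl2_part b v $ k $ n * gl2_part c x $ m $ l)) x"
proof -
  have "cderiv (\<lambda>x. (ssgn k m + eps b c) * (gl2_part b x $ m $ l * gl2_part c x $ k $ n)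
      + (- (ssgn n l + eps b c)) * (gl2_part b x $ k $ n * gl2_part c x $ m $ l))
    (\<lambda>v. ((ssgn k m + eps b c) * (gl2_part b x $ m $ l * gl2_part c v $ k $ n + gl2_part b v $ m $ l * gl2_part c x $ k $ n)
        + 0 * (gl2_part b x $ m $ l * gl2_part c x $ k $ n))
      + ((- (ssgn n l + eps b c)) * (gl2_part b x $ k $ n * gl2_part c v $ m $ l + gl2_part b v $ k $ n * gl2_part c x $ m $ l)
        + 0 * (gl2_part b x $ k $ n * gl2_part c x $ m $ l))) x"
    by (intro cderiv_add cderiv_mult cderiv_const cderiv_gl2_part)
  moreover have "gl2_coeff (b, k, l) (c, m, n) =
      (\<lambda>x. (ssgn k m + eps b c) * (gl2_part b x $ m $ l * gl2_part c x $ k $ n)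
      + (- (ssgn n l + eps b c)) * (gl2_part b x $ k $ n * gl2_part c x $ m $ l))"
    by (simp add: fun_eq_iff gl2_coeff_apply algebra_simps)
  ultimately show ?thesis
    by (simp add: algebra_simps)
qed

lemma holo_gl2_coeff: "gl2_coeff p q \<in> holo U"
proof -
  obtain b k l c m n where "p = (b, k, l)" "q = (c, m, n)"
    by (metis prod.exhaust)
  then show ?thesis
    using holoI[OF cderiv_gl2_coeff] by simp
qed

lemma gl2_coeff_swap: "gl2_coeff q p x = - gl2_coeff p q x"
proof -
  obtain b k l c m n where "p = (b, k, l)" "q = (c, m, n)"
    by (metis prod.exhaust)
  then show ?thesis
    using ssgn_swap[of m k] ssgn_swap[of n l] eps_swap[of c b]
    by (simp add: gl2_coeff_apply algebra_simps)
qed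

lemma sum_gl2_coeff_part:
  "(\<Sum>s\<in>UNIV. gl2_coeff p s x * gl2_part b (gl2_basis s) $ k $ l) = gl2_coeff p (b, k, l) x"
  by (subst sum_single[of "(b, k, l)"])
    (auto simp: gl2_basis_def gl2_part_def mat_unit_nth split: if_splits)

text \<open>The sum over \<open>s\<close> is the bracket of the coordinate \<open>p\<close> with the
  quadratic function \<open>gl2_coeff (b, k, l) (c, m, n)\<close>; the Leibniz rule reduces it to
  brackets of coordinates.\<close>

lemma gl2_coeff_dd:
  "(\<Sum>s\<in>UNIV. gl2_coeff p s x * dd (gl2_coeff (b, k, l) (c, m, n)) x (gl2_basis s))
    = (ssgn k m + eps b c) * (gl2_part b x $ m $ l * gl2_coeff p (c, k, n) x
        + gl2_coeff p (b, m, l) x * gl2_part c x $ k $ n)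
      - (ssgn n l + eps b c) * (gl2_part b x $ k $ n * gl2_coeff p (c, m, l) x
        + gl2_coeff p (b, k, n) x * gl2_part c x $ m $ l)"
proof -
  have "(\<Sum>s\<in>UNIV. gl2_coeff p s x * dd (gl2_coeff (b, k, l) (c, m, n)) x (gl2_basis s))
    = (\<Sum>s\<in>UNIV. (ssgn k m + eps b c) * gl2_part b x $ m $ l * (gl2_coeff p s x * gl2_part c (gl2_basis s) $ k $ n)
        + (ssgn k m + eps b c) * gl2_part c x $ k $ n * (gl2_coeff p s x * gl2_part b (gl2_basis s) $ m $ l)
        - (ssgn n l + eps b c) * gl2_part b x $ k $ n * (gl2_coeff p s x * gl2_part c (gl2_basis s) $ m $ l)
        - (ssgn n l + eps b c) * gl2_part c x $ m $ l * (gl2_coeff p s x * gl2_part b (gl2_basis s) $ k $ n))"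
    unfolding cderiv_frechet[OF cderiv_gl2_coeff] by (intro sum.cong refl) algebra
  also have "\<dots> = (ssgn k m + eps b c) * gl2_part b x $ m $ l * gl2_coeff p (c, k, n) x
        + (ssgn k m + eps b c) * gl2_part c x $ k $ n * gl2_coeff p (b, m, l) x
        - (ssgn n l + eps b c) * gl2_part b x $ k $ n * gl2_coeff p (c, m, l) x
        - (ssgn n l + eps b c) * gl2_part c x $ m $ l * gl2_coeff p (b, k, n) x"
    by (simp only: sum.distrib sum_subtractf sum_gl2_coeff_part flip: sum_distrib_left)
  finally show ?thesis
    by algebra
qed

text \<open>The variable \<open>amj\<close> stands for the entry in row \<open>m\<close> and column \<open>j\<close> of copy \<open>a\<close>; \<open>s\<close>, \<open>t\<close>, \<open>e\<close> are
  the cyclic signs of the rows \<open>i, k, m\<close>, the columns \<open>j, l, n\<close> and the copies \<open>a, b, c\<close>.\<close>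

lemma jacobi_polynomial:
  fixes s1 s2 s3 t1 t2 t3 e1 e2 e3 :: complex
    and aij ail ain akj akl akn amj aml amn :: complex
    and bij bil bin bkj bkl bkn bmj bml bmn :: complex
    and cij cil cin ckj ckl ckn cmj cml cmn :: complex
  shows "((s2 + e2) * (bml * ((s1 + (- e3)) * akj * cin - (t3 + (- e3)) * ain * ckj) + (((- s3) + e1) * amj * bil
      - ((- t1) + e1) * ail * bmj) * ckn)
      - ((- t2) + e2) * (bkn * (((- s3) + (- e3)) * amj * cil
      - ((- t1) + (- e3)) * ail * cmj) + ((s1 + e1) * akj * bin - (t3 + e1) * ain * bkj) * cml))
    + ((s3 + e3) * (cin * ((s2 + (- e1)) * bml * akj - (t1 + (- e1)) * bkj * aml) + (((- s1) + e2) * bil * ckn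
      - ((- t2) + e2) * bkn * cil) * amj)
      - ((- t3) + e3) * (cmj * (((- s1) + (- e1)) * bil * akn
      - ((- t2) + (- e1)) * bkn * ail) + ((s2 + e2) * bml * ckj
      - (t1 + e2) * bkj * cml) * ain))
    + ((s1 + e1) * (akj * ((s3 + (- e2)) * cin * bml - (t2 + (- e2)) * cml * bin) + (((- s2) + e3) * ckn * amj
      - ((- t3) + e3) * cmj * akn) * bil)
      - ((- t1) + e1) * (ail * (((- s2) + (- e2)) * ckn * bmj
      - ((- t3) + (- e2)) * cmj * bkn) + ((s3 + e3) * cin * aml - (t2 + e3) * cml * ain) * bkj))
    = - ((s1 * s2 + s2 * s3 + s3 * s1) - (e1 * e2 + e2 * e3 + e3 * e1)) * (amj * bil * ckn - akj * bml * cin)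
      - ((t1 * t2 + t2 * t3 + t3 * t1) - (e1 * e2 + e2 * e3 + e3 * e1)) * (ain * bkj * cml - ail * bkn * cmj)"
  by algebra

lemma gl2_jacobi:
  "(\<Sum>s\<in>UNIV. gl2_coeff p s x * dd (gl2_coeff q r) x (gl2_basis s))
    + (\<Sum>s\<in>UNIV. gl2_coeff q s x * dd (gl2_coeff r p) x (gl2_basis s))
    + (\<Sum>s\<in>UNIV. gl2_coeff r s x * dd (gl2_coeff p q) x (gl2_basis s)) = 0"
proof -
  obtain a i j b k l c m n where pqr: "p = (a, i, j)" "q = (b, k, l)" "r = (c, m, n)"
    by (metis prod.exhaust)
  let ?M = "gl2_part a x $ m $ j * gl2_part b x $ i $ l * gl2_part c x $ k $ n
    - gl2_part a x $ k $ j * gl2_part b x $ m $ l * gl2_part c x $ i $ n"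
  let ?N = "gl2_part a x $ i $ n * gl2_part b x $ k $ j * gl2_part c x $ m $ l
    - gl2_part a x $ i $ l * gl2_part b x $ k $ n * gl2_part c x $ m $ j"
  let ?s = "ssgn i k * ssgn k m + ssgn k m * ssgn m i + ssgn m i * ssgn i k"
  let ?t = "ssgn j l * ssgn l n + ssgn l n * ssgn n j + ssgn n j * ssgn j l"
  let ?e = "eps a b * eps b c + eps b c * eps c a + eps c a * eps a b"
  have sw: "ssgn k i = - ssgn i k" "ssgn m k = - ssgn k m" "ssgn i m = - ssgn m i"
    "ssgn l j = - ssgn j l" "ssgn n l = - ssgn l n" "ssgn j n = - ssgn n j"
    "eps b a = - eps a b" "eps c b = - eps b c" "eps a c = - eps c a"
    by (rule ssgn_swap eps_swap)+
  have "(\<Sum>s\<in>UNIV. gl2_coeff p s x * dd (gl2_coeff q r) x (gl2_basis s))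
    + (\<Sum>s\<in>UNIV. gl2_coeff q s x * dd (gl2_coeff r p) x (gl2_basis s))
    + (\<Sum>s\<in>UNIV. gl2_coeff r s x * dd (gl2_coeff p q) x (gl2_basis s))
    = - (?s - ?e) * ?M - (?t - ?e) * ?N"
    unfolding pqr gl2_coeff_dd unfolding gl2_coeff_apply sw by (rule jacobi_polynomial)
  \<comment> \<open>All three cyclic sums are 0 or \<open>- 1\<close>. If \<open>a\<close>,
    \<open>b\<close>, \<open>c\<close> are not all equal, \<open>?s - ?e\<close> is nonzero only
    when the three rows coincide, and then the two monomials of \<open>?M\<close> are equal;
    likewise \<open>?t - ?e\<close> with the columns and \<open>?N\<close>. If
    \<open>a = b = c\<close>, then \<open>?N = - ?M\<close>, so that only \<open>?s - ?t\<close>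
    matters. It is nonzero only when the rows or the columns coincide, and either makes
    \<open>?M\<close> vanish.\<close>
  also have "\<dots> = 0"
    unfolding ssgn_cyclic eps_cyclic by auto
  finally show ?thesis .
qed

section \<open>Brackets as forms in the gradients\<close>

text \<open>This is the form \<open>t\<close> of the overview: \<open>r_mat\<close> paired entrywise
  with the tensor product of \<open>M\<close> and \<open>N\<close>, that is, the trace of
  \<open>M ** N\<close> plus its sign-weighted variant.\<close>

definition theta_form :: "'n::{finite,linorder} cmat \<Rightarrow> 'n cmat \<Rightarrow> complex"
  where "theta_form M N = (\<Sum>i\<in>UNIV. \<Sum>k\<in>UNIV. (1 + ssgn i k) * M $ i $ k * N $ k $ i)"

text \<open>\<open>U ** transpose X\<close> is the gradient along left multiplications of
  \<open>X\<close>, and \<open>transpose X ** U\<close> that along right multiplications.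
  Transposing both arguments of \<open>theta_form\<close> exchanges them, so the second term equals
  \<open>theta_form (transpose X ** U) (transpose Y ** V)\<close>: this is the Sklyanin bracket,
  left minus right.\<close>

definition rr_form ::
  "'n::{finite,linorder} cmat \<Rightarrow> 'n cmat \<Rightarrow> 'n cmat \<Rightarrow> 'n cmat \<Rightarrow> complex"
  where "rr_form X Y U V = theta_form (U ** transpose X) (V ** transpose Y)
    - theta_form (transpose V ** Y) (transpose U ** X)"

lemma theta_form_product:
  assumes "\<And>i k. M $ i $ k = (\<Sum>j\<in>UNIV. f i k j)" "\<And>k i. N $ k $ i = (\<Sum>l\<in>UNIV. g k i l)"
  shows "theta_form M N = (\<Sum>i\<in>UNIV. \<Sum>k\<in>UNIV. \<Sum>j\<in>UNIV. \<Sum>l\<in>UNIV. (1 + ssgn i k) * (f i k j * g k i l))"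
  unfolding theta_form_def assms
  by (intro sum.cong refl, subst mult.assoc, subst sum_product, simp only: sum_distrib_left)

lemma theta_form_sums:
  "theta_form (U ** transpose X) (V ** transpose Y)
    = (\<Sum>i\<in>UNIV. \<Sum>j\<in>UNIV. \<Sum>k\<in>UNIV. \<Sum>l\<in>UNIV. (1 + ssgn i k) * X $ k $ j * Y $ i $ l * U $ i $ j * V $ k $ l)"
proof -
  have "theta_form (U ** transpose X) (V ** transpose Y)
    = (\<Sum>i\<in>UNIV. \<Sum>k\<in>UNIV. \<Sum>j\<in>UNIV. \<Sum>l\<in>UNIV. (1 + ssgn i k) * X $ k $ j * Y $ i $ l * U $ i $ j * V $ k $ l)"
    by (subst theta_form_product[where f = "\<lambda>i k j. U $ i $ j * X $ k $ j"
          and g = "\<lambda>k i l. V $ k $ l * Y $ i $ l"])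
      (simp_all add: matrix_matrix_mult_def transpose_def mult_ac)
  also have "\<dots> = (\<Sum>i\<in>UNIV. \<Sum>j\<in>UNIV. \<Sum>k\<in>UNIV. \<Sum>l\<in>UNIV. (1 + ssgn i k) * X $ k $ j * Y $ i $ l * U $ i $ j * V $ k $ l)"
    by (rule sum.cong[OF refl], rule sum.swap)
  finally show ?thesis .
qed

lemma sum_swap_outer4:
  "(\<Sum>l\<in>A. \<Sum>j\<in>B. \<Sum>k\<in>C. \<Sum>i\<in>D. (f l j k i::complex)) = (\<Sum>i\<in>D. \<Sum>j\<in>B. \<Sum>k\<in>C. \<Sum>l\<in>A. f l j k i)"
proof -
  have "(\<Sum>l\<in>A. \<Sum>j\<in>B. \<Sum>k\<in>C. \<Sum>i\<in>D. f l j k i) = (\<Sum>l\<in>A. \<Sum>j\<in>B. \<Sum>i\<in>D. \<Sum>k\<in>C. f l j k i)"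
    by (intro sum.cong refl, rule sum.swap)
  also have "\<dots> = (\<Sum>l\<in>A. \<Sum>i\<in>D. \<Sum>j\<in>B. \<Sum>k\<in>C. f l j k i)"
    by (intro sum.cong refl, rule sum.swap)
  also have "\<dots> = (\<Sum>i\<in>D. \<Sum>l\<in>A. \<Sum>j\<in>B. \<Sum>k\<in>C. f l j k i)"
    by (rule sum.swap)
  also have "\<dots> = (\<Sum>i\<in>D. \<Sum>j\<in>B. \<Sum>l\<in>A. \<Sum>k\<in>C. f l j k i)"
    by (intro sum.cong refl, rule sum.swap)
  also have "\<dots> = (\<Sum>i\<in>D. \<Sum>j\<in>B. \<Sum>k\<in>C. \<Sum>l\<in>A. f l j k i)"
    by (intro sum.cong refl, rule sum.swap)
  finally show ?thesis .
qed

lemma theta_form_sums':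
  "theta_form (transpose V ** Y) (transpose U ** X)
    = (\<Sum>i\<in>UNIV. \<Sum>j\<in>UNIV. \<Sum>k\<in>UNIV. \<Sum>l\<in>UNIV. (1 + ssgn l j) * X $ i $ l * Y $ k $ j * U $ i $ j * V $ k $ l)"
proof -
  have "theta_form (transpose V ** Y) (transpose U ** X)
    = (\<Sum>l\<in>UNIV. \<Sum>j\<in>UNIV. \<Sum>k\<in>UNIV. \<Sum>i\<in>UNIV. (1 + ssgn l j) * X $ i $ l * Y $ k $ j * U $ i $ j * V $ k $ l)"
    by (subst theta_form_product[where f = "\<lambda>l j k. V $ k $ l * Y $ k $ j"
          and g = "\<lambda>j l i. U $ i $ j * X $ i $ l"])
      (simp_all add: matrix_matrix_mult_def transpose_def mult_ac)
  also note sum_swap_outer4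
  finally show ?thesis .
qed

lemma rr_contract:
  "(\<Sum>i\<in>UNIV. \<Sum>j\<in>UNIV. \<Sum>k\<in>UNIV. \<Sum>l\<in>UNIV. rr X Y $ (i, k) $ (j, l) * U $ i $ j * V $ k $ l)
    = rr_form X Y U V"
  unfolding rr_form_def theta_form_sums theta_form_sums' rr_nth left_diff_distrib sum_subtractf ..

lemma theta_form_transpose: "theta_form (transpose M) (transpose N) = theta_form N M"
  by (simp add: theta_form_def transpose_def mult_ac)

text \<open>Exchanging the arguments flips the skew part, which cancels, and preserves the
  permutation part, which doubles.\<close>

lemma theta_form_sym: "theta_form M N + theta_form N M = 2 * trace (M ** N)"
proof -
  have "theta_form N M = (\<Sum>i\<in>UNIV. \<Sum>k\<in>UNIV. (1 + ssgn k i) * N $ k $ i * M $ i $ k)"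
    unfolding theta_form_def by (rule sum.swap)
  then have "theta_form M N + theta_form N M
    = (\<Sum>i\<in>UNIV. \<Sum>k\<in>UNIV. (1 + ssgn i k) * M $ i $ k * N $ k $ i + (1 + ssgn k i) * N $ k $ i * M $ i $ k)"
    by (simp add: theta_form_def sum.distrib)
  also have "\<dots> = (\<Sum>i\<in>UNIV. \<Sum>k\<in>UNIV. 2 * (M $ i $ k * N $ k $ i))"
    by (intro sum.cong refl, subst (2) ssgn_swap) (simp add: algebra_simps)
  finally show ?thesis
    by (simp add: trace_def matrix_matrix_mult_def sum_distrib_left)
qed

lemma theta_form_uminus: "theta_form (- M) N = - theta_form M N" "theta_form M (- N) = - theta_form M N"
  by (simp_all add: theta_form_def sum_negf)

definition grad_fst :: "('n::finite cmat \<times> 'n cmat \<Rightarrow> complex) \<Rightarrow> 'n cmat"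
  where "grad_fst D = grad (\<lambda>V. D (V, 0))"

definition grad_snd :: "('n::finite cmat \<times> 'n cmat \<Rightarrow> complex) \<Rightarrow> 'n cmat"
  where "grad_snd D = grad (\<lambda>V. D (0, V))"

text \<open>\<open>U\<close> and \<open>U'\<close> are the gradients of the first function with
  respect to \<open>B\<close> and \<open>C\<close>, and \<open>V\<close> and \<open>V'\<close> those
  of the second.\<close>

definition gl2_form ::
  "'n::{finite,linorder} cmat \<Rightarrow> 'n cmat \<Rightarrow> 'n cmat \<Rightarrow> 'n cmat \<Rightarrow> 'n cmat \<Rightarrow> 'n cmat \<Rightarrow> complex"
  where "gl2_form B C U U' V V' = rr_form B B U V + rr_form C C U' V' + rr_form C B U' V - rr_form C B V' U"

lemma gl2_bracket_eq_form:
  "gl2_bracket f g (B, C) = gl2_form B C (grad_fst (dd f (B, C))) (grad_snd (dd f (B, C)))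
    (grad_fst (dd g (B, C))) (grad_snd (dd g (B, C)))"
  unfolding gl2_form_def rr_contract[symmetric]
  by (simp add: gl2_bracket_def Let_def grad_fst_def grad_snd_def grad_def sum.distrib
      right_diff_distrib sum_subtractf mult_ac)

lemma form_bracket_eq:
  "form_bracket f g A = rr_form A A (grad (dd f A)) (grad (dd g A))
    + theta_form (transpose (grad (dd f A)) ** A) (grad (dd g A) ** transpose A)
    - theta_form (transpose (grad (dd g A)) ** A) (grad (dd f A) ** transpose A)"
proof -
  have 1: "theta_form (transpose U ** A) (V ** transpose A)
    = (\<Sum>i\<in>UNIV. \<Sum>j\<in>UNIV. \<Sum>k\<in>UNIV. \<Sum>l\<in>UNIV. (1 + ssgn j k) * A $ i $ k * A $ j $ l * U $ i $ j * V $ k $ l)" for U V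
  proof -
    have "theta_form (transpose U ** A) (V ** transpose A)
      = (\<Sum>j\<in>UNIV. \<Sum>k\<in>UNIV. \<Sum>i\<in>UNIV. \<Sum>l\<in>UNIV. (1 + ssgn j k) * A $ i $ k * A $ j $ l * U $ i $ j * V $ k $ l)"
      by (subst theta_form_product[where f = "\<lambda>j k i. U $ i $ j * A $ i $ k"
            and g = "\<lambda>k j l. V $ k $ l * A $ j $ l"])
        (simp_all add: matrix_matrix_mult_def transpose_def mult_ac)
    also have "\<dots> = (\<Sum>j\<in>UNIV. \<Sum>i\<in>UNIV. \<Sum>k\<in>UNIV. \<Sum>l\<in>UNIV. (1 + ssgn j k) * A $ i $ k * A $ j $ l * U $ i $ j * V $ k $ l)"
      by (rule sum.cong[OF refl], rule sum.swap)
    finally show ?thesis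
      by (subst sum.swap)
  qed
  have 2: "theta_form (transpose V ** A) (U ** transpose A)
    = (\<Sum>i\<in>UNIV. \<Sum>j\<in>UNIV. \<Sum>k\<in>UNIV. \<Sum>l\<in>UNIV. (1 + ssgn l i) * A $ k $ i * A $ l $ j * U $ i $ j * V $ k $ l)" for U V
  proof -
    have "theta_form (transpose V ** A) (U ** transpose A)
      = (\<Sum>k\<in>UNIV. \<Sum>l\<in>UNIV. \<Sum>i\<in>UNIV. \<Sum>j\<in>UNIV. (1 + ssgn l i) * A $ k $ i * A $ l $ j * U $ i $ j * V $ k $ l)"
      unfolding 1 by (simp only: mult_ac)
    also have "\<dots> = (\<Sum>i\<in>UNIV. \<Sum>j\<in>UNIV. \<Sum>k\<in>UNIV. \<Sum>l\<in>UNIV. (1 + ssgn l i) * A $ k $ i * A $ l $ j * U $ i $ j * V $ k $ l)"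
      unfolding sum4_tuple
      by (rule sum.reindex_bij_witness[of _ "\<lambda>(i, j, k, l). (k, l, i, j)" "\<lambda>(i, j, k, l). (k, l, i, j)"]) auto
    finally show ?thesis .
  qed
  show ?thesis
    unfolding 1[of "grad (dd f A)" "grad (dd g A)"] 2[of "grad (dd g A)" "grad (dd f A)"]
      rr_contract[symmetric] sum.distrib[symmetric] sum_subtractf[symmetric]
    by (simp add: form_bracket_def Let_def form_tensor_nth grad_def algebra_simps)
qed

text \<open>Links the definition by separate sums over \<open>B\<close> and \<open>C\<close> to a
  single family of coordinates, which makes the general theorem on coordinate brackets applicable.
  The block of \<open>B\<close> with \<open>C\<close> is obtained from that of \<open>C\<close> with
  \<open>B\<close> by antisymmetry.\<close>

lemma gl2_bracket_coord: "gl2_bracket = coord_bracket gl2_basis gl2_coeff"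
proof (intro ext)
  fix f g and x :: "'a cmat \<times> 'a cmat"
  obtain B C where x: "x = (B, C)"
    by (cases x)
  let ?U = "\<lambda>i j. dd f x (mat_unit i j, 0)" and ?U' = "\<lambda>i j. dd f x (0, mat_unit i j)"
  let ?V = "\<lambda>i j. dd g x (mat_unit i j, 0)" and ?V' = "\<lambda>i j. dd g x (0, mat_unit i j)"
  have UNIV_index: "(\<Sum>p\<in>(UNIV::(bool \<times> 'a \<times> 'a) set). h p)
      = (\<Sum>i\<in>UNIV. \<Sum>j\<in>UNIV. h (False, i, j)) + (\<Sum>i\<in>UNIV. \<Sum>j\<in>UNIV. h (True, i, j))"
    for h :: "_ \<Rightarrow> complex"
  proof -
    have "(\<Sum>p\<in>UNIV. h p) = (\<Sum>a\<in>UNIV. \<Sum>i\<in>UNIV. \<Sum>j\<in>UNIV. h (a, i, j))"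
      by (simp add: sum.cartesian_product split_def)
    then show ?thesis
      by (simp add: UNIV_bool)
  qed
  have 1: "gl2_coeff (a, i, j) (a, k, l) x = rr (gl2_part a x) (gl2_part a x) $ (i, k) $ (j, l)" for a i j k l
    using ssgn_swap[of l j] by (simp add: gl2_coeff_apply eps_def rr_nth algebra_simps)
  have 2: "gl2_coeff (True, i, j) (False, k, l) x = rr C B $ (i, k) $ (j, l)" for i j k l
    by (simp add: gl2_coeff_apply eps_def rr_nth gl2_part_def x algebra_simps)
  have 3: "gl2_coeff (False, i, j) (True, k, l) x = - rr C B $ (k, i) $ (l, j)" for i j k l
    by (subst gl2_coeff_swap) (simp only: 2)
  have 4: "(\<Sum>i\<in>UNIV. \<Sum>j\<in>UNIV. \<Sum>k\<in>UNIV. \<Sum>l\<in>UNIV. rr C B $ (k, i) $ (l, j) * ?U i j * ?V' k l)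
    = (\<Sum>i\<in>UNIV. \<Sum>j\<in>UNIV. \<Sum>k\<in>UNIV. \<Sum>l\<in>UNIV. rr C B $ (i, k) $ (j, l) * ?U k l * ?V' i j)"
    unfolding sum4_tuple
    by (rule sum.reindex_bij_witness[of _ "\<lambda>(i, j, k, l). (k, l, i, j)" "\<lambda>(i, j, k, l). (k, l, i, j)"]) auto
  have 5: "gl2_part False x = B" "gl2_part True x = C"
    by (simp_all add: gl2_part_def x)
  have "coord_bracket gl2_basis gl2_coeff f g x =
      (\<Sum>i\<in>UNIV. \<Sum>j\<in>UNIV. \<Sum>k\<in>UNIV. \<Sum>l\<in>UNIV. rr B B $ (i, k) $ (j, l) * ?U i j * ?V k l)
    - (\<Sum>i\<in>UNIV. \<Sum>j\<in>UNIV. \<Sum>k\<in>UNIV. \<Sum>l\<in>UNIV. rr C B $ (k, i) $ (l, j) * ?U i j * ?V' k l)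
    + (\<Sum>i\<in>UNIV. \<Sum>j\<in>UNIV. \<Sum>k\<in>UNIV. \<Sum>l\<in>UNIV. rr C B $ (i, k) $ (j, l) * ?U' i j * ?V k l)
    + (\<Sum>i\<in>UNIV. \<Sum>j\<in>UNIV. \<Sum>k\<in>UNIV. \<Sum>l\<in>UNIV. rr C C $ (i, k) $ (j, l) * ?U' i j * ?V' k l)"
    by (simp add: coord_bracket_def UNIV_index 1 2 3 5 gl2_basis_def sum.distrib sum_negf)
  also have "\<dots> = gl2_bracket f g x"
    unfolding 4 by (simp add: x gl2_bracket_def Let_def sum.distrib sum_subtractf algebra_simps)
  finally show "gl2_bracket f g x = coord_bracket gl2_basis gl2_coeff f g x"
    by simp
qed

theorem poisson_structure_gl2:
  "open S \<Longrightarrow> poisson_structure (open_space S gl2_bracket)"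
  unfolding gl2_bracket_coord
  by (rule poisson_structure_coord_bracket[OF _ holo_gl2_coeff gl2_coeff_swap gl2_jacobi])

section \<open>Products, inverse transposition and the passage to forms\<close>

lemma rr_form_mult:
  "rr_form X Y (U ** transpose X') (V ** transpose Y')
     + rr_form X' Y' (transpose X ** U) (transpose Y ** V)
    = rr_form (X ** X') (Y ** Y') U V"
proof -
  \<comment> \<open>Up to transposition, \<open>?K\<close> and \<open>?L\<close> are at once the
    right gradients in the first factors and the left gradients in the second factors. The right
    term of one summand thus cancels the left term of the other.\<close>
  let ?K = "X' ** transpose U ** X" and ?L = "Y' ** transpose V ** Y"
  have "rr_form X Y (U ** transpose X') (V ** transpose Y')
    = theta_form (U ** transpose (X ** X')) (V ** transpose (Y ** Y')) - theta_form ?L ?K"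
    by (simp add: rr_form_def matrix_transpose_mul matrix_mul_assoc)
  moreover have "rr_form X' Y' (transpose X ** U) (transpose Y ** V)
    = theta_form (transpose ?K) (transpose ?L) - theta_form (transpose V ** (Y ** Y')) (transpose U ** (X ** X'))"
    by (simp add: rr_form_def matrix_transpose_mul matrix_mul_assoc)
  ultimately show ?thesis
    by (simp add: theta_form_transpose rr_form_def)
qed

text \<open>Under inverse transposition each left or right gradient becomes minus its transpose. The
  two signs cancel in a bilinear form, and transposition exchanges its arguments; hence the reversed
  order \<open>W Z V U\<close>.\<close>

lemma rr_form_inv_transpose:
  assumes "Z ** transpose X = mat 1" "transpose X ** Z = mat 1"
    and "W ** transpose Y = mat 1" "transpose Y ** W = mat 1"
  shows "rr_form X Y (- (Z ** transpose U ** Z)) (- (W ** transpose V ** W)) = rr_form W Z V U"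
proof -
  have 1: "Z ** transpose U ** Z ** transpose X = Z ** transpose U"
    "W ** transpose V ** W ** transpose Y = W ** transpose V"
    using assms by (simp_all flip: matrix_mul_assoc)
  have "transpose Z ** X = mat 1" "transpose W ** Y = mat 1"
    using assms by (metis matrix_transpose_mul transpose_mat transpose_transpose)+
  then have 2: "transpose (Z ** transpose U ** Z) ** X = transpose Z ** U"
    "transpose (W ** transpose V ** W) ** Y = transpose W ** V"
    by (simp_all add: matrix_transpose_mul flip: matrix_mul_assoc)
  have 3: "Z ** transpose U = transpose (U ** transpose Z)" "W ** transpose V = transpose (V ** transpose W)"
    "transpose Z ** U = transpose (transpose U ** Z)" "transpose W ** V = transpose (transpose V ** W)"
    by (simp_all add: matrix_transpose_mul)
  show ?thesis
    unfolding rr_form_def transpose_uminus matrix_mult_uminus theta_form_uminus minus_minus 1 2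
    unfolding 3 theta_form_transpose ..
qed

text \<open>The symmetric part of each \<open>theta_form\<close> is a trace, and the traces of the
  left and the right gradients agree when both matrices are \<open>X\<close>.\<close>

lemma rr_form_antisym: "rr_form X X U V = - rr_form X X V U"
proof -
  have "trace ((U ** transpose X) ** (V ** transpose X)) = trace (transpose (U ** transpose X ** (V ** transpose X)))"
    by (simp add: trace_def transpose_def)
  also have "\<dots> = trace (X ** (transpose V ** X ** transpose U))"
    by (simp add: matrix_transpose_mul matrix_mul_assoc)
  also have "\<dots> = trace ((transpose V ** X) ** (transpose U ** X))"
    by (subst trace_mul_sym) (simp add: matrix_mul_assoc)
  finally have "theta_form (U ** transpose X) (V ** transpose X) + theta_form (V ** transpose X) (U ** transpose X)
     = theta_form (transpose V ** X) (transpose U ** X) + theta_form (transpose U ** X) (transpose V ** X)"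
    by (simp add: theta_form_sym)
  then show ?thesis
    by (simp add: rr_form_def algebra_simps)
qed

lemma gl2_form_mult:
  "gl2_form B C (U ** transpose B') (U' ** transpose C') (V ** transpose B') (V' ** transpose C')
    + gl2_form B' C' (transpose B ** U) (transpose C ** U') (transpose B ** V) (transpose C ** V')
    = gl2_form (B ** B') (C ** C') U U' V V'"
  unfolding gl2_form_def rr_form_mult[symmetric] by simp

text \<open>In the mixed terms, swapping the copies and reversing the gradients interchanges the two
  summands, which have opposite signs. In the terms within one copy the sign comes from
  \<open>rr_form_antisym\<close>.\<close>

lemma gl2_form_Theta:
  assumes "Z ** transpose B = mat 1" "transpose B ** Z = mat 1"
    and "W ** transpose C = mat 1" "transpose C ** W = mat 1"
  shows "gl2_form B C (- (Z ** transpose U' ** Z)) (- (W ** transpose U ** W))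
      (- (Z ** transpose V' ** Z)) (- (W ** transpose V ** W)) = - gl2_form W Z U U' V V'"
  unfolding gl2_form_def rr_form_inv_transpose[OF assms] rr_form_inv_transpose[OF assms(1,2,1,2)]
    rr_form_inv_transpose[OF assms(3,4,3,4)] rr_form_inv_transpose[OF assms(3,4,1,2)]
  using rr_form_antisym[of Z V' U'] rr_form_antisym[of W V U] by simp

text \<open>\<open>U ** C\<close> and \<open>transpose U ** B\<close> are the gradients of a
  function pulled back along the form map. The left terms depend on \<open>A\<close> alone. The
  right terms of the two mixed brackets cancel, and those within the copies add up to
  \<open>t N M + t M N\<close>, twice a trace. Cyclicity moves \<open>transpose C\<close> around to
  make this an expression in \<open>A\<close>, and half of it cancels a left term.\<close>

lemma gl2_form_form:
  fixes B C U V :: "'n::{finite,linorder} cmat"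
  defines "A \<equiv> B ** transpose C"
  shows "gl2_form B C (U ** C) (transpose U ** B) (V ** C) (transpose V ** B)
    = rr_form A A U V + theta_form (transpose U ** A) (V ** transpose A)
      - theta_form (transpose V ** A) (U ** transpose A)"
proof -
  let ?M = "transpose C ** transpose U ** B" and ?N = "transpose C ** transpose V ** B"
  note simps = rr_form_def A_def matrix_transpose_mul matrix_mul_assoc
  have 1: "rr_form B B (U ** C) (V ** C) = theta_form (U ** transpose A) (V ** transpose A) - theta_form ?N ?M"
    by (simp add: simps)
  have "rr_form C C (transpose U ** B) (transpose V ** B)
    = theta_form (transpose U ** A) (transpose V ** A) - theta_form (transpose ?N) (transpose ?M)"
    by (simp add: simps)
  then have 2: "rr_form C C (transpose U ** B) (transpose V ** B)
    = theta_form (transpose U ** A) (transpose V ** A) - theta_form ?M ?N"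
    by (simp add: theta_form_transpose)
  have 3: "rr_form C B (transpose U ** B) (V ** C)
    = theta_form (transpose U ** A) (V ** transpose A) - theta_form ?N (transpose ?M)"
    by (simp add: simps)
  have "theta_form ?M (transpose ?N) = theta_form (transpose (transpose ?M)) (transpose ?N)"
    by simp
  then have 4: "rr_form C B (transpose V ** B) (U ** C)
    = theta_form (transpose V ** A) (U ** transpose A) - theta_form ?N (transpose ?M)"
    by (simp only: theta_form_transpose) (simp add: simps)
  have "theta_form ?N ?M + theta_form ?M ?N = 2 * trace (?N ** ?M)"
    by (rule theta_form_sym)
  also have "trace (?N ** ?M) = trace (transpose C ** (transpose V ** B ** transpose C ** transpose U ** B))"
    by (simp add: matrix_mul_assoc)
  also have "\<dots> = trace ((transpose V ** B ** transpose C ** transpose U ** B) ** transpose C)"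
    by (rule trace_mul_sym)
  also have "\<dots> = trace ((transpose V ** A) ** (transpose U ** A))"
    by (simp add: A_def matrix_mul_assoc)
  finally have "theta_form ?N ?M + theta_form ?M ?N
      = theta_form (transpose V ** A) (transpose U ** A) + theta_form (transpose U ** A) (transpose V ** A)"
    by (simp add: theta_form_sym)
  then show ?thesis
    by (simp add: gl2_form_def 1 2 3 4 rr_form_def[of A] algebra_simps)
qed

section \<open>Poisson maps\<close>

lemma scaleC_zero_right [simp]: "c *\<^sub>C (0::'a::complex_normed_vector) = 0"
  using norm_scaleC[of c "0::'a"] by simp

lemma clinear_Pair:
  assumes "clinear D"
  shows "clinear (\<lambda>V. D (V, 0))" "clinear (\<lambda>V. D (0, V))"
proof -
  have "D (u + v, 0) = D ((u, 0) + (v, 0))" "D (0, u' + v') = D ((0, u') + (0, v'))"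
    "D (c *\<^sub>C u, 0) = D (c *\<^sub>C (u, 0))" "D (0, c *\<^sub>C u') = D (c *\<^sub>C (0, u'))" for u v u' v' c
    by (simp_all add: scaleC_prod_def)
  then show "clinear (\<lambda>V. D (V, 0))" "clinear (\<lambda>V. D (0, V))"
    using assms by (auto simp: clinear_def simp del: add_Pair)
qed

lemma holo_comp:
  assumes "f \<in> holo V" "\<And>x. x \<in> S \<Longrightarrow> \<phi> x \<in> V" "\<And>x. x \<in> S \<Longrightarrow> cderiv \<phi> (D x) x"
  shows "f \<circ> \<phi> \<in> holo S"
  unfolding comp_apply[abs_def]
  by (rule holoI, rule cderiv_compose[OF assms(3) holoD[OF assms(1,2)]])

lemma dd_comp:
  assumes "f \<in> holo V" "\<phi> x \<in> V" "cderiv \<phi> D x"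
  shows "dd (f \<circ> \<phi>) x = (\<lambda>v. dd f (\<phi> x) (D v))"
  unfolding comp_apply[abs_def]
  by (rule cderiv_frechet, rule cderiv_compose[OF assms(3) holoD[OF assms(1,2)]])

lemma cderiv_imp_continuous_on:
  assumes "\<And>x. x \<in> S \<Longrightarrow> cderiv \<phi> (D x) x"
  shows "continuous_on S \<phi>"
  using assms by (meson cderiv_has_derivative continuous_at_imp_continuous_on has_derivative_continuous)

lemma holo_map_open_space:
  assumes "\<And>x. x \<in> S \<Longrightarrow> cderiv \<phi> (D x) x" "\<phi> ` S \<subseteq> T"
  shows "holo_map (open_space S br) (open_space T br') \<phi>"
  using cderiv_imp_continuous_on[OF assms(1)] assms(2)
  by (auto simp: holo_map_def open_space_def image_subset_iff_funcset intro!: holo_comp assms(1))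

lemma open_preimage:
  assumes "open S" "open V" "\<And>x. x \<in> S \<Longrightarrow> cderiv \<phi> (D x) x"
  shows "open {x \<in> S. \<phi> x \<in> V}"
proof -
  have "open (\<phi> -` V \<inter> S)"
    using cderiv_imp_continuous_on[of S \<phi>, OF assms(3)] assms(2)
    by (auto simp: continuous_on_open_vimage[OF assms(1)])
  moreover have "\<phi> -` V \<inter> S = {x \<in> S. \<phi> x \<in> V}"
    by auto
  ultimately show ?thesis
    by simp
qed

text \<open>Each equation to be shown concerns one point, and that point has a preimage where the
  equation is known. Closure of the function classes of \<open>N\<close> cannot be read off from
  \<open>M\<close> and is assumed. The lemma serves both the space of forms and the
  quotient.\<close>

lemma poisson_structure_image:
  assumes M: "poisson_structure M" and \<phi>: "poisson_map M N \<phi>"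
    and surj: "topspace (topol N) \<subseteq> \<phi> ` topspace (topol M)"
    and closed: "\<And>V f g. openin (topol N) V \<Longrightarrow> f \<in> hol N V \<Longrightarrow> g \<in> hol N V \<Longrightarrow> pbr N f g \<in> hol N V"
      "\<And>V f g a b. openin (topol N) V \<Longrightarrow> f \<in> hol N V \<Longrightarrow> g \<in> hol N V \<Longrightarrow>
        (\<lambda>y. a * f y + b * g y) \<in> hol N V"
      "\<And>V f g. openin (topol N) V \<Longrightarrow> f \<in> hol N V \<Longrightarrow> g \<in> hol N V \<Longrightarrow> (\<lambda>y. f y * g y) \<in> hol N V"
  shows "poisson_structure N"
  unfolding poisson_structure_def
proof (intro allI impI conjI ballI)
  fix V assume V: "openin (topol N) V"
  define W where "W = {x \<in> topspace (topol M). \<phi> x \<in> V}"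
  have "continuous_map (topol M) (topol N) \<phi>"
    using \<phi> by (simp add: poisson_map_def holo_map_def)
  then have W: "openin (topol M) W"
    using V by (simp add: W_def openin_continuous_map_preimage)
  have VW: "\<exists>z\<in>W. x = \<phi> z" if "x \<in> V" for x
  proof -
    have "x \<in> \<phi> ` topspace (topol M)"
      using openin_subset[OF V] surj that by blast
    then show ?thesis
      using that unfolding W_def by blast
  qed
  have pull: "f \<circ> \<phi> \<in> hol M W" if "f \<in> hol N V" for f
    using \<phi> V that by (simp add: W_def poisson_map_def holo_map_def)
  have br: "pbr N f g (\<phi> z) = pbr M (f \<circ> \<phi>) (g \<circ> \<phi>) z"
    if "f \<in> hol N V" "g \<in> hol N V" "z \<in> W" for f g z
    using \<phi> V that by (simp add: W_def poisson_map_def)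
  note MW = M[unfolded poisson_structure_def, THEN spec, THEN mp, OF W]
  have cong: "pbr M f g z = pbr M f' g z"
    if "f \<in> hol M W" "f' \<in> hol M W" "g \<in> hol M W" "\<forall>z\<in>W. f z = f' z" "z \<in> W" for f f' g z
    by (rule conjunct1[OF MW, THEN bspec, OF that(1), THEN bspec, OF that(2), THEN bspec, OF that(3),
          THEN mp, OF that(4), THEN bspec, OF that(5)])
  have Mcl: "pbr M f g \<in> hol M W" and anti: "z \<in> W \<Longrightarrow> pbr M g f z = - pbr M f g z"
    if "f \<in> hol M W" "g \<in> hol M W" for f g z
    using conjunct1[OF conjunct2[OF MW], THEN bspec, OF that(1), THEN bspec, OF that(2)] by simp_all
  \<comment> \<open>The pullback of the inner bracket agrees with the bracket of the pullbacks only
    on \<open>W\<close>, so locality is needed. It is stated for the first argument; antisymmetry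
    moves the inner bracket there and back.\<close>
  have nest: "pbr N f (pbr N g h) (\<phi> z) = pbr M (f \<circ> \<phi>) (pbr M (g \<circ> \<phi>) (h \<circ> \<phi>)) z"
    if f: "f \<in> hol N V" and g: "g \<in> hol N V" and h: "h \<in> hol N V" and z: "z \<in> W" for f g h z
  proof -
    note p = pull[OF f] pull[OF g] pull[OF h]
    have gh: "pbr N g h \<in> hol N V"
      by (rule closed(1)[OF V g h])
    have "pbr N f (pbr N g h) (\<phi> z) = pbr M (f \<circ> \<phi>) (pbr N g h \<circ> \<phi>) z"
      by (rule br[OF f gh z])
    also have "\<dots> = - pbr M (pbr N g h \<circ> \<phi>) (f \<circ> \<phi>) z"
      by (rule anti[OF pull[OF gh] p(1) z])
    also have "\<dots> = - pbr M (pbr M (g \<circ> \<phi>) (h \<circ> \<phi>)) (f \<circ> \<phi>) z"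
      using cong[OF pull[OF gh] Mcl[OF p(2,3)] p(1) _ z] br[OF g h] by simp
    also have "\<dots> = pbr M (f \<circ> \<phi>) (pbr M (g \<circ> \<phi>) (h \<circ> \<phi>)) z"
      using anti[OF Mcl[OF p(2,3)] p(1) z] by simp
    finally show ?thesis .
  qed
  show "pbr N f g x = pbr N f' g x"
    if f: "f \<in> hol N V" "f' \<in> hol N V" "g \<in> hol N V" "\<forall>x\<in>V. f x = f' x" "x \<in> V" for f f' g x
  proof -
    obtain z where z: "z \<in> W" "x = \<phi> z"
      using VW f(5) by blast
    have "\<forall>z\<in>W. (f \<circ> \<phi>) z = (f' \<circ> \<phi>) z"
      using f(4) by (simp add: W_def)
    then show ?thesis
      using cong[OF pull pull pull _ z(1), OF f(1-3)] by (simp add: z br[OF _ _ z(1)] f)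
  qed
  show "pbr N f g \<in> hol N V" if "f \<in> hol N V" "g \<in> hol N V" for f g
    by (rule closed(1)[OF V that])
  show "pbr N g f x = - pbr N f g x" if "f \<in> hol N V" "g \<in> hol N V" "x \<in> V" for f g x
    using VW[OF that(3)] anti[OF pull pull, OF that(1,2)] by (auto simp: br that)
  fix f g h x assume f: "f \<in> hol N V" and g: "g \<in> hol N V" and h: "h \<in> hol N V" and "x \<in> V"
  then obtain z where z: "z \<in> W" "x = \<phi> z"
    using VW by blast
  note p = pull[OF f] pull[OF g] pull[OF h]
  have M3: "(\<forall>a b. pbr M (\<lambda>y. a * f y + b * g y) h x = a * pbr M f h x + b * pbr M g h x) \<and>
          pbr M (\<lambda>y. f y * g y) h x = f x * pbr M g h x + pbr M f h x * g x \<and>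
          pbr M f (pbr M g h) x + pbr M g (pbr M h f) x + pbr M h (pbr M f g) x = 0"
    if "f \<in> hol M W" "g \<in> hol M W" "h \<in> hol M W" "x \<in> W" for f g h x
    by (rule conjunct2[OF conjunct2[OF MW], THEN bspec, OF that(1), THEN bspec, OF that(2),
          THEN bspec, OF that(3), THEN bspec, OF that(4)])
  show "pbr N (\<lambda>y. a * f y + b * g y) h x = a * pbr N f h x + b * pbr N g h x" for a b
    using M3[OF p z(1)] by (simp add: z(2) br[OF _ _ z(1)] closed(2)[OF V] f g h comp_def)
  show "pbr N (\<lambda>y. f y * g y) h x = f x * pbr N g h x + pbr N f h x * g x"
    using M3[OF p z(1)] by (simp add: z(2) br[OF _ _ z(1)] closed(3)[OF V] f g h comp_def)
  show "pbr N f (pbr N g h) x + pbr N g (pbr N h f) x + pbr N h (pbr N f g) x = 0"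
    using M3[OF p z(1)] by (simp add: z(2) nest[OF _ _ _ z(1)] f g h)
qed

section \<open>Form map, multiplication and inverse transposition acting on brackets\<close>

definition form_of :: "'n::finite cmat \<times> 'n cmat \<Rightarrow> 'n cmat"
  where "form_of x = fst x ** transpose (snd x)"

lemma cderiv_form_of:
  "cderiv form_of (\<lambda>v. fst x ** transpose (snd v) + fst v ** transpose (snd x)) x"
  unfolding form_of_def[abs_def]
  by (rule cderiv_matrix_mult[OF cderiv_fst[OF cderiv_id] cderiv_transpose[OF cderiv_snd[OF cderiv_id]]])

lemma transpose_zero [simp]: "transpose (0::'n::finite cmat) = 0"
  by (simp add: vec_eq_iff transpose_def)

lemma matrix_mult_zero [simp]: "(A::'n::finite cmat) ** 0 = 0" "0 ** (A::'n::finite cmat) = 0"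
  by (simp_all add: vec_eq_iff matrix_matrix_mult_def)

lemma grad_form_of:
  assumes "clinear D"
  shows "grad_fst (\<lambda>v. D (B ** transpose (snd v) + fst v ** transpose C)) = grad D ** C"
    and "grad_snd (\<lambda>v. D (B ** transpose (snd v) + fst v ** transpose C)) = transpose (grad D) ** B"
proof -
  show "grad_fst (\<lambda>v. D (B ** transpose (snd v) + fst v ** transpose C)) = grad D ** C"
    using grad_mult_right[OF assms, of "transpose C"] by (simp add: grad_fst_def)
  have "grad (\<lambda>V. D (B ** transpose V)) = transpose (grad (\<lambda>V. D (B ** V)))"
    by (rule grad_transpose)
  then show "grad_snd (\<lambda>v. D (B ** transpose (snd v) + fst v ** transpose C)) = transpose (grad D) ** B"
    by (simp add: grad_snd_def grad_mult_left[OF assms] matrix_transpose_mul)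
qed

lemma gl2_bracket_form_of:
  assumes "f \<in> holo V" "g \<in> holo V" "form_of x \<in> V"
  shows "gl2_bracket (f \<circ> form_of) (g \<circ> form_of) x = form_bracket f g (form_of x)"
proof -
  obtain B C where x: "x = (B, C)"
    by (cases x)
  note D = dd_comp[OF assms(1,3) cderiv_form_of] dd_comp[OF assms(2,3) cderiv_form_of]
  note cl = cderiv_clinear[OF holoD[OF assms(1,3)]] cderiv_clinear[OF holoD[OF assms(2,3)]]
  show ?thesis
    using D cl unfolding x
    by (simp add: gl2_bracket_eq_form grad_form_of gl2_form_form form_bracket_eq)
      (simp add: form_of_def)
qed

definition gl2_mult :: "'n::finite cmat \<times> 'n cmat \<Rightarrow> 'n cmat \<times> 'n cmat \<Rightarrow> 'n cmat \<times> 'n cmat"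
  where "gl2_mult x y = (fst x ** fst y, snd x ** snd y)"

lemma cderiv_const_mult:
  fixes M :: "'n::finite cmat"
  assumes "cderiv f D x"
  shows "cderiv (\<lambda>y. M ** f y) (\<lambda>v. M ** D v) x" "cderiv (\<lambda>y. f y ** M) (\<lambda>v. D v ** M) x"
  using cderiv_matrix_mult[OF cderiv_const[of M] assms] cderiv_matrix_mult[OF assms cderiv_const[of M]]
  by simp_all

lemma gl2_bracket_mult:
  assumes f: "f \<in> holo V" and g: "g \<in> holo V" and xy: "gl2_mult x y \<in> V"
  shows "gl2_bracket (\<lambda>x'. f (gl2_mult x' y)) (\<lambda>x'. g (gl2_mult x' y)) x
    + gl2_bracket (\<lambda>y'. f (gl2_mult x y')) (\<lambda>y'. g (gl2_mult x y')) y
    = gl2_bracket f g (gl2_mult x y)"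
proof -
  obtain B C B' C' where x: "x = (B, C)" and y: "y = (B', C')"
    by (cases x; cases y)
  have 1: "cderiv (\<lambda>x'. gl2_mult x' y) (\<lambda>v. (fst v ** B', snd v ** C')) x"
    unfolding gl2_mult_def y fst_conv snd_conv
    by (intro cderiv_Pair cderiv_const_mult cderiv_fst cderiv_snd cderiv_id)
  have 2: "cderiv (\<lambda>y'. gl2_mult x y') (\<lambda>v. (B ** fst v, C ** snd v)) y"
    unfolding gl2_mult_def x fst_conv snd_conv
    by (intro cderiv_Pair cderiv_const_mult cderiv_fst cderiv_snd cderiv_id)
  \<comment> \<open>A translation differentiates to multiplication by a fixed matrix, whose adjoint
    for the entrywise pairing is multiplication by the transpose. This is the shape that
    \<open>gl2_form_mult\<close> expects.\<close>
  have grads: "grad_fst (\<lambda>v. D (fst v ** B', snd v ** C')) = grad_fst D ** transpose B'"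
    "grad_snd (\<lambda>v. D (fst v ** B', snd v ** C')) = grad_snd D ** transpose C'"
    "grad_fst (\<lambda>v. D (B ** fst v, C ** snd v)) = transpose B ** grad_fst D"
    "grad_snd (\<lambda>v. D (B ** fst v, C ** snd v)) = transpose C ** grad_snd D"
    if "clinear D" for D
    using clinear_Pair[OF that]
    by (simp_all add: grad_fst_def grad_snd_def grad_mult_right[of "\<lambda>V. D (V, 0)"]
        grad_mult_right[of "\<lambda>V. D (0, V)"] grad_mult_left[of "\<lambda>V. D (V, 0)"] grad_mult_left[of "\<lambda>V. D (0, V)"])
  note cl = cderiv_clinear[OF holoD[OF f xy]] cderiv_clinear[OF holoD[OF g xy]]
  have d: "dd (\<lambda>x'. f (gl2_mult x' y)) x = (\<lambda>v. dd f (gl2_mult x y) (fst v ** B', snd v ** C'))"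
    "dd (\<lambda>x'. g (gl2_mult x' y)) x = (\<lambda>v. dd g (gl2_mult x y) (fst v ** B', snd v ** C'))"
    "dd (\<lambda>y'. f (gl2_mult x y')) y = (\<lambda>v. dd f (gl2_mult x y) (B ** fst v, C ** snd v))"
    "dd (\<lambda>y'. g (gl2_mult x y')) y = (\<lambda>v. dd g (gl2_mult x y) (B ** fst v, C ** snd v))"
    by (intro cderiv_frechet cderiv_compose[OF 1] cderiv_compose[OF 2] holoD[OF f xy] holoD[OF g xy])+
  have xy_eq: "gl2_mult x y = (B ** B', C ** C')"
    by (simp add: gl2_mult_def x y)
  show ?thesis
    using d cl unfolding x y
    by (simp only: gl2_bracket_eq_form grads gl2_form_mult xy_eq[unfolded x y])
qed

lemma invertible_transpose: "invertible (transpose A) = invertible (A::'n::finite cmat)"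
  by (simp add: invertible_det_nz det_transpose)

lemma invertible_matrix_inv: "invertible (A::'n::finite cmat) \<Longrightarrow> invertible (matrix_inv A)"
  using matrix_inv_mult by (auto simp: invertible_def)

lemma matrix_inv_matrix_inv: "invertible (A::'n::finite cmat) \<Longrightarrow> matrix_inv (matrix_inv A) = A"
  by (intro matrix_inv_unique matrix_inv_mult)

lemma matrix_inv_transpose:
  assumes "invertible (A::'n::finite cmat)"
  shows "matrix_inv (transpose A) = transpose (matrix_inv A)"
  by (intro matrix_inv_unique)
    (simp_all add: matrix_inv_mult[OF assms] transpose_mat flip: matrix_transpose_mul)

lemma invertible_mult: "invertible (A::'n::finite cmat) \<Longrightarrow> invertible (B::'n cmat) \<Longrightarrow> invertible (A ** B)"
  by (simp add: invertible_det_nz det_mul)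

lemma matrix_inv_matrix_mult:
  fixes A B :: "'n::finite cmat"
  assumes A: "invertible A" and B: "invertible B"
  shows "matrix_inv (A ** B) = matrix_inv B ** matrix_inv A"
proof (intro matrix_inv_unique)
  have "A ** B ** (matrix_inv B ** matrix_inv A) = A ** (B ** matrix_inv B) ** matrix_inv A"
    by (simp add: matrix_mul_assoc)
  then show "A ** B ** (matrix_inv B ** matrix_inv A) = mat 1"
    by (simp add: matrix_inv_mult A B)
  have "matrix_inv B ** matrix_inv A ** (A ** B) = matrix_inv B ** (matrix_inv A ** A) ** B"
    by (simp add: matrix_mul_assoc)
  then show "matrix_inv B ** matrix_inv A ** (A ** B) = mat 1"
    by (simp add: matrix_inv_mult A B)
qed

abbreviation (input) GLset :: "'n::finite cmat set"
  where "GLset \<equiv> {A. invertible A}"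

lemma cderiv_Theta:
  assumes "x \<in> GLset \<times> GLset"
  shows "cderiv Theta (\<lambda>v. (transpose (- (matrix_inv (snd x) ** snd v ** matrix_inv (snd x))),
    transpose (- (matrix_inv (fst x) ** fst v ** matrix_inv (fst x))))) x"
  unfolding Theta_def split_beta
  using assms
  by (intro cderiv_Pair cderiv_transpose
      cderiv_compose[OF cderiv_fst[OF cderiv_id] cderiv_matrix_inv]
      cderiv_compose[OF cderiv_snd[OF cderiv_id] cderiv_matrix_inv]) auto

lemma grad_inv_transpose:
  assumes "clinear D"
  shows "grad (\<lambda>V. D (transpose (- (X ** V ** X))))
    = - (transpose X ** transpose (grad D) ** transpose X)"
proof -
  have t: "clinear (\<lambda>V. D (transpose V))"
    by (rule clinear_transpose[OF assms])
  have "D (- V) = - D V" for V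
  proof -
    have "D (V + - V) = D V + D (- V)" "D (0 + 0) = D 0 + D 0"
      using assms unfolding clinear_def by blast+
    then show ?thesis
      by (simp add: add_eq_0_iff)
  qed
  then have "grad (\<lambda>V. D (transpose (- (X ** V ** X)))) = - grad (\<lambda>V. D (transpose (X ** V ** X)))"
    by (simp add: transpose_uminus grad_uminus)
  also have "grad (\<lambda>V. D (transpose (X ** V ** X))) = transpose X ** grad (\<lambda>V. D (transpose (V ** X)))"
    by (rule grad_mult_left[OF clinear_mult_right[OF t]])
  also have "grad (\<lambda>V. D (transpose (V ** X))) = grad (\<lambda>V. D (transpose V)) ** transpose X"
    by (rule grad_mult_right[OF t])
  also have "grad (\<lambda>V. D (transpose V)) = transpose (grad D)"
    by (rule grad_transpose)
  finally show ?thesis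
    by (simp add: matrix_mul_assoc)
qed

lemma gl2_bracket_Theta:
  assumes f: "f \<in> holo V" and g: "g \<in> holo V" and x: "x \<in> GLset \<times> GLset" and V: "Theta x \<in> V"
  shows "gl2_bracket (f \<circ> Theta) (g \<circ> Theta) x = - gl2_bracket f g (Theta x)"
proof -
  obtain B C where x': "x = (B, C)" and B: "invertible B" and C: "invertible C"
    using x by auto
  let ?Z = "transpose (matrix_inv B)" and ?W = "transpose (matrix_inv C)"
  have T: "Theta x = (?W, ?Z)"
    by (simp add: Theta_def x')
  have grads: "grad_fst (\<lambda>v. D (transpose (- (matrix_inv C ** snd v ** matrix_inv C)),
      transpose (- (matrix_inv B ** fst v ** matrix_inv B)))) = - (?Z ** transpose (grad_snd D) ** ?Z)"
    "grad_snd (\<lambda>v. D (transpose (- (matrix_inv C ** snd v ** matrix_inv C)),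
      transpose (- (matrix_inv B ** fst v ** matrix_inv B)))) = - (?W ** transpose (grad_fst D) ** ?W)"
    if "clinear D" for D
    using grad_inv_transpose[OF clinear_Pair(2)[OF that], of "matrix_inv B"]
      grad_inv_transpose[OF clinear_Pair(1)[OF that], of "matrix_inv C"]
    by (simp_all add: grad_fst_def grad_snd_def)
  note cl = cderiv_clinear[OF holoD[OF f V]] cderiv_clinear[OF holoD[OF g V]]
  have inv: "?Z ** transpose B = mat 1" "transpose B ** ?Z = mat 1"
    "?W ** transpose C = mat 1" "transpose C ** ?W = mat 1"
    by (simp_all add: matrix_inv_mult B C transpose_mat flip: matrix_transpose_mul)
  have d: "dd (h \<circ> Theta) (B, C) = (\<lambda>v. dd h (?W, ?Z) (transpose (- (matrix_inv C ** snd v ** matrix_inv C)),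
      transpose (- (matrix_inv B ** fst v ** matrix_inv B))))" if "h \<in> holo V" for h
    using dd_comp[OF that V cderiv_Theta[OF x]] by (simp add: T) (simp add: x')
  show ?thesis
    using cl unfolding T unfolding x'
    by (simp only: gl2_bracket_eq_form d f g grads gl2_form_Theta[OF inv])
qed

section \<open>The Poisson symmetric Lie group and its quotient\<close>

lemma GL_simps [simp]:
  "carrier GL = GLset" "A \<otimes>\<^bsub>GL\<^esub> B = A ** B" "\<one>\<^bsub>GL\<^esub> = mat 1"
  by (simp_all add: GL_def)

lemma invertible_mat_1: "invertible (mat 1 :: 'n::finite cmat)"
  by (simp add: invertible_det_nz)

lemma group_GL: "group (GL :: 'n::finite cmat monoid)"
proof (rule groupI)
  show "\<exists>B\<in>carrier GL. B \<otimes>\<^bsub>GL\<^esub> A = \<one>\<^bsub>GL\<^esub>" if "A \<in> carrier GL" for A :: "'n cmat"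
    using that by (intro bexI[of _ "matrix_inv A"]) (simp_all add: matrix_inv_mult invertible_matrix_inv)
qed (simp_all add: invertible_mult invertible_mat_1 matrix_mul_assoc)

lemma inv_GL:
  assumes "invertible A"
  shows "inv\<^bsub>GL\<^esub> A = matrix_inv A"
  using assms by (intro group.inv_equality[OF group_GL])
    (simp_all add: matrix_inv_mult invertible_matrix_inv)

lemma carrier_GL2 [simp]: "carrier GL2 = GLset \<times> GLset"
  by (simp add: GL2_def)

lemma mult_GL2 [simp]: "x \<otimes>\<^bsub>GL2\<^esub> y = gl2_mult x y"
  by (simp add: GL2_def mult_DirProd' gl2_mult_def)

lemma group_GL2: "group (GL2 :: ('n::finite cmat \<times> 'n cmat) monoid)"
  unfolding GL2_def by (intro DirProd_group group_GL)

lemma inv_GL2: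
  assumes "x \<in> GLset \<times> GLset"
  shows "inv\<^bsub>GL2\<^esub> x = (matrix_inv (fst x), matrix_inv (snd x))"
  using assms inv_DirProd[OF group_GL group_GL, of "fst x" "snd x"] inv_GL[of "fst x"] inv_GL[of "snd x"]
  by (auto simp: GL2_def)

lemma open_GL2: "open (GLset \<times> GLset :: ('n::finite cmat \<times> 'n cmat) set)"
  by (intro open_Times open_invertible)

lemma gl2_mult_closed: "x \<in> GLset \<times> GLset \<Longrightarrow> y \<in> GLset \<times> GLset \<Longrightarrow> gl2_mult x y \<in> GLset \<times> GLset"
  by (auto simp: gl2_mult_def invertible_mult)

lemma Theta_closed: "x \<in> GLset \<times> GLset \<Longrightarrow> Theta x \<in> GLset \<times> GLset"
  by (auto simp: Theta_def invertible_transpose invertible_matrix_inv)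

lemma Theta_Theta: "x \<in> GLset \<times> GLset \<Longrightarrow> Theta (Theta x) = x"
  by (auto simp: Theta_def matrix_inv_transpose invertible_matrix_inv matrix_inv_matrix_inv)

lemma Theta_mult:
  "x \<in> GLset \<times> GLset \<Longrightarrow> y \<in> GLset \<times> GLset \<Longrightarrow> Theta (gl2_mult x y) = gl2_mult (Theta x) (Theta y)"
  by (auto simp: Theta_def gl2_mult_def matrix_inv_matrix_mult matrix_transpose_mul)

lemma cderiv_gl2_mult:
  "cderiv (\<lambda>p. gl2_mult (fst p) (snd p))
    (\<lambda>v. (fst (fst p) ** fst (snd v) + fst (fst v) ** fst (snd p),
      snd (fst p) ** snd (snd v) + snd (fst v) ** snd (snd p))) p"
  unfolding gl2_mult_def
  by (intro cderiv_Pair cderiv_matrix_mult cderiv_fst cderiv_snd cderiv_id)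

theorem poisson_lie_group_GL2:
  "poisson_lie_group (GL2 :: ('n::{finite,linorder} cmat \<times> 'n cmat) monoid) gl2_bracket"
  unfolding poisson_lie_group_def
proof (intro conjI)
  let ?G = "GLset \<times> GLset :: ('n cmat \<times> 'n cmat) set"
  show "group (GL2 :: ('n cmat \<times> 'n cmat) monoid)"
    by (rule group_GL2)
  show "open (carrier (GL2 :: ('n cmat \<times> 'n cmat) monoid))"
    by (simp add: open_GL2)
  show "poisson_structure (open_space (carrier (GL2 :: ('n cmat \<times> 'n cmat) monoid)) gl2_bracket)"
    by (simp add: poisson_structure_gl2 open_GL2)
  have "holo_map (open_space (?G \<times> ?G) (prod_bracket gl2_bracket gl2_bracket))
      (open_space ?G gl2_bracket) (\<lambda>p. gl2_mult (fst p) (snd p))"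
  proof (rule holo_map_open_space[OF cderiv_gl2_mult])
    show "(\<lambda>p. gl2_mult (fst p) (snd p)) ` (?G \<times> ?G) \<subseteq> ?G"
      using gl2_mult_closed by fastforce
  qed
  \<comment> \<open>\<open>prod_bracket\<close> adds the brackets in each variable with the other
    one frozen, which is the left side of \<open>gl2_bracket_mult\<close>.\<close>
  then show "poisson_map
      (open_space (carrier GL2 \<times> carrier GL2) (prod_bracket gl2_bracket gl2_bracket))
      (open_space (carrier (GL2 :: ('n cmat \<times> 'n cmat) monoid)) gl2_bracket)
      (\<lambda>(x, y). x \<otimes>\<^bsub>GL2\<^esub> y)"
    by (auto simp: poisson_map_def case_prod_unfold open_space_def prod_bracket_def gl2_bracket_mult)
  have "cderiv (\<lambda>x. (matrix_inv (fst x), matrix_inv (snd x)))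
      (\<lambda>v. (- (matrix_inv (fst x) ** fst v ** matrix_inv (fst x)),
        - (matrix_inv (snd x) ** snd v ** matrix_inv (snd x)))) x" if "x \<in> ?G" for x
    using that
    by (intro cderiv_Pair cderiv_compose[OF cderiv_fst[OF cderiv_id] cderiv_matrix_inv]
        cderiv_compose[OF cderiv_snd[OF cderiv_id] cderiv_matrix_inv]) auto
  then have inv: "cderiv (\<lambda>x. inv\<^bsub>GL2\<^esub> x)
      (\<lambda>v. (- (matrix_inv (fst x) ** fst v ** matrix_inv (fst x)),
        - (matrix_inv (snd x) ** snd v ** matrix_inv (snd x)))) x" if "x \<in> ?G" for x
    by (rule cderiv_transform_open[OF _ open_GL2]) (use that in \<open>simp_all add: inv_GL2\<close>)
  have "(\<lambda>x. inv\<^bsub>GL2\<^esub> x) ` ?G \<subseteq> ?G"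
    by (intro image_subsetI group.inv_closed[OF group_GL2, unfolded carrier_GL2])
  from holo_map_open_space[OF inv this]
  show "holo_map (open_space (carrier GL2) gl2_bracket)
      (open_space (carrier (GL2 :: ('n cmat \<times> 'n cmat) monoid)) gl2_bracket) (\<lambda>x. inv\<^bsub>GL2\<^esub> x)"
    by simp
qed

theorem poisson_symmetric_lie_group_GL2:
  "poisson_symmetric_lie_group (GL2 :: ('n::{finite,linorder} cmat \<times> 'n cmat) monoid) gl2_bracket Theta"
  unfolding poisson_symmetric_lie_group_def
proof (intro conjI)
  let ?G = "GLset \<times> GLset :: ('n cmat \<times> 'n cmat) set"
  show "poisson_lie_group (GL2 :: ('n cmat \<times> 'n cmat) monoid) gl2_bracket"
    by (rule poisson_lie_group_GL2)
  have "Theta \<in> hom GL2 (GL2 :: ('n cmat \<times> 'n cmat) monoid)"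
    using Theta_closed Theta_mult by (intro homI) (simp_all del: mem_Sigma_iff)
  moreover have "bij_betw Theta ?G ?G"
    by (rule bij_betw_byWitness[where f' = Theta]) (use Theta_closed Theta_Theta in blast)+
  ultimately show "Theta \<in> iso GL2 (GL2 :: ('n cmat \<times> 'n cmat) monoid)"
    by (simp add: iso_def)
  show "\<forall>g\<in>carrier (GL2 :: ('n cmat \<times> 'n cmat) monoid). Theta (Theta g) = g"
    unfolding carrier_GL2 by (blast intro: Theta_Theta)
  show "anti_poisson_map (open_space (carrier GL2) gl2_bracket)
      (open_space (carrier (GL2 :: ('n cmat \<times> 'n cmat) monoid)) gl2_bracket) Theta"
    unfolding anti_poisson_map_def carrier_GL2
  proof (intro conjI allI impI ballI)
    show "holo_map (open_space ?G gl2_bracket) (open_space ?G gl2_bracket) Theta"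
      using Theta_closed by (intro holo_map_open_space[OF cderiv_Theta]) blast+
    fix V f g and x :: "'n cmat \<times> 'n cmat"
    assume "f \<in> hol (open_space ?G gl2_bracket) V" "g \<in> hol (open_space ?G gl2_bracket) V"
      "x \<in> topspace (topol (open_space ?G gl2_bracket))" "Theta x \<in> V"
    then show "pbr (open_space ?G gl2_bracket) (f \<circ> Theta) (g \<circ> Theta) x
        = - pbr (open_space ?G gl2_bracket) f g (Theta x)"
      using gl2_bracket_Theta[of f V g x] by (simp add: open_space_def del: mem_Sigma_iff)
  qed
qed

section \<open>Brackets of the coordinate functions\<close>

lemma tensor_bracket_nth:
  "tensor_bracket br X Y a $ (i, k) $ (j, l) = br (\<lambda>x. X x $ i $ j) (\<lambda>x. Y x $ k $ l) a"
proof -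
  let ?t = "\<lambda>i' j' k' l'. br (\<lambda>x. X x $ i' $ j') (\<lambda>x. Y x $ k' $ l') a
    * (mat_unit i' j' $ i $ j * mat_unit k' l' $ k $ l)"
  have "tensor_bracket br X Y a $ (i, k) $ (j, l)
      = (\<Sum>i'\<in>UNIV. \<Sum>j'\<in>UNIV. \<Sum>k'\<in>UNIV. \<Sum>l'\<in>UNIV. ?t i' j' k' l')"
    by (simp add: tensor_bracket_def tensor_def scaleC_complex_def)
  also have "\<dots> = (\<Sum>j'\<in>UNIV. \<Sum>k'\<in>UNIV. \<Sum>l'\<in>UNIV. ?t i j' k' l')"
    by (rule sum_single) (simp add: mat_unit_nth)
  also have "\<dots> = (\<Sum>k'\<in>UNIV. \<Sum>l'\<in>UNIV. ?t i j k' l')"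
    by (rule sum_single) (simp add: mat_unit_nth)
  also have "\<dots> = (\<Sum>l'\<in>UNIV. ?t i j k l')"
    by (rule sum_single) (simp add: mat_unit_nth)
  also have "\<dots> = ?t i j k l"
    by (rule sum_single) (simp add: mat_unit_nth)
  finally show ?thesis
    by (simp add: mat_unit_nth)
qed

lemma gl2_bracket_part:
  "gl2_bracket (\<lambda>x. gl2_part a x $ i $ j) (\<lambda>x. gl2_part b x $ k $ l) x = gl2_coeff (a, i, j) (b, k, l) x"
proof -
  have "gl2_bracket (\<lambda>x. gl2_part a x $ i $ j) (\<lambda>x. gl2_part b x $ k $ l) x
    = (\<Sum>p\<in>UNIV. gl2_part a (gl2_basis p) $ i $ j * (\<Sum>q\<in>UNIV. gl2_coeff p q x * gl2_part b (gl2_basis q) $ k $ l))"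
    by (simp add: gl2_bracket_coord coord_bracket_def cderiv_frechet[OF cderiv_gl2_part]
        sum_distrib_left mult_ac)
  \<comment> \<open>\<open>sum_gl2_coeff_part\<close> contracts the second index of
    \<open>gl2_coeff\<close>; antisymmetry brings the remaining index into that position.\<close>
  also have "\<dots> = (\<Sum>p\<in>UNIV. - (gl2_coeff (b, k, l) p x * gl2_part a (gl2_basis p) $ i $ j))"
    unfolding sum_gl2_coeff_part by (intro sum.cong refl, subst gl2_coeff_swap) simp
  also have "\<dots> = - gl2_coeff (b, k, l) (a, i, j) x"
    by (simp only: sum_negf sum_gl2_coeff_part)
  finally show ?thesis
    by (simp add: gl2_coeff_swap[of "(b, k, l)" "(a, i, j)"])
qed

lemma tensor_bracket_gl2:
  "tensor_bracket gl2_bracket fst fst (B, C) = rr B B"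
  "tensor_bracket gl2_bracket snd snd (B, C) = rr C C"
  "tensor_bracket gl2_bracket snd fst (B, C) = rr C B"
proof -
  have "tensor_bracket gl2_bracket (gl2_part a) (gl2_part b) (B, C) $ (i, k) $ (j, l)
    = gl2_coeff (a, i, j) (b, k, l) (B, C)" for a b i j k l
    by (simp add: tensor_bracket_nth gl2_bracket_part)
  moreover have "gl2_part False = fst" "gl2_part True = snd"
    by (simp_all add: fun_eq_iff gl2_part_def)
  ultimately have *: "tensor_bracket gl2_bracket fst fst (B, C) $ (i, k) $ (j, l)
      = gl2_coeff (False, i, j) (False, k, l) (B, C)"
    "tensor_bracket gl2_bracket snd snd (B, C) $ (i, k) $ (j, l)
      = gl2_coeff (True, i, j) (True, k, l) (B, C)"
    "tensor_bracket gl2_bracket snd fst (B, C) $ (i, k) $ (j, l)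
      = gl2_coeff (True, i, j) (False, k, l) (B, C)" for i j k l
    by metis+
  show "tensor_bracket gl2_bracket fst fst (B, C) = rr B B"
    "tensor_bracket gl2_bracket snd snd (B, C) = rr C C"
    "tensor_bracket gl2_bracket snd fst (B, C) = rr C B"
    using ssgn_swap
    by (auto simp: vec_eq_iff * gl2_coeff_apply gl2_part_def eps_def rr_nth algebra_simps)
qed

lemma tensor_bracket_form: "tensor_bracket form_bracket id id A = form_tensor A"
proof -
  have "form_bracket (\<lambda>x. x $ i $ j) (\<lambda>x. x $ k $ l) A = form_tensor A $ (i, k) $ (j, l)" for i j k l
  proof -
    let ?t = "\<lambda>i' j' k' l'. form_tensor A $ (i', k') $ (j', l') * (mat_unit i' j' $ i $ j) * (mat_unit k' l' $ k $ l)"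
    have "dd (\<lambda>x. x $ a $ b) A = (\<lambda>v. v $ a $ b)" for a b
      by (rule cderiv_frechet, rule cderiv_vec_nth, rule cderiv_vec_nth, rule cderiv_id)
    then have "form_bracket (\<lambda>x. x $ i $ j) (\<lambda>x. x $ k $ l) A
        = (\<Sum>i'\<in>UNIV. \<Sum>j'\<in>UNIV. \<Sum>k'\<in>UNIV. \<Sum>l'\<in>UNIV. ?t i' j' k' l')"
      by (simp add: form_bracket_def)
    also have "\<dots> = (\<Sum>j'\<in>UNIV. \<Sum>k'\<in>UNIV. \<Sum>l'\<in>UNIV. ?t i j' k' l')"
      by (rule sum_single) (simp add: mat_unit_nth)
    also have "\<dots> = (\<Sum>k'\<in>UNIV. \<Sum>l'\<in>UNIV. ?t i j k' l')"
      by (rule sum_single) (simp add: mat_unit_nth)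
    also have "\<dots> = (\<Sum>l'\<in>UNIV. ?t i j k l')"
      by (rule sum_single) (simp add: mat_unit_nth)
    also have "\<dots> = ?t i j k l"
      by (rule sum_single) (simp add: mat_unit_nth)
    finally show ?thesis
      by (simp add: mat_unit_nth)
  qed
  then show ?thesis
    by (simp add: vec_eq_iff tensor_bracket_nth)
qed

section \<open>The bracket on forms as the image of the bracket on pairs\<close>

definition form_section :: "'n::finite cmat \<Rightarrow> 'n cmat \<times> 'n cmat"
  where "form_section A = (A, mat 1)"

lemma form_of_section [simp]: "form_of (form_section A) = A"
  by (simp add: form_of_def form_section_def transpose_mat)

lemma cderiv_section: "cderiv form_section (\<lambda>v. (v, 0)) x"
  unfolding form_section_def[abs_def] by (intro cderiv_Pair cderiv_id cderiv_const)

lemma gl2_bracket_holo: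
  assumes "open U" "f \<in> holo U" "g \<in> holo U"
  shows "gl2_bracket f g \<in> holo U"
  unfolding gl2_bracket_coord by (rule holoI[OF cderiv_coord_bracket[OF assms(1) holo_gl2_coeff assms(2,3)]])

lemma poisson_map_form_of:
  assumes "form_of ` S \<subseteq> T"
  shows "poisson_map (open_space S gl2_bracket) (open_space T form_bracket) form_of"
  using gl2_bracket_form_of holo_map_open_space[OF cderiv_form_of assms]
  by (auto simp: poisson_map_def open_space_def)

text \<open>Pulling back to pairs, taking the bracket there and restricting to the section returns
  the bracket on forms. Its holomorphy thus follows from that on pairs.\<close>

lemma form_bracket_holo:
  assumes "open V" "f \<in> holo V" "g \<in> holo V"
  shows "form_bracket f g \<in> holo V"
proof -
  let ?W = "{x \<in> UNIV. form_of x \<in> V}"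
  have W: "open ?W"
    by (rule open_preimage[OF open_UNIV assms(1) cderiv_form_of])
  have "gl2_bracket (f \<circ> form_of) (g \<circ> form_of) \<in> holo ?W"
    by (intro gl2_bracket_holo[OF W] holo_comp[OF assms(2) _ cderiv_form_of]
        holo_comp[OF assms(3) _ cderiv_form_of]) auto
  then have "gl2_bracket (f \<circ> form_of) (g \<circ> form_of) \<circ> form_section \<in> holo V"
    by (rule holo_comp) (auto intro: cderiv_section)
  then show ?thesis
    by (rule holo_cong[OF _ assms(1)]) (simp add: gl2_bracket_form_of[OF assms(2,3)])
qed

theorem poisson_structure_form:
  "poisson_structure (open_space (UNIV :: 'n::{finite,linorder} cmat set) form_bracket)"
proof (rule poisson_structure_image)
  show "poisson_structure (open_space (UNIV :: ('n cmat \<times> 'n cmat) set) gl2_bracket)"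
    by (rule poisson_structure_gl2) simp
  show "poisson_map (open_space (UNIV :: ('n cmat \<times> 'n cmat) set) gl2_bracket)
      (open_space UNIV form_bracket) form_of"
    by (rule poisson_map_form_of) simp
  have "A \<in> range form_of" for A :: "'n cmat"
    by (rule range_eqI[of _ _ "form_section A"]) simp
  then show "topspace (topol (open_space UNIV form_bracket))
      \<subseteq> form_of ` topspace (topol (open_space (UNIV :: ('n cmat \<times> 'n cmat) set) gl2_bracket))"
    by (auto simp: open_space_def)
qed (auto simp: open_space_def intro!: form_bracket_holo holo_add holo_mult holo_const)

section \<open>Cosets of the fixed group as fibres of the form map\<close>

definition Hfix :: "('n::finite cmat \<times> 'n cmat) set"
  where "Hfix = {g \<in> carrier GL2. Theta g = g}"

definition coset :: "'n::finite cmat \<times> 'n cmat \<Rightarrow> ('n cmat \<times> 'n cmat) set"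
  where "coset g = g <#\<^bsub>GL2\<^esub> Hfix"

lemma Hfix_iff: "(P, Q) \<in> Hfix \<longleftrightarrow> invertible P \<and> Q = transpose (matrix_inv P)"
  by (auto simp: Hfix_def Theta_def matrix_inv_transpose matrix_inv_matrix_inv invertible_matrix_inv
      invertible_transpose)

text \<open>The fixed group consists of the pairs of \<open>P\<close> with its inverse transpose; in
  the form of a translated pair, \<open>P\<close> meets its inverse. Conversely, two invertible
  pairs with the same form determine such a \<open>P\<close>.\<close>

lemma mem_coset_iff:
  assumes "x \<in> GLset \<times> GLset"
  shows "y \<in> coset x \<longleftrightarrow> y \<in> GLset \<times> GLset \<and> form_of y = form_of x"
proof -
  obtain B C B' C' where x: "x = (B, C)" and y: "y = (B', C')"
    by (cases x; cases y)
  have B: "invertible B" and C: "invertible C"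
    using assms x by auto
  have "y \<in> coset x \<longleftrightarrow> (\<exists>P Q. (P, Q) \<in> Hfix \<and> B' = B ** P \<and> C' = C ** Q)"
    by (simp add: coset_def l_coset_def Bex_def gl2_mult_def x y)
  also have "\<dots> \<longleftrightarrow> (\<exists>P. invertible P \<and> B' = B ** P \<and> C' = C ** transpose (matrix_inv P))"
    by (auto simp: Hfix_iff)
  also have "\<dots> \<longleftrightarrow> invertible B' \<and> invertible C' \<and> B' ** transpose C' = B ** transpose C"
  proof (intro iffI conjI)
    assume "\<exists>P. invertible P \<and> B' = B ** P \<and> C' = C ** transpose (matrix_inv P)"
    then obtain P where P: "invertible P" "B' = B ** P" "C' = C ** transpose (matrix_inv P)"
      by blast
    show "invertible B'" "invertible C'"
      using P B C by (auto simp: invertible_mult invertible_transpose invertible_matrix_inv)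
    have "B' ** transpose C' = B ** (P ** matrix_inv P) ** transpose C"
      by (simp add: P matrix_transpose_mul matrix_mul_assoc)
    then show "B' ** transpose C' = B ** transpose C"
      by (simp add: matrix_inv_mult P(1))
  next
    assume *: "invertible B' \<and> invertible C' \<and> B' ** transpose C' = B ** transpose C"
    \<comment> \<open>The first component forces this choice; equality of the forms makes it fit the
      second component.\<close>
    let ?P = "matrix_inv B ** B'"
    have P: "invertible ?P"
      using * B by (simp add: invertible_mult invertible_matrix_inv)
    have B': "B' = B ** ?P"
      by (simp add: matrix_mul_assoc matrix_inv_mult B)
    have "?P ** transpose C' = transpose C"
      using * by (simp add: matrix_inv_mult B flip: matrix_mul_assoc)
        (simp add: matrix_mul_assoc matrix_inv_mult B)
    then have "matrix_inv ?P ** (?P ** transpose C') = matrix_inv ?P ** transpose C"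
      by simp
    moreover have "matrix_inv ?P ** (?P ** transpose C') = transpose C'"
      by (subst matrix_mul_assoc) (simp only: matrix_inv_mult[OF P] matrix_mul_lid)
    ultimately have "transpose C' = matrix_inv ?P ** transpose C"
      by simp
    then have "C' = C ** transpose (matrix_inv ?P)"
      by (metis matrix_transpose_mul transpose_transpose)
    with P B' show "\<exists>P. invertible P \<and> B' = B ** P \<and> C' = C ** transpose (matrix_inv P)"
      by blast
  qed
  finally show ?thesis
    by (simp add: form_of_def y x)
qed

lemma coset_eqI:
  assumes "x \<in> GLset \<times> GLset" "y \<in> GLset \<times> GLset" "form_of x = form_of y"
  shows "coset x = coset y"
  using assms by (auto simp: set_eq_iff mem_coset_iff[OF assms(1)] mem_coset_iff[OF assms(2)])

text \<open>\<open>form_of\<close> is constant on the coset, and the coset contains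
  \<open>x\<close>, so the description in \<open>iota\<close> has exactly one solution.\<close>

lemma iota_coset:
  assumes "x \<in> GLset \<times> GLset"
  shows "iota (coset x) = form_of x"
proof -
  have "(\<exists>(B, C)\<in>coset x. A = B ** transpose C) \<longleftrightarrow> (\<exists>y\<in>coset x. A = form_of y)" for A
    by (simp add: form_of_def split_beta)
  also have "(\<exists>y\<in>coset x. A = form_of y) \<longleftrightarrow> A = form_of x" for A
    using mem_coset_iff[OF assms] assms by metis
  finally show ?thesis
    by (simp add: iota_def)
qed

lemma form_of_invertible: "x \<in> GLset \<times> GLset \<Longrightarrow> invertible (form_of x)"
  by (auto simp: form_of_def invertible_mult invertible_transpose)

lemma section_in: "invertible A \<Longrightarrow> form_section A \<in> GLset \<times> GLset"
  by (simp add: form_section_def invertible_mat_1)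

lemma coset_section:
  assumes "x \<in> GLset \<times> GLset"
  shows "coset (form_section (form_of x)) = coset x"
  by (intro coset_eqI section_in form_of_invertible assms) simp

text \<open>The witness for existence. A function of the coset is read as a function of the form
  through the representative \<open>form_section\<close>, and the bracket on forms is taken at
  \<open>iota Q\<close>; no representative of \<open>Q\<close> is chosen.\<close>

definition quotient_bracket ::
  "(('n::{finite,linorder} cmat \<times> 'n cmat) set \<Rightarrow> complex)
    \<Rightarrow> (('n cmat \<times> 'n cmat) set \<Rightarrow> complex) \<Rightarrow> ('n cmat \<times> 'n cmat) set \<Rightarrow> complex"
  where "quotient_bracket f g Q
    = form_bracket (f \<circ> coset \<circ> form_section) (g \<circ> coset \<circ> form_section) (iota Q)"

abbreviation (input) GL2_space :: "('n::{finite,linorder} cmat \<times> 'n cmat) poisson_space"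
  where "GL2_space \<equiv> open_space (GLset \<times> GLset) gl2_bracket"

abbreviation (input) preim ::
  "('n::finite cmat \<times> 'n cmat) set set \<Rightarrow> ('n cmat \<times> 'n cmat) set"
  where "preim V \<equiv> {x \<in> GLset \<times> GLset. coset x \<in> V}"

lemma openin_quotient_iff:
  "openin (topol (quotient_space GL2_space coset br)) V
    \<longleftrightarrow> V \<subseteq> coset ` (GLset \<times> GLset) \<and> open (preim V)"
  unfolding quotient_space_def open_space_def poisson_space.simps openin_quotient_top topspace_euclidean_subtopology
  by (auto simp: openin_open_eq[OF open_GL2])

lemma hol_quotient_iff: "f \<in> hol (quotient_space GL2_space coset br) V \<longleftrightarrow> f \<circ> coset \<in> holo (preim V)"
  by (simp add: quotient_space_def open_space_def)

lemma topspace_quotient_space: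
  "topspace (topol (quotient_space GL2_space coset br)) = coset ` (GLset \<times> GLset)"
  by (simp add: quotient_space_def open_space_def topspace_quotient_top)

lemma pbr_quotient_space: "pbr (quotient_space M q br) = br"
  by (simp add: quotient_space_def)

lemma section_preimage:
  assumes "open (preim V)"
  shows "open {A \<in> GLset. coset (form_section A) \<in> V}"
proof -
  have "open {A \<in> GLset. form_section A \<in> preim V}"
    by (rule open_preimage[OF open_invertible assms cderiv_section])
  also have "{A \<in> GLset. form_section A \<in> preim V} = {A \<in> GLset. coset (form_section A) \<in> V}"
    using section_in by blast
  finally show ?thesis .
qed

lemma holo_coset_section:
  assumes "f \<circ> coset \<in> holo (preim V)"
  shows "f \<circ> coset \<circ> form_section \<in> holo {A \<in> GLset. coset (form_section A) \<in> V}"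
  by (rule holo_comp[OF assms _ cderiv_section]) (use section_in in blast)

text \<open>Pullbacks such as \<open>f \<circ> iota \<circ> coset\<close> and
  \<open>f \<circ> form_of\<close> agree only on invertible pairs. Their brackets agree there,
  because derivatives depend only on values near the point.\<close>

lemma gl2_bracket_local:
  assumes "open U" "x \<in> U" "f \<in> holo U" "g \<in> holo U"
    and "\<And>y. y \<in> U \<Longrightarrow> f y = f' y" "\<And>y. y \<in> U \<Longrightarrow> g y = g' y"
  shows "gl2_bracket f' g' x = gl2_bracket f g x"
  using dd_cong[OF assms(3,1,2,5)] dd_cong[OF assms(4,1,2,6)]
  by (simp add: gl2_bracket_coord coord_bracket_def)

lemma form_bracket_local:
  assumes "open U" "A \<in> U" "f \<in> holo U" "g \<in> holo U"
    and "\<And>y. y \<in> U \<Longrightarrow> f y = f' y" "\<And>y. y \<in> U \<Longrightarrow> g y = g' y"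
  shows "form_bracket f' g' A = form_bracket f g A"
  using dd_cong[OF assms(3,1,2,5)] dd_cong[OF assms(4,1,2,6)] by (simp add: form_bracket_def)

text \<open>On invertible pairs a function of the coset is a function of the form, as
  \<open>coset (form_section (form_of y)) = coset y\<close>; so the formula for pullbacks along
  \<open>form_of\<close> applies. Both the existence of the quotient bracket and the Poisson
  property of the inverse of \<open>iota\<close> rest on this.\<close>

lemma gl2_bracket_coset:
  assumes V: "open (preim V)" and f: "f \<circ> coset \<in> holo (preim V)" and g: "g \<circ> coset \<in> holo (preim V)"
    and x: "x \<in> preim V"
  shows "gl2_bracket (f \<circ> coset) (g \<circ> coset) x
    = form_bracket (f \<circ> coset \<circ> form_section) (g \<circ> coset \<circ> form_section) (form_of x)"
proof -
  have "form_of x \<in> {A \<in> GLset. coset (form_section A) \<in> V}"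
    using x form_of_invertible[of x] coset_section[of x] by simp
  note * = gl2_bracket_form_of[OF holo_coset_section[OF f] holo_coset_section[OF g] this]
  have eq: "(h \<circ> coset) y = (h \<circ> coset \<circ> form_section \<circ> form_of) y" if "y \<in> preim V"
    for h :: "_ \<Rightarrow> complex" and y
    using coset_section[of y] that by simp
  show ?thesis
    unfolding *[symmetric]
    by (rule gl2_bracket_local[symmetric, OF V x f g]) (rule eq, assumption)+
qed

lemma poisson_map_coset:
  "poisson_map GL2_space (quotient_space GL2_space coset quotient_bracket) coset"
  unfolding poisson_map_def holo_map_def
proof (intro conjI allI impI ballI)
  show "continuous_map (topol GL2_space) (topol (quotient_space GL2_space coset quotient_bracket)) coset"
    unfolding continuous_map
  proof (intro conjI allI impI)
    show "coset ` topspace (topol GL2_space)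
        \<subseteq> topspace (topol (quotient_space GL2_space coset quotient_bracket))"
      by (simp add: topspace_quotient_space) (simp add: open_space_def)
  next
    fix V assume "openin (topol (quotient_space GL2_space coset quotient_bracket)) V"
    then show "openin (topol GL2_space) {x \<in> topspace (topol GL2_space). coset x \<in> V}"
      by (simp add: quotient_space_def openin_quotient_top)
  qed
next
  fix V f assume "f \<in> hol (quotient_space GL2_space coset quotient_bracket) V"
  then show "f \<circ> coset \<in> hol GL2_space {x \<in> topspace (topol GL2_space). coset x \<in> V}"
    by (simp add: quotient_space_def)
next
  fix V f g x
  assume V: "openin (topol (quotient_space GL2_space coset quotient_bracket)) V"
    and f: "f \<in> hol (quotient_space GL2_space coset quotient_bracket) V"
    and g: "g \<in> hol (quotient_space GL2_space coset quotient_bracket) V"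
    and x: "x \<in> topspace (topol GL2_space)" "coset x \<in> V"
  have x': "x \<in> preim V" "x \<in> GLset \<times> GLset"
    using x by (simp_all add: open_space_def)
  show "pbr GL2_space (f \<circ> coset) (g \<circ> coset) x
      = pbr (quotient_space GL2_space coset quotient_bracket) f g (coset x)"
    using gl2_bracket_coset[of V f g x] V f g x' iota_coset[OF x'(2)]
    by (simp add: openin_quotient_iff hol_quotient_iff pbr_quotient_space quotient_bracket_def)
      (simp add: open_space_def)
qed

lemma quotient_poisson_bracket_quotient_bracket:
  "quotient_poisson_bracket GL2_space coset quotient_bracket"
  unfolding quotient_poisson_bracket_def
proof (intro conjI poisson_map_coset poisson_structure_image[OF _ poisson_map_coset])
  let ?Q = "quotient_space GL2_space coset quotient_bracket"
  show "poisson_structure GL2_space"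
    by (rule poisson_structure_gl2[OF open_GL2])
  show "topspace (topol ?Q) \<subseteq> coset ` topspace (topol GL2_space)"
    by (simp add: topspace_quotient_space) (simp add: open_space_def)
  fix V f g assume V: "openin (topol ?Q) V" and f: "f \<in> hol ?Q V" and g: "g \<in> hol ?Q V"
  have V': "open (preim V)" and f': "f \<circ> coset \<in> holo (preim V)" and g': "g \<circ> coset \<in> holo (preim V)"
    using V f g by (simp_all add: openin_quotient_iff hol_quotient_iff)
  show "pbr ?Q f g \<in> hol ?Q V"
    unfolding hol_quotient_iff pbr_quotient_space
  proof (rule holo_cong[OF gl2_bracket_holo[OF V' f' g'] V'])
    fix x assume x: "x \<in> preim V"
    then show "gl2_bracket (f \<circ> coset) (g \<circ> coset) x = (quotient_bracket f g \<circ> coset) x"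
      using gl2_bracket_coset[OF V' f' g' x] iota_coset[of x] by (simp add: quotient_bracket_def)
  qed
  show "(\<lambda>y. a * f y + b * g y) \<in> hol ?Q V" for a b
    using holo_add[OF holo_mult[OF holo_const f'] holo_mult[OF holo_const g'], of a b]
    unfolding hol_quotient_iff by (simp add: comp_def)
  show "(\<lambda>y. f y * g y) \<in> hol ?Q V"
    using holo_mult[OF f' g'] unfolding hol_quotient_iff by (simp add: comp_def)
qed

text \<open>The projection is Poisson and every point of the quotient is a coset, so the values of
  \<open>br\<close> are forced. Open sets and holomorphic functions of the quotient do not involve
  its bracket; stating them relative to \<open>br'\<close> permits comparing two brackets.\<close>

lemma quotient_poisson_bracket_apply:
  assumes br: "quotient_poisson_bracket GL2_space coset br"
    and V: "openin (topol (quotient_space GL2_space coset br')) V"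
    and f: "f \<in> hol (quotient_space GL2_space coset br') V"
    and g: "g \<in> hol (quotient_space GL2_space coset br') V"
    and x: "x \<in> GLset \<times> GLset" "coset x \<in> V"
  shows "br f g (coset x) = gl2_bracket (f \<circ> coset) (g \<circ> coset) x"
proof -
  let ?Q = "quotient_space GL2_space coset br"
  have "openin (topol ?Q) V" "f \<in> hol ?Q V" "g \<in> hol ?Q V"
    using V f g by (simp_all add: openin_quotient_iff hol_quotient_iff)
  moreover have "x \<in> topspace (topol GL2_space)"
    using x by (simp add: open_space_def)
  moreover have "poisson_map GL2_space ?Q coset"
    using br by (simp add: quotient_poisson_bracket_def)
  ultimately have "pbr GL2_space (f \<circ> coset) (g \<circ> coset) x = pbr ?Q f g (coset x)"
    using x(2) unfolding poisson_map_def by blast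
  then show ?thesis
    by (simp add: pbr_quotient_space) (simp add: open_space_def)
qed

lemma quotient_bracket_unique:
  assumes br: "quotient_poisson_bracket GL2_space coset br"
    and br': "quotient_poisson_bracket GL2_space coset br'"
    and V: "openin (topol (quotient_space GL2_space coset br)) V"
    and f: "f \<in> hol (quotient_space GL2_space coset br) V"
    and g: "g \<in> hol (quotient_space GL2_space coset br) V"
    and Q: "Q \<in> V"
  shows "br' f g Q = br f g Q"
proof -
  obtain x where x: "x \<in> GLset \<times> GLset" "Q = coset x"
    using V Q by (auto simp: openin_quotient_iff)
  then show ?thesis
    using quotient_poisson_bracket_apply[OF br V f g x(1)] quotient_poisson_bracket_apply[OF br' V f g x(1)] Q
    by simp
qed

section \<open>The quotient identified with the invertible forms\<close>

lemma iota_preim: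
  "preim {P \<in> coset ` (GLset \<times> GLset). iota P \<in> V} = {x \<in> GLset \<times> GLset. form_of x \<in> V}"
  using iota_coset by fastforce

text \<open>\<open>T\<close> covers both targets: the space of all forms and its open subset of
  invertible forms, in which every value of \<open>iota\<close> lies.\<close>

lemma poisson_map_iota:
  assumes br: "quotient_poisson_bracket GL2_space coset br"
    and T: "open T" "GLset \<subseteq> T"
  shows "poisson_map (quotient_space GL2_space coset br) (open_space T form_bracket) iota"
  unfolding poisson_map_def holo_map_def
proof (intro conjI allI impI ballI)
  let ?Q = "quotient_space GL2_space coset br" and ?A = "open_space T form_bracket"
  have open_V: "open V" "V \<subseteq> T" if "openin (topol ?A) V" for V
    using that T(1) by (auto simp: open_space_def openin_open_eq)
  have pre: "openin (topol ?Q) {P \<in> topspace (topol ?Q). iota P \<in> V}"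
    if "openin (topol ?A) V" for V
    unfolding openin_quotient_iff topspace_quotient_space iota_preim
    using open_preimage[OF open_GL2 open_V(1)[OF that] cderiv_form_of] by blast
  have hol: "f \<circ> iota \<in> hol ?Q {P \<in> topspace (topol ?Q). iota P \<in> V}"
    if V: "openin (topol ?A) V" and f: "f \<in> hol ?A V" for V f
    unfolding hol_quotient_iff topspace_quotient_space iota_preim
  proof (rule holo_cong[of "f \<circ> form_of"])
    show "f \<circ> form_of \<in> holo {x \<in> GLset \<times> GLset. form_of x \<in> V}"
      using f by (intro holo_comp[OF _ _ cderiv_form_of, of f V]) (auto simp: open_space_def)
    show "open {x \<in> GLset \<times> GLset. form_of x \<in> V}"
      by (rule open_preimage[OF open_GL2 open_V(1)[OF V] cderiv_form_of])
  qed (simp add: iota_coset del: mem_Sigma_iff)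
  show "continuous_map (topol ?Q) (topol ?A) iota"
    unfolding continuous_map
  proof (intro conjI allI impI)
    show "iota ` topspace (topol ?Q) \<subseteq> topspace (topol ?A)"
    proof
      fix A assume "A \<in> iota ` topspace (topol ?Q)"
      then obtain x where x: "x \<in> GLset \<times> GLset" "A = iota (coset x)"
        unfolding topspace_quotient_space by blast
      then have "invertible A"
        using form_of_invertible[OF x(1)] iota_coset[OF x(1)] by simp
      then show "A \<in> topspace (topol ?A)"
        using T(2) by (auto simp: open_space_def)
    qed
  qed (rule pre)
  show "f \<circ> iota \<in> hol ?Q {P \<in> topspace (topol ?Q). iota P \<in> V}"
    if "openin (topol ?A) V" "f \<in> hol ?A V" for V f
    by (rule hol[OF that])
  fix V f g P
  assume V: "openin (topol ?A) V" and f: "f \<in> hol ?A V" and g: "g \<in> hol ?A V"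
    and P: "P \<in> topspace (topol ?Q)" "iota P \<in> V"
  obtain x where x: "x \<in> GLset \<times> GLset" "P = coset x"
    using P(1) unfolding topspace_quotient_space by blast
  have xV: "form_of x \<in> V"
    using P(2) x by (simp add: iota_coset del: mem_Sigma_iff)
  let ?W = "{x \<in> GLset \<times> GLset. form_of x \<in> V}"
  have W: "open ?W"
    by (rule open_preimage[OF open_GL2 open_V(1)[OF V] cderiv_form_of])
  have fg: "f \<in> holo V" "g \<in> holo V"
    using f g by (simp_all add: open_space_def)
  have "br (f \<circ> iota) (g \<circ> iota) P = gl2_bracket (f \<circ> iota \<circ> coset) (g \<circ> iota \<circ> coset) x"
    using quotient_poisson_bracket_apply[OF br pre[OF V] hol[OF V f] hol[OF V g] x(1)] P
    unfolding x(2) by blast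
  also have "\<dots> = gl2_bracket (f \<circ> form_of) (g \<circ> form_of) x"
    by (rule gl2_bracket_local[OF W])
      (use x(1) xV fg in \<open>auto simp: iota_coset intro!: holo_comp[OF _ _ cderiv_form_of, of _ V]\<close>)
  also have "\<dots> = form_bracket f g (iota P)"
    using gl2_bracket_form_of[OF fg xV] x by (simp add: iota_coset del: mem_Sigma_iff)
  finally show "pbr ?Q (f \<circ> iota) (g \<circ> iota) P = pbr ?A f g (iota P)"
    by (simp add: pbr_quotient_space) (simp add: open_space_def)
qed

lemma bij_betw_iota: "bij_betw iota (coset ` (GLset \<times> GLset)) GLset"
proof (rule bij_betw_byWitness[where f' = "\<lambda>A. coset (form_section A)"])
  show "\<forall>P\<in>coset ` (GLset \<times> GLset). coset (form_section (iota P)) = P"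
    using iota_coset coset_section by fastforce
  show "\<forall>A\<in>GLset. iota (coset (form_section A)) = A"
    by (simp add: iota_coset[OF section_in])
  show "iota ` coset ` (GLset \<times> GLset) \<subseteq> GLset"
    using iota_coset form_of_invertible by fastforce
  show "(\<lambda>A. coset (form_section A)) ` GLset \<subseteq> coset ` (GLset \<times> GLset)"
    using section_in by blast
qed

lemma inv_into_iota:
  assumes "invertible A"
  shows "inv_into (coset ` (GLset \<times> GLset)) iota A = coset (form_section A)"
  by (rule inv_into_f_eq[OF bij_betw_imp_inj_on[OF bij_betw_iota]])
    (use section_in[OF assms] iota_coset[OF section_in[OF assms]] in auto)

text \<open>The inverse sends \<open>A\<close> to the coset of \<open>form_section A\<close>. At
  this representative \<open>gl2_bracket_coset\<close> yields the bracket on forms at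
  \<open>form_of (form_section A) = A\<close>, which is the Poisson property of the inverse.\<close>

lemma poisson_iso_iota:
  assumes br: "quotient_poisson_bracket GL2_space coset br"
  shows "poisson_iso (quotient_space GL2_space coset br) (open_space GLset form_bracket) iota"
  unfolding poisson_iso_def
proof (intro conjI)
  let ?Q = "quotient_space GL2_space coset br" and ?A = "open_space GLset form_bracket"
  let ?j = "inv_into (topspace (topol ?Q)) iota"
  have topA: "topspace (topol ?A) = GLset"
    by (simp add: open_space_def)
  show "bij_betw iota (topspace (topol ?Q)) (topspace (topol ?A))"
    using bij_betw_iota unfolding topA topspace_quotient_space .
  show "poisson_map ?Q ?A iota"
    by (rule poisson_map_iota[OF br open_invertible]) simp
  have j: "?j A = coset (form_section A)" if "invertible A" for A
    using inv_into_iota[OF that] by (simp only: topspace_quotient_space)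
  let ?U = "\<lambda>V. {A \<in> GLset. coset (form_section A) \<in> V}"
  have U: "{A \<in> topspace (topol ?A). ?j A \<in> V} = ?U V" for V
    unfolding topA using j by auto
  have open_U: "open (?U V)" if "openin (topol ?Q) V" for V
    using that by (intro section_preimage) (simp add: openin_quotient_iff)
  have hol: "f \<circ> ?j \<in> holo (?U V)" if "openin (topol ?Q) V" "f \<in> hol ?Q V" for V f
    by (rule holo_cong[OF holo_coset_section open_U[OF that(1)]])
      (use that(2) j in \<open>auto simp: hol_quotient_iff\<close>)
  show "poisson_map ?A ?Q ?j"
    unfolding poisson_map_def holo_map_def
  proof (intro conjI allI impI ballI)
    show "continuous_map (topol ?A) (topol ?Q) ?j"
      unfolding continuous_map U
    proof (intro conjI allI impI)
      show "?j ` topspace (topol ?A) \<subseteq> topspace (topol ?Q)"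
        unfolding topA topspace_quotient_space[of br]
        using j section_in by (auto simp: topspace_quotient_space)
      show "openin (topol ?A) (?U V)" if "openin (topol ?Q) V" for V
        using open_U[OF that] by (auto simp: open_space_def openin_open_eq[OF open_invertible])
    qed
    show "f \<circ> ?j \<in> hol ?A {A \<in> topspace (topol ?A). ?j A \<in> V}"
      if "openin (topol ?Q) V" "f \<in> hol ?Q V" for V f
      unfolding U using hol[OF that] by (simp add: open_space_def)
    fix V f g A
    assume V: "openin (topol ?Q) V" and f: "f \<in> hol ?Q V" and g: "g \<in> hol ?Q V"
      and A: "A \<in> topspace (topol ?A)" "?j A \<in> V"
    have inv: "invertible A" and AU: "A \<in> ?U V"
      using A j by (auto simp: topA)
    note s = section_in[OF inv]
    have V': "open (preim V)" and f': "f \<circ> coset \<in> holo (preim V)" and g': "g \<circ> coset \<in> holo (preim V)"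
      using V f g by (simp_all add: openin_quotient_iff hol_quotient_iff)
    have "br f g (?j A) = gl2_bracket (f \<circ> coset) (g \<circ> coset) (form_section A)"
      using quotient_poisson_bracket_apply[OF br V f g s] AU by (simp add: j[OF inv])
    also have "\<dots> = form_bracket (f \<circ> coset \<circ> form_section) (g \<circ> coset \<circ> form_section) A"
      using gl2_bracket_coset[OF V' f' g', of "form_section A"] s AU by simp
    also have "\<dots> = form_bracket (f \<circ> ?j) (g \<circ> ?j) A"
      by (rule form_bracket_local[OF open_U[OF V] AU hol[OF V f] hol[OF V g]]) (simp_all add: j)
    finally show "pbr ?A (f \<circ> ?j) (g \<circ> ?j) A = pbr ?Q f g (?j A)"
      by (simp add: pbr_quotient_space) (simp add: open_space_def)
  qed
qed

text \<open>The defining property constrains a quotient bracket on holomorphic functions only; hence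
  the shape of the uniqueness clause and the quantification over all such \<open>br\<close>. The
  image of \<open>iota\<close> is the set of invertible forms, so \<open>iota\<close> is a Poisson
  map into all forms and an isomorphism onto this open subset.\<close>

theorem theorem3p3:
  fixes G :: "('n::{finite,linorder} cmat \<times> 'n cmat) monoid"
    and br_G :: "('n cmat \<times> 'n cmat \<Rightarrow> complex) \<Rightarrow> ('n cmat \<times> 'n cmat \<Rightarrow> complex)
                   \<Rightarrow> 'n cmat \<times> 'n cmat \<Rightarrow> complex"
    and M_G :: "('n cmat \<times> 'n cmat) poisson_space"
    and br_A :: "('n cmat \<Rightarrow> complex) \<Rightarrow> ('n cmat \<Rightarrow> complex) \<Rightarrow> 'n cmat \<Rightarrow> complex"
    and H :: "('n cmat \<times> 'n cmat) set"
    and proj :: "'n cmat \<times> 'n cmat \<Rightarrow> ('n cmat \<times> 'n cmat) set"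
  assumes "G = GL2" and "br_G = gl2_bracket" and "M_G = open_space (carrier G) br_G"
    and "br_A = form_bracket"
    and "H = {g \<in> carrier G. Theta g = g}" and "proj = (\<lambda>g. g <#\<^bsub>G\<^esub> H)"
  shows
    "(\<forall>B C. (B, C) \<in> carrier G \<longrightarrow>
        tensor_bracket br_G fst fst (B, C)
          = r_mat ** in1 B ** in2 B - in1 B ** in2 B ** r_mat \<and>
        tensor_bracket br_G snd snd (B, C)
          = r_mat ** in1 C ** in2 C - in1 C ** in2 C ** r_mat \<and>
        tensor_bracket br_G snd fst (B, C)
          = r_mat ** in1 C ** in2 B - in1 C ** in2 B ** r_mat) \<and>
     poisson_symmetric_lie_group G br_G Theta \<and>
     (\<forall>A. tensor_bracket br_A id id A
          = r_mat ** in1 A ** in2 A - in1 A ** in2 A ** r_mat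
            + in1 A ** transpose1 r_mat ** in2 A - in2 A ** transpose1 r_mat ** in1 A) \<and>
     poisson_structure (open_space UNIV br_A) \<and>
     (\<exists>br. quotient_poisson_bracket M_G proj br \<and>
       (\<forall>br'. quotient_poisson_bracket M_G proj br' \<longrightarrow>
          (\<forall>V. openin (topol (quotient_space M_G proj br)) V \<longrightarrow>
            (\<forall>f\<in>hol (quotient_space M_G proj br) V.
             \<forall>g\<in>hol (quotient_space M_G proj br) V.
             \<forall>x\<in>V. br' f g x = br f g x)))) \<and>
     (\<forall>B C. (B, C) \<in> carrier G \<longrightarrow> iota (proj (B, C)) = B ** transpose C) \<and>
     (\<forall>br. quotient_poisson_bracket M_G proj br \<longrightarrow>
       poisson_map (quotient_space M_G proj br) (open_space UNIV br_A) iota \<and>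
       poisson_iso (quotient_space M_G proj br)
         (open_space {A. invertible A} br_A) iota)"
proof -
  have M: "M_G = GL2_space"
    using assms by simp
  have proj: "proj = coset"
    using assms by (simp add: fun_eq_iff coset_def Hfix_def)
  show ?thesis
    unfolding M proj \<open>G = GL2\<close> \<open>br_G = gl2_bracket\<close> \<open>br_A = form_bracket\<close>
  proof (intro conjI allI impI)
    fix B C :: "'n cmat"
    show "tensor_bracket gl2_bracket fst fst (B, C) = r_mat ** in1 B ** in2 B - in1 B ** in2 B ** r_mat"
      "tensor_bracket gl2_bracket snd snd (B, C) = r_mat ** in1 C ** in2 C - in1 C ** in2 C ** r_mat"
      "tensor_bracket gl2_bracket snd fst (B, C) = r_mat ** in1 C ** in2 B - in1 C ** in2 B ** r_mat"
      by (simp_all add: tensor_bracket_gl2 rr_def)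
    show "iota (coset (B, C)) = B ** transpose C" if "(B, C) \<in> carrier GL2"
      using iota_coset[of "(B, C)"] that by (simp add: form_of_def)
  next
    show "tensor_bracket form_bracket id id A
        = r_mat ** in1 A ** in2 A - in1 A ** in2 A ** r_mat
          + in1 A ** transpose1 r_mat ** in2 A - in2 A ** transpose1 r_mat ** in1 A" for A :: "'n cmat"
      by (simp add: tensor_bracket_form form_tensor_def)
    show "\<exists>br. quotient_poisson_bracket GL2_space (coset :: 'n cmat \<times> 'n cmat \<Rightarrow> _) br \<and>
       (\<forall>br'. quotient_poisson_bracket GL2_space coset br' \<longrightarrow>
          (\<forall>V. openin (topol (quotient_space GL2_space coset br)) V \<longrightarrow>
            (\<forall>f\<in>hol (quotient_space GL2_space coset br) V.
             \<forall>g\<in>hol (quotient_space GL2_space coset br) V.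
             \<forall>x\<in>V. br' f g x = br f g x)))"
      using quotient_poisson_bracket_quotient_bracket quotient_bracket_unique by blast
  qed (simp_all add: poisson_symmetric_lie_group_GL2 poisson_structure_form poisson_map_iota poisson_iso_iota)
qed

end
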